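(* Let $\mathfrak g=\mathrm{osp}(1|2n)$, let $\mathrm U_q(\mathfrak k)$ be a reductive subalgebra of $\mathrm U_q(\mathfrak g)$, and let $V$ be a finite-dimensional $\mathrm U_q(\mathfrak k)$-module. Let $W$ be a $\mathrm U_q(\mathfrak g)$-module, the restriction of which furnishes a $\mathrm U_q(\mathfrak k)$-module in a natural way. Then there exists a canonical isomorphism $$\mathrm{Hom}_{\mathrm U_q(\mathfrak g)}\bigl(W,\Gamma_q^{\mathfrak k}(V)\bigr)\;\cong\;\mathrm{Hom}_{\mathrm U_q(\mathfrak k)}(W,V),$$ where $\mathrm U_q(\mathfrak g)$ acts on the left module $\Gamma_q^{\mathfrak k}(V)$ via the $\cdot$ action.
   Context: **The quantum superalgebra.** $n\ge 1$; $q\in\mathbb C^{*}$ is generic. Algebras, modules and maps are $\mathbb Z_2$-graded over $\mathbb C$; $[x]\in\{0,1\}$ is the parity of a homogeneous $x$; the usual sign rule $(a\otimes b)(c\otimes d)=(-1)^{[b][c]}ac\otimes bd$ holds. Let $\epsilon_1,\dots,\epsilon_n$ be an orthonormal basis of an $n$-dimensional Euclidean space $E$, $\alpha_i=\epsilon_i-\epsilon_{i+1}$ ($i<n$), $\alpha_n=\epsilon_n$, $a_{ij}=2(\alpha_i,\alpha_j)/(\alpha_i,\alpha_i)$. $\mathrm U_q(\mathfrak g)$, $\mathfrak g=\mathrm{osp}(1|2n)$, is the $\mathbb Z_2$-graded unital associative algebra generated by $k_i^{\pm1},e_i,f_i$ ($1\le i\le n$), all even except $e_n,f_n$ which are odd,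 with relations $k_ik_i^{-1}=1$, $k_ik_j=k_jk_i$, $k_ie_j=q^{(\alpha_i,\alpha_j)}e_jk_i$, $k_if_j=q^{-(\alpha_i,\alpha_j)}f_jk_i$, $e_if_j-(-1)^{[e_i][f_j]}f_je_i=\delta_{ij}\frac{k_i-k_i^{-1}}{q-q^{-1}}$, and $(\mathrm{Ad}\,e_i)^{1-a_{ij}}(e_j)=0=(\mathrm{Ad}\,f_i)^{1-a_{ij}}(f_j)$ for $i\ne j$, where $\mathrm{Ad}\,e_i(x)=e_ix-(-1)^{[e_i][x]}k_ixk_i^{-1}e_i$ and $\mathrm{Ad}\,f_i(x)=f_ix-(-1)^{[f_i][x]}k_ixk_i^{-1}f_i$. It is a $\mathbb Z_2$-graded Hopf algebra with $\Delta(k_i^{\pm1})=k_i^{\pm1}\otimes k_i^{\pm1}$, $\Delta(e_i)=e_i\otimes k_i+1\otimes e_i$, $\Delta(f_i)=f_i\otimes 1+k_i^{-1}\otimes f_i$, $\epsilon(k_i)=1$, $\epsilon(e_i)=\epsilon(f_i)=0$, $S(k_i)=k_i^{-1}$, $S(e_i)=-e_ik_i^{-1}$, $S(f_i)=-k_if_i$ ($S$ is a graded anti-automorphism). **Subalgebra and homomorphisms.** For a subset $\Theta\subseteq\{1,\dots,n\}$, the reductive subalgebra $\mathrm U_q(\mathfrak k)$ is the $\mathbb Z_2$-graded Hopf subalgebra generated by all $k_i^{\pm1}$ ($1\le i\le n$) and by $e_j,f_j$ with $j\in\Theta$. $\mathrm{Hom}$ spaces of module homomorphisms are $\mathbb Z_2$-graded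 vector spaces: they are spanned by homogeneous linear maps $\phi$ (even or odd) with $x\,\phi(w)=(-1)^{[\phi][x]}\phi(xw)$. **Functions on $\mathrm{OSP}_q(1|2n)$.** The finite dual $(\mathrm U_q(\mathfrak g))^0$ (functionals whose kernel contains a two-sided ideal of finite codimension) is a $\mathbb Z_2$-graded Hopf algebra with unit $\epsilon$, product $\langle fg,a\rangle=\sum_{(a)}(-1)^{[g][a_{(1)}]}\langle f,a_{(1)}\rangle\langle g,a_{(2)}\rangle$, coproduct determined by $\langle f,ab\rangle=\sum_{(f)}(-1)^{[f_{(1)}][f_{(2)}]}\langle f_{(1)},a\rangle\langle f_{(2)},b\rangle$, counit $f\mapsto\langle f,1\rangle$, antipode $\langle S(f),a\rangle=\langle f,S(a)\rangle$. $\mathcal T_q(\mathfrak g)$ is its $\mathbb Z_2$-graded subalgebra (in fact a Hopf subalgebra) generated by the matrix elements of the vector representation, i.e. of the irreducible $(2n+1)$-dimensional module with highest weight $\epsilon_1$ (even highest weight vector $v_+$: $e_iv_+=0$, $k_iv_+=q^{(\epsilon_1,\alpha_i)}v_+$). **Induced modules.** $\mathrm U_q(\mathfrak g)$ acts on $\mathcal T_q(\mathfrak g)$ in two ways: $x\circ f=\sum_{(f)}(-1)^{[f_{(1)}][f_{(2)}]}f_{(1)}\langle f_{(2)},x\rangle$, and $x\cdot f=\sum_{(f)}\langle f_{(1)},S^{-1}(x)\rangle f_{(2)}$. Both extend to $V\otimes\mathcal T_q(\mathfrak g)$ by $x\circ(v\otimes f)=(-1)^{[x][v]}v\otimes x\circ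 f$ and $x\cdot(v\otimes f)=(-1)^{[x][v]}v\otimes x\cdot f$. Define $$\Gamma_q^{\mathfrak k}(V)=\{\zeta\in V\otimes\mathcal T_q(\mathfrak g): x\circ\zeta=(S(x)\otimes\mathrm{id})\zeta\ \ \forall x\in\mathrm U_q(\mathfrak k)\},$$ which is a left $\mathrm U_q(\mathfrak g)$-module under the $\cdot$ action.
   Formalization: W is additionally assumed to be a comodule over T_q(g): for each w, x ↦ xw comes from an element of W⊗T_q(g). Without it the claim fails, e.g. for the 1-dimensional W with e_i=f_i=0, k_n=-1, other k_i=1, Θ empty and V=W. *)

theory Defs
  imports
    Complex_Main
    "HOL-Library.Z2"
    "HOL-Library.Poly_Mapping"
    "HOL-Library.Function_Algebras"
    "HOL-Algebra.QuotRing"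
begin

section \<open>The free algebra\<close>

text \<open>Words form a monoid under concatenation, so that finitely supported functions on words,
  with the convolution product of \<^theory>\<open>HOL-Library.Poly_Mapping\<close>, are the free algebra.\<close>

instantiation list :: (type) monoid_add
begin

definition zero_list :: "'a list" where "zero_list = []"

definition plus_list :: "'a list \<Rightarrow> 'a list \<Rightarrow> 'a list" where "plus_list u v = u @ v"

instance by standard (simp_all add: zero_list_def plus_list_def)

end

datatype gen = K nat | Kinv nat | E nat | F nat

type_synonym falg = "gen list \<Rightarrow>\<^sub>0 complex"

fun gen_index :: "gen \<Rightarrow> nat" where
  "gen_index (K i) = i"
| "gen_index (Kinv i) = i"
| "gen_index (E i) = i"
| "gen_index (F i) = i"

text \<open>The degree in \<open>\<int>/2\<close>: only the last pair of root vectors is odd.\<close>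

fun gen_parity :: "nat \<Rightarrow> gen \<Rightarrow> bit" where
  "gen_parity n (K i) = 0"
| "gen_parity n (Kinv i) = 0"
| "gen_parity n (E i) = of_bool (i = n)"
| "gen_parity n (F i) = of_bool (i = n)"

definition word_parity :: "nat \<Rightarrow> gen list \<Rightarrow> bit" where
  "word_parity n w = (\<Sum>g\<leftarrow>w. gen_parity n g)"

definition sgn2 :: "bit \<Rightarrow> bit \<Rightarrow> complex" where
  "sgn2 a b = (if a = 1 \<and> b = 1 then - 1 else 1)"

definition mon :: "gen list \<Rightarrow> falg" where
  "mon w = Poly_Mapping.single w 1"

abbreviation gen :: "gen \<Rightarrow> falg" where
  "gen g \<equiv> mon [g]"

definition const :: "complex \<Rightarrow> falg" where
  "const c = Poly_Mapping.single [] c"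

definition pm_scale :: "complex \<Rightarrow> ('a \<Rightarrow>\<^sub>0 complex) \<Rightarrow> 'a \<Rightarrow>\<^sub>0 complex" where
  "pm_scale c p = Poly_Mapping.map (\<lambda>z. c * z) p"

text \<open>The linear extension of a map given on words.\<close>

definition lin_ext :: "(gen list \<Rightarrow> 'a \<Rightarrow>\<^sub>0 complex) \<Rightarrow> falg \<Rightarrow> 'a \<Rightarrow>\<^sub>0 complex" where
  "lin_ext h a = (\<Sum>w\<in>Poly_Mapping.keys a. pm_scale (Poly_Mapping.lookup a w) (h w))"

definition free_alg :: "nat \<Rightarrow> falg ring" where
  "free_alg n =
     \<lparr>carrier = {a. \<forall>w\<in>Poly_Mapping.keys a. \<forall>g\<in>set w. gen_index g \<in> {1..n}},
      mult = (*), one = 1, zero = 0, add = (+)\<rparr>"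

section \<open>The quantum superalgebra of osp(1|2n)\<close>

text \<open>Coordinates of the simple roots with respect to the orthonormal basis
  \<open>\<epsilon>\<^sub>1, \<dots>, \<epsilon>\<^sub>n\<close>.\<close>

definition eps :: "nat \<Rightarrow> nat \<Rightarrow> int" where
  "eps i = (\<lambda>j. of_bool (j = i))"

definition simple_root :: "nat \<Rightarrow> nat \<Rightarrow> nat \<Rightarrow> int" where
  "simple_root n i = (if i < n then (\<lambda>j. eps i j - eps (i + 1) j) else eps n)"

definition ip :: "nat \<Rightarrow> (nat \<Rightarrow> int) \<Rightarrow> (nat \<Rightarrow> int) \<Rightarrow> int" where
  "ip n x y = (\<Sum>j=1..n. x j * y j)"

text \<open>The division is exact: \<open>(\<alpha>\<^sub>i, \<alpha>\<^sub>i)\<close> is 2 for \<open>i < n\<close> and 1 for \<open>i = n\<close>.\<close>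

definition cartan :: "nat \<Rightarrow> nat \<Rightarrow> nat \<Rightarrow> int" where
  "cartan n i j =
     2 * ip n (simple_root n i) (simple_root n j) div ip n (simple_root n i) (simple_root n i)"

text \<open>The linear map \<open>x \<mapsto> (-1)\<^bsup>p[x]\<^esup> x\<close>.\<close>

definition sign_twist :: "nat \<Rightarrow> bit \<Rightarrow> falg \<Rightarrow> falg" where
  "sign_twist n p = lin_ext (\<lambda>w. pm_scale (sgn2 p (word_parity n w)) (mon w))"

definition Ad_E :: "nat \<Rightarrow> nat \<Rightarrow> falg \<Rightarrow> falg" where
  "Ad_E n i x =
     gen (E i) * x - gen (K i) * sign_twist n (gen_parity n (E i)) x * gen (Kinv i) * gen (E i)"

definition Ad_F :: "nat \<Rightarrow> nat \<Rightarrow> falg \<Rightarrow> falg" where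
  "Ad_F n i x =
     gen (F i) * x - gen (K i) * sign_twist n (gen_parity n (F i)) x * gen (Kinv i) * gen (F i)"

definition osp_relations :: "nat \<Rightarrow> complex \<Rightarrow> falg set" where
  "osp_relations n q = (\<Union>i\<in>{1..n}.
     {gen (K i) * gen (Kinv i) - 1, gen (Kinv i) * gen (K i) - 1} \<union>
     (\<Union>j\<in>{1..n}.
       {gen (K i) * gen (K j) - gen (K j) * gen (K i),
        gen (K i) * gen (E j)
          - const (q powi ip n (simple_root n i) (simple_root n j)) * gen (E j) * gen (K i),
        gen (K i) * gen (F j)
          - const (q powi (- ip n (simple_root n i) (simple_root n j))) * gen (F j) * gen (K i),
        gen (E i) * gen (F j)
          - const (sgn2 (gen_parity n (E i)) (gen_parity n (F j))) * gen (F j) * gen (E i)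
          - (if i = j then const (1 / (q - inverse q)) * (gen (K i) - gen (Kinv i)) else 0)} \<union>
       (if i = j then {} else
         {(Ad_E n i ^^ nat (1 - cartan n i j)) (gen (E j)),
          (Ad_F n i ^^ nat (1 - cartan n i j)) (gen (F j))})))"

definition osp_ideal :: "nat \<Rightarrow> complex \<Rightarrow> falg set" where
  "osp_ideal n q = Idl\<^bsub>free_alg n\<^esub> (osp_relations n q)"

text \<open>Elements of the algebra are cosets; its \<open>\<complex>\<close>-linear structure is multiplication by the
  classes of constants.\<close>

type_synonym uq = "falg set"

definition Uq :: "nat \<Rightarrow> complex \<Rightarrow> uq ring" where
  "Uq n q = free_alg n Quot osp_ideal n q"

definition cls :: "nat \<Rightarrow> complex \<Rightarrow> falg \<Rightarrow> uq" where
  "cls n q a = osp_ideal n q +>\<^bsub>free_alg n\<^esub> a"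

definition rep :: "uq \<Rightarrow> falg" where
  "rep x = (SOME a. a \<in> x)"

definition uscale :: "nat \<Rightarrow> complex \<Rightarrow> complex \<Rightarrow> uq \<Rightarrow> uq" where
  "uscale n q c x = cls n q (const c) \<otimes>\<^bsub>Uq n q\<^esub> x"

definition upart :: "nat \<Rightarrow> complex \<Rightarrow> bit \<Rightarrow> uq set" where
  "upart n q p = cls n q `
     {a \<in> carrier (free_alg n). \<forall>w\<in>Poly_Mapping.keys a. word_parity n w = p}"

text \<open>The decomposition of an element into its homogeneous components.\<close>

definition ucomps :: "nat \<Rightarrow> complex \<Rightarrow> uq \<Rightarrow> bit \<Rightarrow> uq" where
  "ucomps n q x = (SOME c. (\<forall>p. c p \<in> upart n q p) \<and> x = c 0 \<oplus>\<^bsub>Uq n q\<^esub> c 1)"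

lemma free_alg_simps [simp]:
  "mult (free_alg n) = (*)" "one (free_alg n) = 1" "zero (free_alg n) = 0" "add (free_alg n) = (+)"
  by (simp_all add: free_alg_def)

lemma free_alg_plus_closed:
  "a \<in> carrier (free_alg n) \<Longrightarrow> b \<in> carrier (free_alg n) \<Longrightarrow> a + b \<in> carrier (free_alg n)"
  using Poly_Mapping.keys_add[of a b] by (auto simp: free_alg_def)

lemma free_alg_uminus_closed:
  "a \<in> carrier (free_alg n) \<Longrightarrow> - a \<in> carrier (free_alg n)"
  by (simp add: free_alg_def)

lemma free_alg_minus_closed:
  "a \<in> carrier (free_alg n) \<Longrightarrow> b \<in> carrier (free_alg n) \<Longrightarrow> a - b \<in> carrier (free_alg n)"
  using free_alg_plus_closed[of a n "- b"] free_alg_uminus_closed[of b n] by simp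

lemma free_alg_times_closed:
  assumes "a \<in> carrier (free_alg n)" "b \<in> carrier (free_alg n)"
  shows "a * b \<in> carrier (free_alg n)"
proof -
  have "\<exists>u\<in>Poly_Mapping.keys a. \<exists>v\<in>Poly_Mapping.keys b. w = u @ v"
    if "w \<in> Poly_Mapping.keys (a * b)" for w
    using that Poly_Mapping.keys_mult[of a b] unfolding plus_list_def by blast
  then show ?thesis
    using assms by (fastforce simp: free_alg_def)
qed

lemma free_alg_single_closed:
  "(\<forall>g\<in>set w. gen_index g \<in> {1..n}) \<Longrightarrow> Poly_Mapping.single w c \<in> carrier (free_alg n)"
  by (simp add: free_alg_def)

lemma free_alg_sum_closed:
  "(\<And>w. w \<in> A \<Longrightarrow> f w \<in> carrier (free_alg n)) \<Longrightarrow> sum f A \<in> carrier (free_alg n)"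
  by (induction A rule: infinite_finite_induct)
    (auto simp: free_alg_plus_closed, simp_all add: free_alg_def)

lemma free_alg_sign_twist_closed:
  assumes "a \<in> carrier (free_alg n)"
  shows "sign_twist n p a \<in> carrier (free_alg n)"
proof -
  have "pm_scale c (pm_scale d (mon w)) \<in> carrier (free_alg n)"
    if "w \<in> Poly_Mapping.keys a" for c d w
    using that assms by (auto simp: free_alg_def pm_scale_def mon_def split: if_splits)
  then show ?thesis
    unfolding sign_twist_def lin_ext_def by (intro free_alg_sum_closed) auto
qed

lemmas free_alg_closed = free_alg_plus_closed free_alg_minus_closed free_alg_times_closed
  free_alg_sign_twist_closed free_alg_uminus_closed

lemma ring_free_alg: "ring (free_alg n)"
proof (rule ringI)
  show "abelian_group (free_alg n)"
  proof (rule abelian_groupI)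
    show "\<exists>y\<in>carrier (free_alg n). y \<oplus>\<^bsub>free_alg n\<^esub> x = \<zero>\<^bsub>free_alg n\<^esub>"
      if "x \<in> carrier (free_alg n)" for x
      using free_alg_uminus_closed[OF that] by (intro bexI[of _ "- x"]) auto
  qed (auto simp: free_alg_closed add_ac, simp add: free_alg_def)
  show "Group.monoid (free_alg n)"
    by (rule Group.monoidI) (auto simp: free_alg_closed mult.assoc, simp add: free_alg_def zero_list_def)
qed (auto simp: algebra_simps)

lemma gen_closed: "gen_index g \<in> {1..n} \<Longrightarrow> gen g \<in> carrier (free_alg n)"
  unfolding mon_def by (rule free_alg_single_closed) auto

lemma const_closed: "const c \<in> carrier (free_alg n)"
  unfolding const_def by (rule free_alg_single_closed) auto

lemma osp_relations_closed: "osp_relations n q \<subseteq> carrier (free_alg n)"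
proof -
  have E: "(Ad_E n i ^^ m) (gen (E j)) \<in> carrier (free_alg n)"
    and F: "(Ad_F n i ^^ m) (gen (F j)) \<in> carrier (free_alg n)"
    if "i \<in> {1..n}" "j \<in> {1..n}" for i j m
    using that by (induction m)
      (auto simp: Ad_E_def Ad_F_def intro!: free_alg_closed gen_closed)
  have one: "1 \<in> carrier (free_alg n)" and zero: "0 \<in> carrier (free_alg n)"
    by (auto simp: free_alg_def zero_list_def)
  show ?thesis
    unfolding osp_relations_def
    using E F one zero
    by (auto split: if_splits intro!: free_alg_closed gen_closed const_closed)
qed

lemma ideal_osp_ideal: "ideal (osp_ideal n q) (free_alg n)"
  unfolding osp_ideal_def
  by (rule ring.genideal_ideal[OF ring_free_alg osp_relations_closed])

lemma ring_Uq: "ring (Uq n q)"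
  unfolding Uq_def by (rule ideal.quotient_is_ring[OF ideal_osp_ideal])

lemma cls_ring_hom: "cls n q \<in> ring_hom (free_alg n) (Uq n q)"
  using ideal.rcos_ring_hom[OF ideal_osp_ideal] unfolding Uq_def cls_def by simp

lemma cls_surj: "carrier (Uq n q) = cls n q ` carrier (free_alg n)"
  by (auto simp: Uq_def FactRing_def cls_def A_RCOSETS_def')

lemma ucomps:
  assumes "x \<in> carrier (Uq n q)"
  shows "ucomps n q x p \<in> upart n q p" and "x = ucomps n q x 0 \<oplus>\<^bsub>Uq n q\<^esub> ucomps n q x 1"
proof -
  obtain a where a: "a \<in> carrier (free_alg n)" "x = cls n q a"
    using assms cls_surj by auto
  define b where
    "b r = Poly_Mapping.mapp (\<lambda>w z. if word_parity n w = r then z else 0) a" for r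
  have b: "Poly_Mapping.lookup (b r) w = (if word_parity n w = r then Poly_Mapping.lookup a w else 0)"
    for r w
    by (auto simp: b_def lookup_mapp in_keys_iff when_def)
  have carr: "b r \<in> carrier (free_alg n)" for r
    using a(1) by (auto simp: free_alg_def b in_keys_iff split: if_splits)
  have "b 0 + b 1 = a"
    by (rule poly_mapping_eqI) (auto simp: b lookup_add)
  then have "x = cls n q (b 0) \<oplus>\<^bsub>Uq n q\<^esub> cls n q (b 1)"
    using ring_hom_add[OF cls_ring_hom carr carr, of q 0 1] a(2) by simp
  moreover have "cls n q (b r) \<in> upart n q r" for r
    using carr by (auto simp: upart_def b in_keys_iff split: if_splits)
  ultimately have "\<exists>c. (\<forall>p. c p \<in> upart n q p) \<and> x = c 0 \<oplus>\<^bsub>Uq n q\<^esub> c 1"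
    by (intro exI[of _ "\<lambda>r. cls n q (b r)"]) auto
  from someI_ex[OF this] show "ucomps n q x p \<in> upart n q p"
    and "x = ucomps n q x 0 \<oplus>\<^bsub>Uq n q\<^esub> ucomps n q x 1"
    unfolding ucomps_def by auto
qed

lemma upart_carrier: "x \<in> upart n q p \<Longrightarrow> x \<in> carrier (Uq n q)"
  by (auto simp: upart_def cls_surj)

section \<open>Hopf structure\<close>

text \<open>The structure maps are given on the free algebra by their values on the generators. They
  preserve the defining ideal (the coproduct maps it into the kernel of the projection to the
  tensor square of the quotient), so on the quotient they are computed on representatives.\<close>

fun counit_gen :: "gen \<Rightarrow> complex" where
  "counit_gen (K i) = 1"
| "counit_gen (Kinv i) = 1"
| "counit_gen (E i) = 0"
| "counit_gen (F i) = 0"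

definition free_counit :: "falg \<Rightarrow> complex" where
  "free_counit a =
     (\<Sum>w\<in>Poly_Mapping.keys a. Poly_Mapping.lookup a w * prod_list (map counit_gen w))"

fun antipode_gen :: "gen \<Rightarrow> falg" where
  "antipode_gen (K i) = gen (Kinv i)"
| "antipode_gen (Kinv i) = gen (K i)"
| "antipode_gen (E i) = - (gen (E i) * gen (Kinv i))"
| "antipode_gen (F i) = - (gen (K i) * gen (F i))"

fun antipode_word :: "nat \<Rightarrow> gen list \<Rightarrow> falg" where
  "antipode_word n [] = 1"
| "antipode_word n (g # w) =
     pm_scale (sgn2 (gen_parity n g) (word_parity n w)) (antipode_word n w * antipode_gen g)"

text \<open>The tensor square of the free algebra has pairs of words as a basis; its product carries
  the sign \<open>(a \<otimes> b)(c \<otimes> d) = (-1)\<^bsup>[b][c]\<^esup> ac \<otimes> bd\<close>.\<close>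

type_synonym falg2 = "(gen list \<times> gen list) \<Rightarrow>\<^sub>0 complex"

definition tmult :: "nat \<Rightarrow> falg2 \<Rightarrow> falg2 \<Rightarrow> falg2" where
  "tmult n s t =
     (\<Sum>(a, b)\<in>Poly_Mapping.keys s. \<Sum>(c, d)\<in>Poly_Mapping.keys t.
        Poly_Mapping.single (a @ c, b @ d)
          (sgn2 (word_parity n b) (word_parity n c)
            * Poly_Mapping.lookup s (a, b) * Poly_Mapping.lookup t (c, d)))"

abbreviation mon2 :: "gen list \<Rightarrow> gen list \<Rightarrow> falg2" where
  "mon2 u v \<equiv> Poly_Mapping.single (u, v) 1"

fun coproduct_gen :: "gen \<Rightarrow> falg2" where
  "coproduct_gen (K i) = mon2 [K i] [K i]"
| "coproduct_gen (Kinv i) = mon2 [Kinv i] [Kinv i]"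
| "coproduct_gen (E i) = mon2 [E i] [K i] + mon2 [] [E i]"
| "coproduct_gen (F i) = mon2 [F i] [] + mon2 [Kinv i] [F i]"

fun coproduct_word :: "nat \<Rightarrow> gen list \<Rightarrow> falg2" where
  "coproduct_word n [] = mon2 [] []"
| "coproduct_word n (g # w) = tmult n (coproduct_gen g) (coproduct_word n w)"

definition free_coproduct :: "nat \<Rightarrow> falg \<Rightarrow> falg2" where
  "free_coproduct n = lin_ext (coproduct_word n)"

definition antipode :: "nat \<Rightarrow> complex \<Rightarrow> uq \<Rightarrow> uq" where
  "antipode n q x = cls n q (lin_ext (antipode_word n) (rep x))"

definition antipode_inv :: "nat \<Rightarrow> complex \<Rightarrow> uq \<Rightarrow> uq" where
  "antipode_inv n q = inv_into (carrier (Uq n q)) (antipode n q)"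

text \<open>The reductive subalgebra; its coproduct and antipode are the restrictions.\<close>

inductive_set Uk :: "nat \<Rightarrow> complex \<Rightarrow> nat set \<Rightarrow> uq set"
  for n :: nat and q :: complex and \<Theta> :: "nat set" where
  one: "\<one>\<^bsub>Uq n q\<^esub> \<in> Uk n q \<Theta>"
| K: "i \<in> {1..n} \<Longrightarrow> cls n q (gen (K i)) \<in> Uk n q \<Theta>"
| Kinv: "i \<in> {1..n} \<Longrightarrow> cls n q (gen (Kinv i)) \<in> Uk n q \<Theta>"
| E: "i \<in> \<Theta> \<Longrightarrow> cls n q (gen (E i)) \<in> Uk n q \<Theta>"
| F: "i \<in> \<Theta> \<Longrightarrow> cls n q (gen (F i)) \<in> Uk n q \<Theta>"
| scale: "x \<in> Uk n q \<Theta> \<Longrightarrow> uscale n q c x \<in> Uk n q \<Theta>"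
| add: "x \<in> Uk n q \<Theta> \<Longrightarrow> y \<in> Uk n q \<Theta> \<Longrightarrow> x \<oplus>\<^bsub>Uq n q\<^esub> y \<in> Uk n q \<Theta>"
| mult: "x \<in> Uk n q \<Theta> \<Longrightarrow> y \<in> Uk n q \<Theta> \<Longrightarrow> x \<otimes>\<^bsub>Uq n q\<^esub> y \<in> Uk n q \<Theta>"

section \<open>Graded modules and their homomorphisms\<close>

text \<open>A graded module consists of a scalar multiplication, the even and the odd part (subspaces of
  the ambient type) and an action. Its underlying space is \<open>space_of M\<close>.\<close>

record 'm smod =
  scl :: "complex \<Rightarrow> 'm \<Rightarrow> 'm"
  part :: "bit \<Rightarrow> 'm set"
  act :: "uq \<Rightarrow> 'm \<Rightarrow> 'm"

definition space_of :: "('m::ab_group_add) smod \<Rightarrow> 'm set" where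
  "space_of M = {x + y | x y. x \<in> part M 0 \<and> y \<in> part M 1}"

definition is_module ::
    "nat \<Rightarrow> complex \<Rightarrow> uq set \<Rightarrow> ('m::ab_group_add) smod \<Rightarrow> bool" where
  "is_module n q B M \<longleftrightarrow>
     vector_space (scl M) \<and>
     (\<forall>p. module.subspace (scl M) (part M p)) \<and> part M 0 \<inter> part M 1 = {0} \<and>
     (\<forall>p r. \<forall>x\<in>B \<inter> upart n q p. \<forall>m\<in>part M r. act M x m \<in> part M (p + r)) \<and>
     (\<forall>x\<in>B. \<forall>m\<in>space_of M. \<forall>m'\<in>space_of M. act M x (m + m') = act M x m + act M x m') \<and>
     (\<forall>x\<in>B. \<forall>m\<in>space_of M. \<forall>c. act M x (scl M c m) = scl M c (act M x m)) \<and>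
     (\<forall>x\<in>B. \<forall>y\<in>B. \<forall>m\<in>space_of M. act M (x \<oplus>\<^bsub>Uq n q\<^esub> y) m = act M x m + act M y m) \<and>
     (\<forall>x\<in>B. \<forall>m\<in>space_of M. \<forall>c. act M (uscale n q c x) m = scl M c (act M x m)) \<and>
     (\<forall>x\<in>B. \<forall>y\<in>B. \<forall>m\<in>space_of M. act M (x \<otimes>\<^bsub>Uq n q\<^esub> y) m = act M x (act M y m)) \<and>
     (\<forall>m\<in>space_of M. act M \<one>\<^bsub>Uq n q\<^esub> m = m)"

definition finite_dim :: "('m::ab_group_add) smod \<Rightarrow> bool" where
  "finite_dim M \<longleftrightarrow> (\<exists>B. finite B \<and> space_of M = module.span (scl M) B)"

text \<open>Homogeneous homomorphisms of a given parity, and all sums of an even and an odd one. A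
  function on \<open>space_of W\<close> is represented by its extension by zero to the whole type.\<close>

definition Hom_part ::
    "nat \<Rightarrow> complex \<Rightarrow> uq set \<Rightarrow> ('w::ab_group_add) smod \<Rightarrow> ('m::ab_group_add) smod \<Rightarrow>
     bit \<Rightarrow> ('w \<Rightarrow> 'm) set" where
  "Hom_part n q B W M p = {\<phi>.
     (\<forall>w. w \<notin> space_of W \<longrightarrow> \<phi> w = 0) \<and>
     (\<forall>w\<in>space_of W. \<forall>w'\<in>space_of W. \<phi> (w + w') = \<phi> w + \<phi> w') \<and>
     (\<forall>w\<in>space_of W. \<forall>c. \<phi> (scl W c w) = scl M c (\<phi> w)) \<and>
     (\<forall>r. \<forall>w\<in>part W r. \<phi> w \<in> part M (p + r)) \<and>
     (\<forall>r. \<forall>x\<in>B \<inter> upart n q r. \<forall>w\<in>space_of W.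
        act M x (\<phi> w) = scl M (sgn2 p r) (\<phi> (act W x w)))}"

definition Hom ::
    "nat \<Rightarrow> complex \<Rightarrow> uq set \<Rightarrow> ('w::ab_group_add) smod \<Rightarrow> ('m::ab_group_add) smod \<Rightarrow>
     ('w \<Rightarrow> 'm) set" where
  "Hom n q B W M = {\<phi> + \<psi> | \<phi> \<psi>. \<phi> \<in> Hom_part n q B W M 0 \<and> \<psi> \<in> Hom_part n q B W M 1}"

section \<open>Functions on the quantum supergroup\<close>

text \<open>Functionals on \<open>Uq n q\<close> are extended by zero outside the carrier.\<close>

type_synonym func = "uq \<Rightarrow> complex"

definition on_Uq :: "nat \<Rightarrow> complex \<Rightarrow> (uq \<Rightarrow> 'a::zero) \<Rightarrow> uq \<Rightarrow> 'a" where
  "on_Uq n q f x = (if x \<in> carrier (Uq n q) then f x else 0)"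

definition counit :: "nat \<Rightarrow> complex \<Rightarrow> func" where
  "counit n q = on_Uq n q (\<lambda>x. free_counit (rep x))"

text \<open>The sign in the product is \<open>(-1)\<close> to the power \<open>[g][a\<^sub>1]\<close>; it is written here as
  \<open>[a\<^sub>2][a\<^sub>1]\<close>, because \<open>g\<close> homogeneous and \<open>g a\<^sub>2 \<noteq> 0\<close> force \<open>[g] = [a\<^sub>2]\<close>.\<close>

definition fmult :: "nat \<Rightarrow> complex \<Rightarrow> func \<Rightarrow> func \<Rightarrow> func" where
  "fmult n q f g = on_Uq n q (\<lambda>x.
     \<Sum>(u, v)\<in>Poly_Mapping.keys (free_coproduct n (rep x)).
       Poly_Mapping.lookup (free_coproduct n (rep x)) (u, v)
         * sgn2 (word_parity n v) (word_parity n u) * f (cls n q (mon u)) * g (cls n q (mon v)))"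

definition irreducible_module :: "nat \<Rightarrow> complex \<Rightarrow> ('m::ab_group_add) smod \<Rightarrow> bool" where
  "irreducible_module n q M \<longleftrightarrow>
     is_module n q (carrier (Uq n q)) M \<and> space_of M \<noteq> {0} \<and>
     (\<forall>N. (\<forall>p. N p \<subseteq> part M p) \<and> is_module n q (carrier (Uq n q)) (M\<lparr>part := N\<rparr>) \<longrightarrow>
        (\<forall>p. N p = {0}) \<or> N = part M)"

text \<open>The vector representation, realised on subspaces of \<open>\<nat> \<Rightarrow> \<complex>\<close>; every
  finite-dimensional module has such a realisation.\<close>

definition vector_rep :: "nat \<Rightarrow> complex \<Rightarrow> (nat \<Rightarrow> complex) smod \<Rightarrow> bool" where
  "vector_rep n q M \<longleftrightarrow>
     scl M = (\<lambda>c v i. c * v i) \<and> irreducible_module n q M \<and>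
     finite_dim M \<and> vector_space.dim (scl M) (space_of M) = 2 * n + 1 \<and>
     (\<exists>v\<in>part M 0. v \<noteq> 0 \<and>
        (\<forall>i\<in>{1..n}. act M (cls n q (gen (E i))) v = 0 \<and>
           act M (cls n q (gen (K i))) v = scl M (q powi ip n (eps 1) (simple_root n i)) v))"

definition matrix_elements :: "nat \<Rightarrow> complex \<Rightarrow> ('m::ab_group_add) smod \<Rightarrow> func set" where
  "matrix_elements n q M =
     {on_Uq n q (\<lambda>x. l (act M x v)) | l v. v \<in> space_of M \<and> module_hom (scl M) (*) l}"

text \<open>Matrix elements lie in the finite dual, so the subalgebra they generate there is the
  subalgebra they generate among all functionals.\<close>

inductive_set Tq :: "nat \<Rightarrow> complex \<Rightarrow> func set" for n :: nat and q :: complex where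
  unit: "counit n q \<in> Tq n q"
| matrix: "vector_rep n q M \<Longrightarrow> f \<in> matrix_elements n q M \<Longrightarrow> f \<in> Tq n q"
| scale: "f \<in> Tq n q \<Longrightarrow> (\<lambda>x. c * f x) \<in> Tq n q"
| add: "f \<in> Tq n q \<Longrightarrow> g \<in> Tq n q \<Longrightarrow> f + g \<in> Tq n q"
| mult: "f \<in> Tq n q \<Longrightarrow> g \<in> Tq n q \<Longrightarrow> fmult n q f g \<in> Tq n q"

definition linear_on_Uq :: "nat \<Rightarrow> complex \<Rightarrow> func \<Rightarrow> bool" where
  "linear_on_Uq n q f \<longleftrightarrow>
     (\<forall>x\<in>carrier (Uq n q). \<forall>y\<in>carrier (Uq n q). f (x \<oplus>\<^bsub>Uq n q\<^esub> y) = f x + f y) \<and>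
     (\<forall>x\<in>carrier (Uq n q). \<forall>c. f (uscale n q c x) = c * f x)"

definition fpart :: "nat \<Rightarrow> complex \<Rightarrow> bit \<Rightarrow> func set" where
  "fpart n q p = {f. \<forall>x\<in>upart n q (p + 1). f x = 0}"

section \<open>Tensor products with functionals\<close>

text \<open>For a vector space \<open>V\<close> and a space \<open>T\<close> of functionals, \<open>V \<otimes> T\<close> embeds into the
  \<open>V\<close>-valued functions by \<open>v \<otimes> f \<mapsto> (a \<mapsto> f a v)\<close>, cf. \<open>pure_sum_eq_zero\<close> below;
  it is identified with its image. The map \<open>id \<otimes> \<langle>\<cdot>, a\<rangle>\<close> becomes evaluation
  at \<open>a\<close>.\<close>

definition pure :: "('m::ab_group_add) smod \<Rightarrow> 'm \<Rightarrow> func \<Rightarrow> uq \<Rightarrow> 'm" where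
  "pure V v f = (\<lambda>a. scl V (f a) v)"

definition fscale :: "('m::ab_group_add) smod \<Rightarrow> complex \<Rightarrow> (uq \<Rightarrow> 'm) \<Rightarrow> uq \<Rightarrow> 'm" where
  "fscale V c \<zeta> = (\<lambda>a. scl V c (\<zeta> a))"

definition tensor_T :: "nat \<Rightarrow> complex \<Rightarrow> ('m::ab_group_add) smod \<Rightarrow> (uq \<Rightarrow> 'm) set" where
  "tensor_T n q V = module.span (fscale V) {pure V v f | v f. v \<in> space_of V \<and> f \<in> Tq n q}"

definition tensor_T_part ::
    "nat \<Rightarrow> complex \<Rightarrow> ('m::ab_group_add) smod \<Rightarrow> bit \<Rightarrow> (uq \<Rightarrow> 'm) set" where
  "tensor_T_part n q V p = module.span (fscale V)
     {pure V v f | v f r s. v \<in> part V r \<and> f \<in> Tq n q \<inter> fpart n q s \<and> r + s = p}"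

lemma pure_sum_eq_zero:
  assumes "vector_space (scl V)" "finite B" "\<not> module.dependent (scl V) B"
    and sum: "(\<Sum>b\<in>B. pure V b (f b)) = 0" and "b \<in> B"
  shows "f b = 0"
proof
  fix x
  interpret vector_space "scl V" by fact
  have eval: "(\<Sum>b\<in>A. pure V b (f b)) x = (\<Sum>b\<in>A. scl V (f b x) b)" if "finite A" for A
    using that by (induction A) (simp_all add: pure_def)
  have "(\<Sum>b\<in>B. scl V (f b x) b) = 0"
    using eval[OF \<open>finite B\<close>] sum by simp
  then show "f b x = 0 x"
    using assms independentD[of B B "\<lambda>b. f b x" b] by simp
qed

section \<open>The two actions and the induced module\<close>

text \<open>By the definition of the coproduct of a functional,
  \<open>\<langle>x \<circ> f, a\<rangle> = \<langle>f, ax\<rangle>\<close> and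
  \<open>\<langle>x \<cdot> f, a\<rangle> = (-1)\<^bsup>[x][a]\<^esup> \<langle>f, S\<^sup>-\<^sup>1(x)a\<rangle>\<close>.
  The lemmas \<open>circ_sweedler\<close> and \<open>dot_sweedler\<close> state the agreement with the formulas in
  terms of \<open>f\<^sub>1 \<otimes> f\<^sub>2\<close>. The two operations are defined for functions with values
  in a vector space, where they are \<open>v \<otimes> f \<mapsto> v \<otimes> x \<circ> f\<close> and
  \<open>v \<otimes> f \<mapsto> v \<otimes> x \<cdot> f\<close>.\<close>

definition circ :: "nat \<Rightarrow> complex \<Rightarrow> uq \<Rightarrow> (uq \<Rightarrow> 'm::zero) \<Rightarrow> uq \<Rightarrow> 'm" where
  "circ n q x f = on_Uq n q (\<lambda>a. f (a \<otimes>\<^bsub>Uq n q\<^esub> x))"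

definition dot ::
    "(complex \<Rightarrow> 'm \<Rightarrow> 'm) \<Rightarrow> nat \<Rightarrow> complex \<Rightarrow> uq \<Rightarrow> (uq \<Rightarrow> 'm::ab_group_add) \<Rightarrow> uq \<Rightarrow> 'm" where
  "dot sc n q x f = on_Uq n q (\<lambda>a.
     \<Sum>p\<in>{0, 1}. \<Sum>s\<in>{0, 1}.
       sc (sgn2 p s) (f (ucomps n q (antipode_inv n q x) p \<otimes>\<^bsub>Uq n q\<^esub> ucomps n q a s)))"

text \<open>The list \<open>ps\<close> below is a decomposition \<open>\<Sum> f\<^sub>1 \<otimes> f\<^sub>2\<close> of the coproduct of \<open>f\<close>
  into homogeneous functionals, annotated with their parities.\<close>

definition is_coproduct ::
    "nat \<Rightarrow> complex \<Rightarrow> func \<Rightarrow> (bit \<times> bit \<times> func \<times> func) list \<Rightarrow> bool" where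
  "is_coproduct n q f ps \<longleftrightarrow>
     (\<forall>(p, r, g, h)\<in>set ps. linear_on_Uq n q g \<and> linear_on_Uq n q h \<and>
        g \<in> fpart n q p \<and> h \<in> fpart n q r) \<and>
     (\<forall>a\<in>carrier (Uq n q). \<forall>b\<in>carrier (Uq n q).
        f (a \<otimes>\<^bsub>Uq n q\<^esub> b) = (\<Sum>(p, r, g, h)\<leftarrow>ps. sgn2 p r * g a * h b))"

lemma circ_sweedler:
  assumes "is_coproduct n q f ps" "x \<in> carrier (Uq n q)" "a \<in> carrier (Uq n q)"
  shows "circ n q x f a = (\<Sum>(p, r, g, h)\<leftarrow>ps. sgn2 p r * g a * h x)"
  using assms unfolding circ_def on_Uq_def is_coproduct_def by simp

lemma bit_eq_plus_one_iff: "(a :: bit) = b + 1 \<longleftrightarrow> a \<noteq> b"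
  by (cases a; cases b) simp_all

lemma fpart_ucomps:
  assumes "g \<in> fpart n q p" "linear_on_Uq n q g" "x \<in> carrier (Uq n q)"
  shows "g (ucomps n q x r) = (if r = p then g x else 0)"
proof -
  have zero: "g (ucomps n q x s) = 0" if "s \<noteq> p" for s
    using that assms(1) ucomps(1)[OF assms(3), of s] bit_eq_plus_one_iff[of s p]
    by (auto simp: fpart_def)
  have "g x = g (ucomps n q x 0) + g (ucomps n q x 1)"
    using assms(2) upart_carrier[OF ucomps(1)[OF assms(3)]] ucomps(2)[OF assms(3)]
    unfolding linear_on_Uq_def by metis
  then show ?thesis
    using zero zero[of 0] zero[of 1] by (cases p; cases r) auto
qed

lemma dot_sweedler:
  assumes ps: "is_coproduct n q f ps"
    and x: "antipode_inv n q x \<in> carrier (Uq n q)" and a: "a \<in> carrier (Uq n q)"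
  shows "dot (*) n q x f a = (\<Sum>(p, r, g, h)\<leftarrow>ps. g (antipode_inv n q x) * h a)"
proof -
  define y where "y = antipode_inv n q x"
  have y: "y \<in> carrier (Uq n q)" using x by (simp add: y_def)
  let ?c = "ucomps n q"
  have f: "f (?c y s \<otimes>\<^bsub>Uq n q\<^esub> ?c a t) =
      (\<Sum>(p, r, g, h)\<leftarrow>ps. if s = p \<and> t = r then sgn2 p r * g y * h a else 0)" for s t
  proof -
    have "f (?c y s \<otimes>\<^bsub>Uq n q\<^esub> ?c a t) = (\<Sum>(p, r, g, h)\<leftarrow>ps. sgn2 p r * g (?c y s) * h (?c a t))"
      using ps upart_carrier[OF ucomps(1)[OF y]] upart_carrier[OF ucomps(1)[OF a]]
      unfolding is_coproduct_def by blast
    also have "\<dots> = (\<Sum>(p, r, g, h)\<leftarrow>ps. if s = p \<and> t = r then sgn2 p r * g y * h a else 0)"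
    proof (intro arg_cong[where f = sum_list] map_cong refl, clarify)
      fix p r g h
      assume "(p, r, g, h) \<in> set ps"
      then have "g \<in> fpart n q p" "h \<in> fpart n q r" "linear_on_Uq n q g" "linear_on_Uq n q h"
        using ps by (auto simp: is_coproduct_def)
      then show "sgn2 p r * g (?c y s) * h (?c a t) =
          (if s = p \<and> t = r then sgn2 p r * g y * h a else 0)"
        by (simp add: fpart_ucomps y a)
    qed
    finally show ?thesis .
  qed
  have "dot (*) n q x f a = (\<Sum>s\<in>{0, 1}. \<Sum>t\<in>{0, 1}. sgn2 s t *
      (\<Sum>(p, r, g, h)\<leftarrow>ps. if s = p \<and> t = r then sgn2 p r * g y * h a else 0))"
    using a by (simp add: dot_def on_Uq_def f flip: y_def)
  also have "\<dots> = (\<Sum>(p, r, g, h)\<leftarrow>ps. g y * h a)"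
  proof (induction ps)
    case (Cons e ps)
    obtain p r g h where e: "e = (p, r, g, h)" by (cases e)
    show ?case
      using Cons by (cases p; cases r) (simp_all add: e sgn2_def algebra_simps)
  qed simp
  finally show ?thesis by (simp add: y_def)
qed

lemma circ_pure:
  assumes "vector_space (scl V)"
  shows "circ n q x (pure V v f) = pure V v (circ n q x f)"
proof -
  interpret vector_space "scl V" by fact
  show ?thesis by (auto simp: circ_def pure_def on_Uq_def)
qed

lemma dot_pure:
  assumes "vector_space (scl V)"
  shows "dot (scl V) n q x (pure V v f) = pure V v (dot (*) n q x f)"
proof -
  interpret vector_space "scl V" by fact
  show ?thesis
    by (auto simp: dot_def pure_def on_Uq_def scale_left_distrib scale_scale)
qed

definition vcomp :: "('m::ab_group_add) smod \<Rightarrow> bit \<Rightarrow> 'm \<Rightarrow> 'm" where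
  "vcomp V r v = (THE u. u \<in> part V r \<and> (\<exists>u'\<in>part V (r + 1). v = u + u'))"

text \<open>The extension \<open>x(v \<otimes> f) = (-1)\<^bsup>[x][v]\<^esup> v \<otimes> xf\<close> of an action on functionals.\<close>

definition signed_ext ::
    "nat \<Rightarrow> complex \<Rightarrow> ('m::ab_group_add) smod \<Rightarrow>
     (uq \<Rightarrow> (uq \<Rightarrow> 'm) \<Rightarrow> uq \<Rightarrow> 'm) \<Rightarrow> uq \<Rightarrow> (uq \<Rightarrow> 'm) \<Rightarrow> uq \<Rightarrow> 'm" where
  "signed_ext n q V op x \<zeta> a =
     (\<Sum>p\<in>{0, 1}. \<Sum>r\<in>{0, 1}. scl V (sgn2 p r) (vcomp V r (op (ucomps n q x p) \<zeta> a)))"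

lemma signed_ext_pure:
  assumes V: "vector_space (scl V)" "\<And>p. module.subspace (scl V) (part V p)"
      "part V 0 \<inter> part V 1 = {0}"
    and op: "\<And>y. op y (pure V v f) = pure V v (opT y f)" and v: "v \<in> part V r"
  shows "signed_ext n q V op x (pure V v f) =
    (\<Sum>p\<in>{0, 1}. fscale V (sgn2 p r) (pure V v (opT (ucomps n q x p) f)))"
proof
  fix a
  interpret vector_space "scl V" by fact
  have disj: "part V s \<inter> part V (s + 1) = {0}" for s
    using V(3) by (cases s) auto
  have zero: "0 \<in> part V s" for s
    using V(2) by (simp add: subspace_0)
  have vc: "vcomp V s (scl V c v) = (if s = r then scl V c v else 0)" for s c
  proof (cases "s = r")
    case True
    have "u = scl V c v" if "u \<in> part V r" "u' \<in> part V (r + 1)" "scl V c v = u + u'" for u u'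
    proof -
      have "u' = scl V c v - u" using that(3) by simp
      then have "u' \<in> part V r" using that(1) v V(2) by (simp add: subspace_diff subspace_scale)
      then show ?thesis using disj[of r] that by auto
    qed
    then show ?thesis
      unfolding vcomp_def True using v V(2) zero
      by (intro the_equality) (auto simp: subspace_scale intro!: bexI[of _ 0])
  next
    case False
    then have r: "r = s + 1" by (metis bit_eq_plus_one_iff)
    have "u = 0" if "u \<in> part V s" "u' \<in> part V (s + 1)" "scl V c v = u + u'" for u u'
    proof -
      have "u = scl V c v - u'" using that(3) by simp
      then have "u \<in> part V (s + 1)" using that(2) v V(2) r by (simp add: subspace_diff subspace_scale)
      then show ?thesis using disj[of s] that by auto
    qed
    then show ?thesis
      unfolding vcomp_def using v V(2) zero False r
      by (auto simp: subspace_scale intro!: the_equality)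
  qed
  have opv: "op y (pure V v f) a = scl V (opT y f a) v" for y
    unfolding op by (simp add: pure_def)
  show "signed_ext n q V op x (pure V v f) a =
      (\<Sum>p\<in>{0, 1}. fscale V (sgn2 p r) (pure V v (opT (ucomps n q x p) f))) a"
    unfolding signed_ext_def opv vc by (cases r) (simp_all add: pure_def fscale_def)
qed

definition circ_tensor ::
    "nat \<Rightarrow> complex \<Rightarrow> ('m::ab_group_add) smod \<Rightarrow> uq \<Rightarrow> (uq \<Rightarrow> 'm) \<Rightarrow> uq \<Rightarrow> 'm" where
  "circ_tensor n q V = signed_ext n q V (circ n q)"

definition dot_tensor ::
    "nat \<Rightarrow> complex \<Rightarrow> ('m::ab_group_add) smod \<Rightarrow> uq \<Rightarrow> (uq \<Rightarrow> 'm) \<Rightarrow> uq \<Rightarrow> 'm" where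
  "dot_tensor n q V = signed_ext n q V (dot (scl V) n q)"

definition Gamma ::
    "nat \<Rightarrow> complex \<Rightarrow> nat set \<Rightarrow> ('v::ab_group_add) smod \<Rightarrow> (uq \<Rightarrow> 'v) set" where
  "Gamma n q \<Theta> V = {\<zeta> \<in> tensor_T n q V.
     \<forall>x\<in>Uk n q \<Theta>. circ_tensor n q V x \<zeta> = (\<lambda>a. act V (antipode n q x) (\<zeta> a))}"

definition induced :: "nat \<Rightarrow> complex \<Rightarrow> nat set \<Rightarrow> ('v::ab_group_add) smod \<Rightarrow> (uq \<Rightarrow> 'v) smod" where
  "induced n q \<Theta> V =
     \<lparr>scl = fscale V, part = (\<lambda>p. Gamma n q \<Theta> V \<inter> tensor_T_part n q V p),
      act = dot_tensor n q V\<rparr>"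

text \<open>A module is a comodule of functions on the quantum supergroup if for every \<open>w\<close> there is
  \<open>\<delta>(w) = \<Sum> w\<^sub>i \<otimes> f\<^sub>i\<close> with \<open>xw = \<Sum> f\<^sub>i(x) w\<^sub>i\<close> for all \<open>x\<close>.
  The one-dimensional modules with \<open>e\<^sub>i = f\<^sub>i = 0\<close> and \<open>k\<^sub>n = -1\<close> do not have this
  property, and reciprocity fails for them: no vector of an induced module has such a weight.\<close>

definition T_comodule :: "nat \<Rightarrow> complex \<Rightarrow> ('w::ab_group_add) smod \<Rightarrow> bool" where
  "T_comodule n q W \<longleftrightarrow>
     (\<forall>w\<in>space_of W. on_Uq n q (\<lambda>x. act W x w) \<in> tensor_T n q W)"

text \<open>The canonical map: composition with \<open>id \<otimes> \<langle>\<cdot>, 1\<rangle>\<close>, the counit of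
  the second factor.\<close>

definition eval_one :: "nat \<Rightarrow> complex \<Rightarrow> ('w \<Rightarrow> uq \<Rightarrow> 'v) \<Rightarrow> 'w \<Rightarrow> 'v" where
  "eval_one n q \<psi> = (\<lambda>w. \<psi> w \<one>\<^bsub>Uq n q\<^esub>)"

end

(* An even or odd homomorphism psi into the induced module is determined by phi = eval_one psi through
     psi(w)(y) = (-1)^([y]([w] + 1)) phi(S(y) w),
   and conversely this formula defines a homomorphism into the induced module for every phi. The substance is
   that psi(w) lies in V \<otimes> T_q, for which T_q has to be stable under the antipode. This is reduced to the
   vector representation: weights and the commutation relations force it to have an explicit basis, in which
   precomposition with S permutes the matrix elements up to scalars. Well-definedness of the Hopf structure on the
   quotient is tested on functionals: an element of the free algebra lies in the defining ideal if and only if it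
   is killed by all functionals that respect the relations. *)
theory Submission
  imports Defs
begin

section \<open>Linear functionals on the free algebra\<close>

text \<open>The formula for \<open>psi\<close> is forced: equivariance under S(y), evaluated at 1.
  What remains is existence, and three obstacles shape it. The ideal of relations is not known
  explicitly and the tensor square of the quotient is not formed, so S and the coproduct are
  replaced by their transposes, acting on functions of one or two words. That they descend to the
  quotient then becomes a finite list of identities between values on short words, verified by
  moving all Cartan letters to the right. The vector representation is given only by irreducibility,
  dimension and highest weight. Its matrix elements can be compared with their antipodes only after
  a basis is found; the relations build a chain of vectors, and irreducibility annihilates whatever
  would leave the chain. S reverses products of functionals with a sign that depends on parities, so
  the algebra of functions has first to be closed under homogeneous parts. The comodule hypothesis
  enters where y -> phi(S(y) w) is to be a finite sum of tensors.\<close>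

definition ev :: "('a \<Rightarrow> complex) \<Rightarrow> ('a \<Rightarrow>\<^sub>0 complex) \<Rightarrow> complex" where
  "ev f a = (\<Sum>w\<in>Poly_Mapping.keys a. Poly_Mapping.lookup a w * f w)"

lemma ev_superset:
  assumes "finite A" "Poly_Mapping.keys a \<subseteq> A"
  shows "ev f a = (\<Sum>w\<in>A. Poly_Mapping.lookup a w * f w)"
  unfolding ev_def using assms by (intro sum.mono_neutral_left) (auto simp: in_keys_iff)

lemma ev_zero [simp]: "ev f 0 = 0"
  by (simp add: ev_def)

lemma ev_add [simp]: "ev f (a + b) = ev f a + ev f b"
proof -
  let ?A = "Poly_Mapping.keys a \<union> Poly_Mapping.keys b"
  have "Poly_Mapping.keys (a + b) \<subseteq> ?A" by (rule Poly_Mapping.keys_add)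
  then show ?thesis
    by (simp add: ev_superset[of ?A] lookup_add distrib_right sum.distrib)
qed

lemma ev_uminus [simp]: "ev f (- a) = - ev f a"
  by (simp add: ev_def sum_negf)

lemma ev_diff [simp]: "ev f (a - b) = ev f a - ev f b"
  using ev_add[of f a "- b"] by simp

lemma ev_sum [simp]: "ev f (sum h A) = (\<Sum>x\<in>A. ev f (h x))"
  by (induction A rule: infinite_finite_induct) auto

lemma ev_single [simp]: "ev f (Poly_Mapping.single w c) = c * f w"
  by (cases "c = 0") (auto simp: ev_def)

lemma ev_mon [simp]: "ev f (mon w) = f w"
  by (simp add: mon_def)

lemma one_falg: "(1 :: falg) = mon []"
  by (rule poly_mapping_eqI) (simp add: mon_def lookup_one lookup_single zero_list_def when_def)

lemma ev_one [simp]: "ev f (1 :: falg) = f []"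
  by (simp add: one_falg)

lemma lookup_pm_scale [simp]:
  "Poly_Mapping.lookup (pm_scale c p) w = c * Poly_Mapping.lookup p w"
  by (simp add: pm_scale_def map.rep_eq when_def)

lemma keys_pm_scale: "Poly_Mapping.keys (pm_scale c p) \<subseteq> Poly_Mapping.keys p"
  by (auto simp: in_keys_iff)

lemma ev_scale [simp]: "ev f (pm_scale c a) = c * ev f a"
proof -
  have "ev f (pm_scale c a) = (\<Sum>w\<in>Poly_Mapping.keys a. c * Poly_Mapping.lookup a w * f w)"
    by (subst ev_superset[OF finite_keys keys_pm_scale]) simp
  then show ?thesis by (simp add: ev_def sum_distrib_left mult.assoc)
qed

lemma lookup_eq_ev: "Poly_Mapping.lookup a w = ev (\<lambda>v. of_bool (v = w)) a"
  by (auto simp: ev_def in_keys_iff of_bool_def if_distrib cong: if_cong)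

text \<open>The coordinate functionals are among the \<open>f\<close>. Identities in the free
  algebra can therefore be proved by computing with \<open>ev\<close> alone.\<close>

lemma pm_eqI_ev: "(\<And>f. ev f a = ev f b) \<Longrightarrow> a = b"
  by (rule poly_mapping_eqI) (simp add: lookup_eq_ev)

lemma ev_fun_add: "ev (\<lambda>w. f w + g w) a = ev f a + ev g a"
  by (simp add: ev_def distrib_left sum.distrib)

lemma ev_fun_diff: "ev (\<lambda>w. f w - g w) a = ev f a - ev g a"
  by (simp add: ev_def right_diff_distrib sum_subtractf)

lemma ev_fun_uminus: "ev (\<lambda>w. - f w) a = - ev f a"
  by (simp add: ev_def sum_negf)

lemma ev_fun_scale: "ev (\<lambda>w. c * f w) a = c * ev f a"
  by (simp add: ev_def sum_distrib_left mult_ac)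

lemma ev_fun_zero [simp]: "ev (\<lambda>w. 0) a = 0"
  by (simp add: ev_def)

lemma ev_fun_sum: "ev (\<lambda>w. \<Sum>x\<in>A. f x w) a = (\<Sum>x\<in>A. ev (f x) a)"
  by (simp add: ev_def sum_distrib_left) (rule sum.swap)

lemma ev_swap: "ev (\<lambda>u. ev (\<lambda>v. f u v) b) a = ev (\<lambda>v. ev (\<lambda>u. f u v) a) b"
proof -
  have "ev (\<lambda>u. ev (\<lambda>v. f u v) b) a =
      (\<Sum>u\<in>Poly_Mapping.keys a. \<Sum>v\<in>Poly_Mapping.keys b.
        Poly_Mapping.lookup a u * (Poly_Mapping.lookup b v * f u v))"
    by (simp add: ev_def sum_distrib_left)
  also have "\<dots> = (\<Sum>v\<in>Poly_Mapping.keys b. \<Sum>u\<in>Poly_Mapping.keys a.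
        Poly_Mapping.lookup a u * (Poly_Mapping.lookup b v * f u v))"
    by (rule sum.swap)
  finally show ?thesis
    by (simp add: ev_def sum_distrib_left mult.left_commute)
qed

lemma ev_lin_ext: "ev f (lin_ext h a) = ev (\<lambda>w. ev f (h w)) a"
  by (simp add: lin_ext_def) (simp add: ev_def)

lemma pm_expand:
  "(a :: 'a \<Rightarrow>\<^sub>0 complex) =
    (\<Sum>w\<in>Poly_Mapping.keys a. Poly_Mapping.single w (Poly_Mapping.lookup a w))"
  by (rule pm_eqI_ev) (simp, simp add: ev_def)

text \<open>Products disappear here: a functional on \<open>a * b\<close> becomes an iterated
  functional on concatenated words, and associativity becomes that of \<open>@\<close>.\<close>

lemma ev_mult: "ev f (a * b) = ev (\<lambda>u. ev (\<lambda>v. f (u @ v)) b) (a :: falg)"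
proof -
  have "ev f (a * b) = ev f ((\<Sum>u\<in>Poly_Mapping.keys a. Poly_Mapping.single u (Poly_Mapping.lookup a u))
      * (\<Sum>v\<in>Poly_Mapping.keys b. Poly_Mapping.single v (Poly_Mapping.lookup b v)))"
    by (simp flip: pm_expand)
  then show ?thesis
    by (simp add: sum_product mult_single plus_list_def)
      (simp add: ev_def sum_distrib_left mult.assoc)
qed

lemma mon_mult: "mon u * mon v = mon (u @ v)"
  by (simp add: mon_def mult_single plus_list_def)

lemma ev_const_mult [simp]: "ev f (const c * a) = c * ev f a"
  by (simp add: ev_mult const_def)

text \<open>The type of words has letters of every index, while the relations concern the indices
  from 1 to \<open>n\<close>. Word identities are therefore guarded by \<open>okw\<close>.\<close>

definition okw :: "nat \<Rightarrow> gen list \<Rightarrow> bool" where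
  "okw n w \<longleftrightarrow> (\<forall>g\<in>set w. gen_index g \<in> {1..n})"

lemma okw_Nil [simp]: "okw n []"
  and okw_Cons [simp]: "okw n (g # w) \<longleftrightarrow> gen_index g \<in> {1..n} \<and> okw n w"
  and okw_append [simp]: "okw n (u @ v) \<longleftrightarrow> okw n u \<and> okw n v"
  by (auto simp: okw_def)

lemma carrier_free_alg: "carrier (free_alg n) = {a. \<forall>w\<in>Poly_Mapping.keys a. okw n w}"
  by (simp add: free_alg_def okw_def)

lemma mon_closed: "okw n w \<Longrightarrow> mon w \<in> carrier (free_alg n)"
  unfolding mon_def okw_def by (rule free_alg_single_closed)

lemma scale_closed: "a \<in> carrier (free_alg n) \<Longrightarrow> pm_scale c a \<in> carrier (free_alg n)"
  using keys_pm_scale[of c a] by (auto simp: carrier_free_alg)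

lemma zero_one_closed: "0 \<in> carrier (free_alg n)" "1 \<in> carrier (free_alg n)"
  by (simp_all add: carrier_free_alg zero_list_def)

lemma lin_ext_closed:
  assumes "a \<in> carrier (free_alg n)" "\<And>w. okw n w \<Longrightarrow> h w \<in> carrier (free_alg n)"
  shows "lin_ext h a \<in> carrier (free_alg n)"
  unfolding lin_ext_def using assms
  by (intro free_alg_sum_closed scale_closed) (auto simp: carrier_free_alg)

lemma ev_cong:
  assumes "a \<in> carrier (free_alg n)" "\<And>w. okw n w \<Longrightarrow> f w = g w"
  shows "ev f a = ev g a"
  unfolding ev_def using assms by (intro sum.cong) (auto simp: carrier_free_alg)

lemma free_alg_span_induct [consumes 1, case_names mon scale add]:
  assumes "a \<in> carrier (free_alg n)"
    and "\<And>w. okw n w \<Longrightarrow> P (mon w)"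
    and "\<And>a c. a \<in> carrier (free_alg n) \<Longrightarrow> P a \<Longrightarrow> P (pm_scale c a)"
    and "\<And>a b. a \<in> carrier (free_alg n) \<Longrightarrow> b \<in> carrier (free_alg n) \<Longrightarrow>
      P a \<Longrightarrow> P b \<Longrightarrow> P (a + b)"
  shows "P a"
proof -
  \<comment> \<open>The empty word belongs to every \<open>free_alg n\<close>, so scaling it by 0
    gives the base case.\<close>
  have zero: "P 0"
  proof -
    have "pm_scale 0 (mon []) = 0" by (rule poly_mapping_eqI) simp
    then show ?thesis using assms(3)[OF mon_closed assms(2), of "[]" 0] by simp
  qed
  have single: "Poly_Mapping.single w c = pm_scale c (mon w)" for w c
    by (rule pm_eqI_ev) simp
  have "P (\<Sum>w\<in>A. Poly_Mapping.single w (Poly_Mapping.lookup a w)) \<and>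
      (\<Sum>w\<in>A. Poly_Mapping.single w (Poly_Mapping.lookup a w)) \<in> carrier (free_alg n)"
    if "finite A" "\<forall>w\<in>A. okw n w" for A
    using that
    by (induction A)
      (auto simp: single zero zero_one_closed intro!: assms(2-) scale_closed mon_closed free_alg_plus_closed)
  from this[OF finite_keys[of a]] show ?thesis
    using assms(1) pm_expand[of a] by (auto simp: carrier_free_alg)
qed

section \<open>Functionals vanishing on the ideal\<close>

text \<open>The functionals on words that descend to the quotient.\<close>

definition resp :: "nat \<Rightarrow> complex \<Rightarrow> (gen list \<Rightarrow> complex) \<Rightarrow> bool" where
  "resp n q f \<longleftrightarrow> (\<forall>r\<in>osp_relations n q. \<forall>u v. okw n u \<longrightarrow> okw n v \<longrightarrow> ev (\<lambda>w. f (u @ w @ v)) r = 0)"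

text \<open>The elements annihilated by \<open>f\<close> in every context \<open>u\<close>,
  \<open>v\<close> form a two-sided ideal that contains the relations, hence all of
  \<open>osp_ideal\<close>. The contexts in \<open>resp\<close> are what makes this set an
  ideal.\<close>

lemma resp_vanishes:
  assumes "resp n q f" "a \<in> osp_ideal n q"
  shows "ev f a = 0"
proof -
  let ?I = "{a \<in> carrier (free_alg n). \<forall>u v. okw n u \<longrightarrow> okw n v \<longrightarrow> ev (\<lambda>w. f (u @ w @ v)) a = 0}"
  have "ideal ?I (free_alg n)"
  proof (rule idealI[OF ring_free_alg])
    interpret R: ring "free_alg n" by (rule ring_free_alg)
    show "subgroup ?I (add_monoid (free_alg n))"
    proof (rule R.add.subgroupI)
      show "\<ominus>\<^bsub>free_alg n\<^esub> a \<in> ?I" if "a \<in> ?I" for a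
      proof -
        have "\<ominus>\<^bsub>free_alg n\<^esub> a = - a"
          using that free_alg_uminus_closed[of a n] R.minus_equality[of "- a" a] by simp
        then show ?thesis using that free_alg_uminus_closed[of a n] by simp
      qed
    qed (auto simp: zero_one_closed free_alg_plus_closed intro!: exI[of _ 0])
  next
    fix a x
    assume a: "a \<in> ?I" and x: "x \<in> carrier (free_alg n)"
    have "ev (\<lambda>w. f (u @ w @ v)) (x * a) = 0" "ev (\<lambda>w. f (u @ w @ v)) (a * x) = 0"
      if uv: "okw n u" "okw n v" for u v
    proof -
      have "ev (\<lambda>w. f (u @ w @ v)) (x * a) = ev (\<lambda>y. 0) x"
        unfolding ev_mult using a uv
        by (intro ev_cong[OF x]) (auto dest: spec[of _ "u @ _"] simp flip: append_assoc)
      then show "ev (\<lambda>w. f (u @ w @ v)) (x * a) = 0" by simp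
      have "ev (\<lambda>w. f (u @ w @ v)) (a * x) = ev (\<lambda>y. 0) x"
        unfolding ev_mult ev_swap[of _ x a] using a uv
        by (intro ev_cong[OF x]) (auto simp: append_assoc)
      then show "ev (\<lambda>w. f (u @ w @ v)) (a * x) = 0" by simp
    qed
    then show "x \<otimes>\<^bsub>free_alg n\<^esub> a \<in> ?I" "a \<otimes>\<^bsub>free_alg n\<^esub> x \<in> ?I"
      using a x by (auto simp: free_alg_times_closed)
  qed
  moreover have "osp_relations n q \<subseteq> ?I"
    using assms(1) osp_relations_closed[of n q] by (auto simp: resp_def)
  ultimately have "osp_ideal n q \<subseteq> ?I"
    unfolding osp_ideal_def by (intro ring.genideal_minimal[OF ring_free_alg])
  then have "a \<in> ?I" using assms(2) by blast
  then show ?thesis using okw_Nil by fastforce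
qed

interpretation pm: vector_space "pm_scale :: complex \<Rightarrow> ('a \<Rightarrow>\<^sub>0 complex) \<Rightarrow> _"
  by standard (rule pm_eqI_ev; simp add: algebra_simps)+

lemma pm_scale_eq_const: "pm_scale c a = const c * a"
  by (rule pm_eqI_ev) simp

lemma osp_ideal_subspace: "pm.subspace (osp_ideal n q)"
proof -
  interpret I: ideal "osp_ideal n q" "free_alg n" by (rule ideal_osp_ideal)
  show ?thesis
    unfolding pm.subspace_def pm_scale_eq_const
    using additive_subgroup.zero_closed[OF I.additive_subgroup_axioms]
      additive_subgroup.a_closed[OF I.additive_subgroup_axioms]
      I.I_l_closed[OF _ const_closed] by simp
qed

text \<open>Functionals separate points of the quotient; all later identities in \<open>Uq\<close> are checked
  through them.\<close>

lemma in_osp_ideal: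
  assumes "a \<in> carrier (free_alg n)" "\<And>f. resp n q f \<Longrightarrow> ev f a = 0"
  shows "a \<in> osp_ideal n q"
proof (rule ccontr)
  assume "a \<notin> osp_ideal n q"
  interpret vector_space_pair "pm_scale :: complex \<Rightarrow> falg \<Rightarrow> falg" "(*) :: complex \<Rightarrow> complex \<Rightarrow> complex"
    by (intro vector_space_pair.intro pm.vector_space_axioms, standard) (auto simp: algebra_simps)
  \<comment> \<open>A basis of the ideal stays independent when \<open>a\<close> is added, so some
    functional is 1 at \<open>a\<close> and vanishes on the ideal. Restricted to words it respects
    the relations, because the ideal contains every \<open>u r v\<close>.\<close>
  obtain B where B: "B \<subseteq> osp_ideal n q" "pm.independent B" "osp_ideal n q \<subseteq> pm.span B"
    using pm.maximal_independent_subset by blast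
  have "pm.span B = osp_ideal n q"
    using B pm.span_minimal[OF B(1) osp_ideal_subspace] by blast
  then have "pm.independent (insert a B)" "a \<notin> B"
    using B pm.independent_insert[of a B] \<open>a \<notin> osp_ideal n q\<close> by auto
  then obtain g where g: "module_hom pm_scale (*) g" "\<forall>x\<in>insert a B. g x = of_bool (x = a)"
    using linear_independent_extend[of "insert a B" "\<lambda>x. of_bool (x = a)"] by (auto simp: module_hom_iff_linear)
  interpret g: module_hom pm_scale "(*)" g by fact
  have g_ev: "g x = ev (\<lambda>w. g (mon w)) x" for x
  proof -
    have "Poly_Mapping.single w c = pm_scale c (mon w)" for w c
      by (rule pm_eqI_ev) simp
    then have "g (\<Sum>w\<in>Poly_Mapping.keys x. Poly_Mapping.single w (Poly_Mapping.lookup x w))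
        = ev (\<lambda>w. g (mon w)) x"
      by (simp add: g.sum g.scale ev_def)
    then show ?thesis by (simp flip: pm_expand)
  qed
  have "g x = 0" if "x \<in> osp_ideal n q" for x
  proof -
    have "x \<in> pm.span B" using that B(3) by blast
    moreover have "g b = 0" if "b \<in> B" for b
      using g(2) that \<open>a \<notin> B\<close> by auto
    ultimately show ?thesis using g.eq_0_on_span[of B x] by blast
  qed
  moreover have "mon u * r * mon v \<in> osp_ideal n q" if "r \<in> osp_relations n q" "okw n u" "okw n v" for r u v
  proof -
    interpret I: ideal "osp_ideal n q" "free_alg n" by (rule ideal_osp_ideal)
    have "r \<in> osp_ideal n q"
      using that(1) ring.genideal_self[OF ring_free_alg osp_relations_closed] by (auto simp: osp_ideal_def)
    then show ?thesis
      using I.I_l_closed I.I_r_closed mon_closed that by (metis free_alg_simps(1))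
  qed
  ultimately have "g (mon u * r * mon v) = 0" if "r \<in> osp_relations n q" "okw n u" "okw n v" for r u v
    using that by blast
  then have "resp n q (\<lambda>w. g (mon w))"
    unfolding resp_def by (simp add: g_ev[of "_ * _"] ev_mult)
  then have "g a = 0" using assms(2) g_ev by metis
  then show False using g(2) by simp
qed

lemma cls_eq_iff_diff:
  assumes "a \<in> carrier (free_alg n)" "b \<in> carrier (free_alg n)"
  shows "cls n q a = cls n q b \<longleftrightarrow> a - b \<in> osp_ideal n q"
proof -
  interpret I: ideal "osp_ideal n q" "free_alg n" by (rule ideal_osp_ideal)
  have "a \<ominus>\<^bsub>free_alg n\<^esub> b = a - b"
  proof -
    have "\<ominus>\<^bsub>free_alg n\<^esub> b = - b"
      using assms free_alg_uminus_closed[of b n] I.minus_equality[of "- b" b] by simp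
    then show ?thesis by (simp add: a_minus_def)
  qed
  then show ?thesis
    using I.quotient_eq_iff_same_a_r_cos[OF ideal_osp_ideal assms] by (simp add: cls_def)
qed

lemma cls_eq_iff:
  assumes "a \<in> carrier (free_alg n)" "b \<in> carrier (free_alg n)"
  shows "cls n q a = cls n q b \<longleftrightarrow> (\<forall>f. resp n q f \<longrightarrow> ev f a = ev f b)"
proof -
  have "a - b \<in> osp_ideal n q \<longleftrightarrow> (\<forall>f. resp n q f \<longrightarrow> ev f (a - b) = 0)"
    using in_osp_ideal[OF free_alg_minus_closed[OF assms]] resp_vanishes by blast
  then show ?thesis using cls_eq_iff_diff[OF assms] by simp
qed

lemma rep:
  assumes "x \<in> carrier (Uq n q)"
  shows rep_closed: "rep x \<in> carrier (free_alg n)" and cls_rep: "cls n q (rep x) = x"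
proof -
  interpret I: ideal "osp_ideal n q" "free_alg n" by (rule ideal_osp_ideal)
  obtain a where a: "a \<in> carrier (free_alg n)" "x = cls n q a"
    using assms by (auto simp: cls_surj)
  have "a \<in> x" using a I.a_rcos_self by (simp add: cls_def)
  then have rep: "rep x \<in> x" unfolding rep_def by (rule someI)
  then show "rep x \<in> carrier (free_alg n)"
    using a I.a_r_coset_subset_G[OF I.a_subset] by (auto simp: cls_def)
  show "cls n q (rep x) = x"
    using rep a I.a_repr_independence' by (simp add: cls_def)
qed

lemma cls_closed: "a \<in> carrier (free_alg n) \<Longrightarrow> cls n q a \<in> carrier (Uq n q)"
  by (simp add: cls_surj)

lemma cls_add:
  "a \<in> carrier (free_alg n) \<Longrightarrow> b \<in> carrier (free_alg n) \<Longrightarrow>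
    cls n q (a + b) = cls n q a \<oplus>\<^bsub>Uq n q\<^esub> cls n q b"
  using ring_hom_add[OF cls_ring_hom] by (metis free_alg_simps(4))

lemma cls_mult:
  "a \<in> carrier (free_alg n) \<Longrightarrow> b \<in> carrier (free_alg n) \<Longrightarrow>
    cls n q (a * b) = cls n q a \<otimes>\<^bsub>Uq n q\<^esub> cls n q b"
  using ring_hom_mult[OF cls_ring_hom] by (metis free_alg_simps(1))

lemma cls_one: "cls n q 1 = \<one>\<^bsub>Uq n q\<^esub>"
  using ring_hom_one[OF cls_ring_hom] by (metis free_alg_simps(2))

lemma uscale_cls: "a \<in> carrier (free_alg n) \<Longrightarrow> uscale n q c (cls n q a) = cls n q (pm_scale c a)"
  by (simp add: uscale_def pm_scale_eq_const cls_mult const_closed)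

lemma uscale_closed: "x \<in> carrier (Uq n q) \<Longrightarrow> uscale n q c x \<in> carrier (Uq n q)"
  by (auto simp: cls_surj uscale_cls scale_closed)

text \<open>\<open>ext\<close> and \<open>wf\<close> translate between functions on words and
  functionals on \<open>Uq\<close>. On functions with \<open>resp\<close> the value does not depend
  on the choice made by \<open>rep\<close> (\<open>ext_cls\<close>), and the two translations are
  mutually inverse up to words with illegal indices.\<close>

definition ext :: "nat \<Rightarrow> complex \<Rightarrow> (gen list \<Rightarrow> complex) \<Rightarrow> func" where
  "ext n q f = on_Uq n q (\<lambda>x. ev f (rep x))"

definition wf :: "nat \<Rightarrow> complex \<Rightarrow> func \<Rightarrow> gen list \<Rightarrow> complex" where
  "wf n q g w = g (cls n q (mon w))"

lemma ext_cls:
  assumes "resp n q f" "a \<in> carrier (free_alg n)"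
  shows "ext n q f (cls n q a) = ev f a"
proof -
  have "ev f (rep (cls n q a)) = ev f a"
    using assms cls_eq_iff[of "rep (cls n q a)" n a q] cls_closed[OF assms(2)] rep_closed cls_rep
    by blast
  then show ?thesis using assms(2) by (simp add: ext_def on_Uq_def cls_closed)
qed

lemma linear_ext:
  assumes "resp n q f"
  shows "linear_on_Uq n q (ext n q f)"
  unfolding linear_on_Uq_def
proof (intro conjI ballI allI)
  fix x y c
  assume "x \<in> carrier (Uq n q)"
  then obtain a where a: "a \<in> carrier (free_alg n)" "x = cls n q a"
    by (auto simp: cls_surj)
  show "ext n q f (uscale n q c x) = c * ext n q f x"
    unfolding a(2) uscale_cls[OF a(1)] using a(1) by (simp add: ext_cls[OF assms] scale_closed)
  assume "y \<in> carrier (Uq n q)"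
  then obtain b where b: "b \<in> carrier (free_alg n)" "y = cls n q b"
    by (auto simp: cls_surj)
  show "ext n q f (x \<oplus>\<^bsub>Uq n q\<^esub> y) = ext n q f x + ext n q f y"
    unfolding a(2) b(2) cls_add[OF a(1) b(1), symmetric] using a(1) b(1)
    by (simp add: ext_cls[OF assms] free_alg_plus_closed)
qed

lemma linear_on_Uq_ev:
  assumes "linear_on_Uq n q g" "a \<in> carrier (free_alg n)"
  shows "g (cls n q a) = ev (wf n q g) a"
  using assms(2)
proof (induction rule: free_alg_span_induct)
  case (mon w)
  then show ?case by (simp add: wf_def)
next
  case (scale a c)
  then show ?case
    using assms(1) by (simp add: linear_on_Uq_def uscale_cls[symmetric] cls_closed)
next
  case (add a b)
  then show ?case
    using assms(1) by (simp add: linear_on_Uq_def cls_add cls_closed)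
qed

lemma resp_wf:
  assumes "linear_on_Uq n q g"
  shows "resp n q (wf n q g)"
  unfolding resp_def
proof (intro ballI allI impI)
  fix r u v
  assume *: "r \<in> osp_relations n q" "okw n u" "okw n v"
  interpret I: ideal "osp_ideal n q" "free_alg n" by (rule ideal_osp_ideal)
  have r: "r \<in> carrier (free_alg n)" using * osp_relations_closed by blast
  have "r \<in> osp_ideal n q"
    using *(1) ring.genideal_self[OF ring_free_alg osp_relations_closed] by (auto simp: osp_ideal_def)
  then have "mon u * r * mon v \<in> osp_ideal n q"
    using I.I_l_closed I.I_r_closed mon_closed * by (metis free_alg_simps(1))
  then have "cls n q (mon u * r * mon v) = cls n q 0"
    using r * by (subst cls_eq_iff_diff) (auto simp: zero_one_closed mon_closed free_alg_times_closed)
  then have "ev (wf n q g) (mon u * r * mon v) = ev (wf n q g) 0"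
    using r * linear_on_Uq_ev[OF assms] zero_one_closed(1)
    by (metis mon_closed free_alg_times_closed)
  then show "ev (\<lambda>w. wf n q g (u @ w @ v)) r = 0"
    by (simp add: ev_mult)
qed

lemma ext_wf:
  assumes "linear_on_Uq n q g" "\<And>x. x \<notin> carrier (Uq n q) \<Longrightarrow> g x = 0"
  shows "ext n q (wf n q g) = g"
proof
  fix x
  show "ext n q (wf n q g) x = g x"
  proof (cases "x \<in> carrier (Uq n q)")
    case True
    then show ?thesis
      using linear_on_Uq_ev[OF assms(1) rep_closed[OF True]]
      by (simp add: ext_def on_Uq_def cls_rep)
  next
    case False
    then show ?thesis using assms(2) by (simp add: ext_def on_Uq_def)
  qed
qed

lemma wf_ext: "resp n q f \<Longrightarrow> okw n w \<Longrightarrow> wf n q (ext n q f) w = f w"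
  by (simp add: wf_def ext_cls mon_closed)

lemma Uq_eqI:
  assumes "x \<in> carrier (Uq n q)" "y \<in> carrier (Uq n q)"
    and "\<And>f. resp n q f \<Longrightarrow> ext n q f x = ext n q f y"
  shows "x = y"
proof -
  have "cls n q (rep x) = cls n q (rep y)"
    using assms by (subst cls_eq_iff) (auto simp: ext_def on_Uq_def rep_closed)
  then show ?thesis using assms(1,2) by (simp add: cls_rep)
qed

section \<open>The defining relations in terms of functionals\<close>

lemma ip_eps: "ip n (eps i) (eps j) = of_bool (i = j \<and> i \<in> {1..n})"
proof -
  have "ip n (eps i) (eps j) = (\<Sum>k=1..n. if k = i then of_bool (i = j) else 0)"
    unfolding ip_def eps_def by (rule sum.cong) auto
  then show ?thesis by simp
qed

lemma ip_simple_root: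
  assumes "i \<in> {1..n}" "j \<in> {1..n}"
  shows "ip n (simple_root n i) (simple_root n j) =
    (if i = j then if i < n then 2 else 1 else if j = i + 1 \<or> i = j + 1 then - 1 else 0)"
proof -
  have diff: "ip n (\<lambda>k. x k - y k) z = ip n x z - ip n y z"
      "ip n z (\<lambda>k. x k - y k) = ip n z x - ip n z y" for x y z
    by (simp_all add: ip_def algebra_simps sum_subtractf)
  show ?thesis
    using assms by (auto simp: simple_root_def ip_eps diff)
qed

lemma ip_eps_simple_root:
  assumes "k \<in> {1..n}" "i \<in> {1..n}"
  shows "ip n (eps k) (simple_root n i) = of_bool (k = i) - of_bool (k = i + 1)"
proof -
  have diff: "ip n z (\<lambda>k. x k - y k) = ip n z x - ip n z y" for x y z
    by (simp_all add: ip_def algebra_simps sum_subtractf)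
  show ?thesis
    using assms by (auto simp: simple_root_def ip_eps diff)
qed

text \<open>The last root is the short one, whence \<open>a_ij = - 2\<close> for
  \<open>i = n\<close> and its neighbour. Apart from this there are only commuting pairs and pairs
  with \<open>a_ij = - 1\<close>, so the Serre relations have three shapes.\<close>

lemma cartan_simple_root:
  assumes "i \<in> {1..n}" "j \<in> {1..n}" "i \<noteq> j"
  shows "nat (1 - cartan n i j) = (if j = i + 1 \<or> i = j + 1 then if i < n then 2 else 3 else 1)"
  using assms by (auto simp: cartan_def ip_simple_root)

lemma word_parity_Nil [simp]: "word_parity n [] = 0"
  and word_parity_Cons [simp]: "word_parity n (g # w) = gen_parity n g + word_parity n w"
  and word_parity_append [simp]: "word_parity n (u @ v) = word_parity n u + word_parity n v"
  by (simp_all add: word_parity_def)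

lemma sgn2_simps [simp]: "sgn2 0 p = 1" "sgn2 p 0 = 1" "sgn2 1 1 = - 1"
  by (auto simp: sgn2_def)

lemma sgn2_add_left: "sgn2 (p + r) s = sgn2 p s * sgn2 r s"
  by (cases p; cases r; cases s) (simp_all add: sgn2_def)

lemma sgn2_add_right: "sgn2 s (p + r) = sgn2 s p * sgn2 s r"
  by (cases p; cases r; cases s) (simp_all add: sgn2_def)

lemma sgn2_commute: "sgn2 p r = sgn2 r p"
  by (cases p; cases r) (simp_all add: sgn2_def)

lemma sgn2_square [simp]: "sgn2 p r * sgn2 p r = 1" "sgn2 p r * (sgn2 p r * x) = x"
  by (cases p; cases r; simp add: sgn2_def)+

lemma ev_sign_twist: "ev f (sign_twist n p a) = ev (\<lambda>w. sgn2 p (word_parity n w) * f w) a"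
  by (simp add: sign_twist_def ev_lin_ext)

text \<open>The pairing of the weight of a word with \<open>\<alpha>\<^sub>i\<close>.\<close>

fun gen_wt :: "nat \<Rightarrow> nat \<Rightarrow> gen \<Rightarrow> int" where
  "gen_wt n i (K j) = 0"
| "gen_wt n i (Kinv j) = 0"
| "gen_wt n i (E j) = ip n (simple_root n i) (simple_root n j)"
| "gen_wt n i (F j) = - ip n (simple_root n i) (simple_root n j)"

definition wt :: "nat \<Rightarrow> nat \<Rightarrow> gen list \<Rightarrow> int" where
  "wt n i w = (\<Sum>g\<leftarrow>w. gen_wt n i g)"

lemma wt_simps [simp]: "wt n i [] = 0" "wt n i (g # w) = gen_wt n i g + wt n i w"
  "wt n i (u @ v) = wt n i u + wt n i v"
  by (simp_all add: wt_def)

text \<open>With \<open>t\<close> recording one letter \<open>X i\<close> moved to the right of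
  \<open>X j\<close>, the iterated commutators have the generating polynomials (1 - t/q)(1 - q t)
  and (1 - t/q)(1 + t)(1 - q t); the factor 1 + t is due to the odd parity of the last root. Both
  are invariant under q -> 1/q, so one formula serves for \<open>E\<close> and
  \<open>F\<close>.\<close>

definition serre :: "nat \<Rightarrow> complex \<Rightarrow> (nat \<Rightarrow> gen) \<Rightarrow> nat \<Rightarrow> nat \<Rightarrow> (gen list \<Rightarrow> complex) \<Rightarrow> bool" where
  "serre n q X i j f \<longleftrightarrow>
    (if j = i + 1 \<or> i = j + 1 then
       if i < n then f [X i, X i, X j] + f [X j, X i, X i] = (q + inverse q) * f [X i, X j, X i]
       else f [X i, X i, X i, X j] + f [X j, X i, X i, X i]
         = (q + inverse q - 1) * (f [X i, X i, X j, X i] + f [X i, X j, X i, X i])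
     else f [X i, X j] = f [X j, X i])"

definition k_relations :: "nat \<Rightarrow> complex \<Rightarrow> (gen list \<Rightarrow> complex) \<Rightarrow> bool" where
  "k_relations n q f \<longleftrightarrow> (\<forall>i\<in>{1..n}.
     f [K i, Kinv i] = f [] \<and> f [Kinv i, K i] = f [] \<and>
     (\<forall>j\<in>{1..n}. f [K i, K j] = f [K j, K i] \<and>
        f [K i, E j] = q powi ip n (simple_root n i) (simple_root n j) * f [E j, K i] \<and>
        f [K i, F j] = q powi (- ip n (simple_root n i) (simple_root n j)) * f [F j, K i]))"

definition ef_relation :: "nat \<Rightarrow> complex \<Rightarrow> nat \<Rightarrow> nat \<Rightarrow> (gen list \<Rightarrow> complex) \<Rightarrow> bool" where
  "ef_relation n q i j f \<longleftrightarrow>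
     f [E i, F j] - sgn2 (gen_parity n (E i)) (gen_parity n (F j)) * f [F j, E i]
       = (if i = j then (f [K i] - f [Kinv i]) / (q - inverse q) else 0)"

definition relations :: "nat \<Rightarrow> complex \<Rightarrow> (gen list \<Rightarrow> complex) \<Rightarrow> bool" where
  "relations n q f \<longleftrightarrow> k_relations n q f \<and> (\<forall>i\<in>{1..n}. \<forall>j\<in>{1..n}. ef_relation n q i j f \<and>
     (i \<noteq> j \<longrightarrow> serre n q E i j f \<and> serre n q F i j f))"

section \<open>Moving the generators \<open>K i\<close> through words, and expanding the Serre
  relations\<close>

locale quantum_osp =
  fixes n :: nat and q :: complex
  assumes q_nonzero: "q \<noteq> 0"
begin

definition k_closed :: "(gen list \<Rightarrow> complex) \<Rightarrow> bool" where
  "k_closed f \<longleftrightarrow> (\<forall>u v. okw n u \<longrightarrow> okw n v \<longrightarrow> k_relations n q (\<lambda>w. f (u @ w @ v)))"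

context
  fixes f assumes k: "k_closed f"
begin

lemma k_cancel:
  assumes "i \<in> {1..n}" "okw n u" "okw n v"
  shows "f (u @ K i # Kinv i # v) = f (u @ v)" "f (u @ Kinv i # K i # v) = f (u @ v)"
  using k assms by (auto simp: k_closed_def k_relations_def)

lemma k_swap:
  assumes "i \<in> {1..n}" "gen_index g \<in> {1..n}" "okw n u" "okw n v"
  shows "f (u @ K i # g # v) = q powi gen_wt n i g * f (u @ g # K i # v)"
proof -
  have k: "k_relations n q (\<lambda>w. f (u @ w @ v))"
    if "okw n u" "okw n v" for u v
    using k that by (simp add: k_closed_def)
  show ?thesis
  proof (cases g)
    case (Kinv j)
    have j: "j \<in> {1..n}" using assms(2) Kinv by simp
    \<comment> \<open>The relations do not mention \<open>K i\<close> together with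
      \<open>Kinv j\<close>. Insert \<open>Kinv j\<close>, \<open>K j\<close> in front, commute
      \<open>K j\<close> with \<open>K i\<close>, and cancel.\<close>
    have "f (u @ K i # Kinv j # v) = f ((u @ [Kinv j]) @ K j # K i # Kinv j # v)"
      using k_cancel(2)[of j u "K i # Kinv j # v"] j assms by simp
    also have "\<dots> = f ((u @ [Kinv j]) @ K i # K j # Kinv j # v)"
      using k[of "u @ [Kinv j]" "Kinv j # v"] j assms unfolding k_relations_def by simp
    also have "\<dots> = f (u @ Kinv j # K i # v)"
      using k_cancel(1)[of j "u @ [Kinv j, K i]" v] j assms by simp
    finally show ?thesis using Kinv by simp
  qed (use k[OF assms(3,4)] assms(1,2) in \<open>auto simp: k_relations_def\<close>)
qed

lemma k_move:
  assumes "i \<in> {1..n}" "okw n u" "okw n w" "okw n v"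
  shows "f (u @ K i # w @ v) = q powi wt n i w * f (u @ w @ K i # v)"
  using assms(2,3)
proof (induction w arbitrary: u)
  case (Cons g w)
  then show ?case
    using k_swap[of i g u "w @ v"] Cons.IH[of "u @ [g]"] assms
    by (simp add: power_int_add q_nonzero)
qed simp

lemma kinv_move:
  assumes "i \<in> {1..n}" "okw n u" "okw n w" "okw n v"
  shows "f (u @ Kinv i # w @ v) = q powi (- wt n i w) * f (u @ w @ Kinv i # v)"
proof -
  have "f (u @ w @ Kinv i # v) = f (u @ Kinv i # K i # w @ Kinv i # v)"
    using k_cancel(2)[of i u "w @ Kinv i # v"] assms by simp
  also have "\<dots> = q powi wt n i w * f (u @ Kinv i # w @ K i # Kinv i # v)"
    using k_move[of i "u @ [Kinv i]" w "Kinv i # v"] assms by simp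
  also have "\<dots> = q powi wt n i w * f (u @ Kinv i # w @ v)"
    using k_cancel(1)[of i "u @ Kinv i # w" v] assms by simp
  finally show ?thesis by (simp add: power_int_minus q_nonzero)
qed

lemma k_conj:
  assumes "i \<in> {1..n}" "okw n u" "okw n w" "okw n v"
  shows "f (u @ K i # w @ Kinv i # v) = q powi wt n i w * f (u @ w @ v)"
  using k_move[of i u w "Kinv i # v"] k_cancel(1)[of i "u @ w" v] assms by simp

end

text \<open>The one consequence of the Cartan relations that the expansion of \<open>Ad_E\<close>
  and \<open>Ad_F\<close> uses; it passes to \<open>ad X i f\<close>, as the induction on powers
  requires.\<close>

definition conj_closed :: "(gen list \<Rightarrow> complex) \<Rightarrow> bool" where
  "conj_closed f \<longleftrightarrow> (\<forall>i\<in>{1..n}. \<forall>u w v. okw n u \<longrightarrow> okw n w \<longrightarrow> okw n v \<longrightarrow>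
     f (u @ K i # w @ Kinv i # v) = q powi wt n i w * f (u @ w @ v))"

text \<open>The transpose of \<open>Ad_E\<close> and \<open>Ad_F\<close>: conjugation of a word by
  \<open>K i\<close> has been replaced by its eigenvalue, so that powers can be evaluated on a
  single letter.\<close>

definition ad :: "(nat \<Rightarrow> gen) \<Rightarrow> nat \<Rightarrow> (gen list \<Rightarrow> complex) \<Rightarrow> gen list \<Rightarrow> complex" where
  "ad X i f w = f (X i # w)
     - sgn2 (gen_parity n (X i)) (word_parity n w) * q powi wt n i w * f (w @ [X i])"

lemma conj_closed_ad:
  assumes "conj_closed f" "gen_index (X i) \<in> {1..n}"
  shows "conj_closed (ad X i f)"
  unfolding conj_closed_def
proof (intro ballI allI impI)
  fix j u w v
  assume *: "j \<in> {1..n}" "okw n u" "okw n w" "okw n v"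
  have 1: "f (X i # u @ K j # w @ Kinv j # v) = q powi wt n j w * f (X i # u @ w @ v)"
    using assms * append_Cons unfolding conj_closed_def by (metis okw_Cons)
  have 2: "f (u @ K j # w @ Kinv j # v @ [X i]) = q powi wt n j w * f (u @ w @ v @ [X i])"
    using assms * unfolding conj_closed_def by simp
  show "ad X i f (u @ K j # w @ Kinv j # v) = q powi wt n j w * ad X i f (u @ w @ v)"
    using 1 2 by (simp add: ad_def algebra_simps)
qed

lemma ev_Ad:
  assumes "conj_closed f" "i \<in> {1..n}" "a \<in> carrier (free_alg n)"
  shows "ev f (Ad_E n i a) = ev (ad E i f) a" "ev f (Ad_F n i a) = ev (ad F i f) a"
proof -
  have conj: "f (K i # w @ [Kinv i, g]) = q powi wt n i w * f (w @ [g])"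
    if "okw n w" "gen_index g \<in> {1..n}" for w g
    using assms(1,2) that unfolding conj_closed_def
    by (auto dest!: bspec[of _ _ i] dest: spec[of _ "[]"])
  have "ev f (Ad_E n i a) = ev (\<lambda>w. f (E i # w) - sgn2 (gen_parity n (E i)) (word_parity n w)
      * f (K i # w @ [Kinv i, E i])) a"
    by (simp add: Ad_E_def ev_mult ev_sign_twist ev_fun_diff)
  also have "\<dots> = ev (ad E i f) a"
    using assms(2) by (intro ev_cong[OF assms(3)]) (simp add: ad_def conj)
  finally show "ev f (Ad_E n i a) = ev (ad E i f) a" .
  have "ev f (Ad_F n i a) = ev (\<lambda>w. f (F i # w) - sgn2 (gen_parity n (F i)) (word_parity n w)
      * f (K i # w @ [Kinv i, F i])) a"
    by (simp add: Ad_F_def ev_mult ev_sign_twist ev_fun_diff)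
  also have "\<dots> = ev (ad F i f) a"
    using assms(2) by (intro ev_cong[OF assms(3)]) (simp add: ad_def conj)
  finally show "ev f (Ad_F n i a) = ev (ad F i f) a" .
qed

lemma ev_Ad_power:
  assumes "conj_closed f" "i \<in> {1..n}" "a \<in> carrier (free_alg n)"
  shows "ev f ((Ad_E n i ^^ m) a) = ev ((ad E i ^^ m) f) a"
    and "ev f ((Ad_F n i ^^ m) a) = ev ((ad F i ^^ m) f) a"
proof -
  have cl: "(Ad_E n i ^^ m) a \<in> carrier (free_alg n)" "(Ad_F n i ^^ m) a \<in> carrier (free_alg n)" for m
    using assms(2,3)
    by (induction m) (auto simp: Ad_E_def Ad_F_def intro!: free_alg_closed gen_closed)
  have ad: "conj_closed (ad E i g)" "conj_closed (ad F i g)" if "conj_closed g" for g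
    using that assms(2) by (simp_all add: conj_closed_ad)
  show "ev f ((Ad_E n i ^^ m) a) = ev ((ad E i ^^ m) f) a"
    using assms(1)
    by (induction m arbitrary: f)
      (simp_all add: ev_Ad(1)[OF _ assms(2) cl(1)] ad funpow_swap1[of "ad E i"])
  show "ev f ((Ad_F n i ^^ m) a) = ev ((ad F i ^^ m) f) a"
    using assms(1)
    by (induction m arbitrary: f)
      (simp_all add: ev_Ad(2)[OF _ assms(2) cl(2)] ad funpow_swap1[of "ad F i"])
qed

lemma serre_iff:
  assumes X: "X = E \<or> X = F" and ij: "i \<in> {1..n}" "j \<in> {1..n}" "i \<noteq> j"
  shows "(ad X i ^^ nat (1 - cartan n i j)) f [X j] = 0 \<longleftrightarrow> serre n q X i j f"
proof -
  have par: "gen_parity n (X k) = of_bool (k = n)" for k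
    using X by auto
  \<comment> \<open>The weights of \<open>E\<close> and \<open>F\<close> differ by a sign only;
    \<open>s\<close> lets one computation cover both.\<close>
  obtain s :: int where s: "s = 1 \<or> s = - 1"
      and wtX: "\<And>k l. gen_wt n k (X l) = s * ip n (simple_root n k) (simple_root n l)"
    using X by (cases "X = E") (auto intro: that[of 1] that[of "- 1"])
  note simps = ad_def par wtX ip_simple_root cartan_simple_root serre_def eval_nat_numeral
    power_int_minus sgn2_def
  consider "j \<noteq> i + 1" "i \<noteq> j + 1" | "j = i + 1 \<or> i = j + 1" "i < n" | "i = n" "Suc j = n"
    using ij by fastforce
  then show ?thesis
  proof cases
    case 1
    then show ?thesis using ij by (auto simp: simps)
  next
    case 2
    have "(ad X i ^^ 2) f [X j] = f [X i, X i, X j] + f [X j, X i, X i] - (q + inverse q) * f [X i, X j, X i]"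
      using s 2 ij q_nonzero by (auto simp: simps) (simp_all add: field_simps)
    then show ?thesis using 2 ij by (simp add: cartan_simple_root serre_def)
  next
    case 3
    have "(ad X i ^^ 3) f [X j] = f [X i, X i, X i, X j] + f [X j, X i, X i, X i]
         - (q + inverse q - 1) * (f [X i, X i, X j, X i] + f [X i, X j, X i, X i])"
    proof -
      have [simp]: "i = n" "Suc j = n" "1 \<le> j" "j \<noteq> n" "n \<noteq> j" "1 \<le> n" "j \<le> n" "j \<noteq> Suc n"
          "n \<noteq> 0" "Suc 0 \<le> n" "Suc 0 \<le> j"
        using 3 ij by auto
      show ?thesis
        using s by (elim disjE; simp add: simps) (simp_all add: field_simps q_nonzero)
    qed
    then show ?thesis using 3 ij by (simp add: cartan_simple_root serre_def)
  qed
qed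

lemma k_relations_iff:
  "k_relations n q f \<longleftrightarrow> (\<forall>i\<in>{1..n}.
     ev f (gen (K i) * gen (Kinv i) - 1) = 0 \<and> ev f (gen (Kinv i) * gen (K i) - 1) = 0 \<and>
     (\<forall>j\<in>{1..n}. ev f (gen (K i) * gen (K j) - gen (K j) * gen (K i)) = 0 \<and>
        ev f (gen (K i) * gen (E j)
          - const (q powi ip n (simple_root n i) (simple_root n j)) * gen (E j) * gen (K i)) = 0 \<and>
        ev f (gen (K i) * gen (F j)
          - const (q powi (- ip n (simple_root n i) (simple_root n j))) * gen (F j) * gen (K i)) = 0))"
  by (simp add: k_relations_def mult.assoc mon_mult)

lemma conj_closedI: "k_closed f \<Longrightarrow> conj_closed f"
  by (simp add: conj_closed_def k_conj)

lemma k_closed_context: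
  assumes "k_closed f" "okw n u" "okw n v"
  shows "k_closed (\<lambda>w. f (u @ w @ v))"
  unfolding k_closed_def
proof (intro allI impI)
  fix u' v'
  assume "okw n u'" "okw n v'"
  then have "k_relations n q (\<lambda>w. f ((u @ u') @ w @ (v' @ v)))"
    using assms unfolding k_closed_def by (metis okw_append)
  then show "k_relations n q (\<lambda>w. f (u @ (u' @ w @ v') @ v))" by simp
qed

lemma vanishes_on_relations_iff:
  "(\<forall>r\<in>osp_relations n q. ev f r = 0) \<longleftrightarrow> k_relations n q f \<and>
    (\<forall>i\<in>{1..n}. \<forall>j\<in>{1..n}. ef_relation n q i j f \<and>
     (i \<noteq> j \<longrightarrow> ev f ((Ad_E n i ^^ nat (1 - cartan n i j)) (gen (E j))) = 0 \<and>
       ev f ((Ad_F n i ^^ nat (1 - cartan n i j)) (gen (F j))) = 0))"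
proof -
  have ef: "ev f (gen (E i) * gen (F j)
      - const (sgn2 (gen_parity n (E i)) (gen_parity n (F j))) * gen (F j) * gen (E i)
      - (if i = j then const (1 / (q - inverse q)) * (gen (K i) - gen (Kinv i)) else 0)) = 0
    \<longleftrightarrow> ef_relation n q i j f" for i j
    by (cases "i = j") (simp_all add: mult.assoc mon_mult ef_relation_def)
  have if_ball: "(\<forall>r\<in>(if i = j then {} else S). P r) \<longleftrightarrow> (i \<noteq> j \<longrightarrow> (\<forall>r\<in>S. P r))"
    for i j :: nat and S :: "falg set" and P
    by simp
  show ?thesis
    unfolding osp_relations_def k_relations_iff ball_UN ball_Un if_ball
    by (simp only: ball_simps ef) blast
qed

text \<open>Translating the Serre elements into words uses conjugation by \<open>K i\<close>, hence
  the Cartan relations in every context. Under \<open>k_closed\<close> the two sides agree context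
  by context.\<close>

lemma resp_iff:
  "resp n q f \<longleftrightarrow> (\<forall>u v. okw n u \<longrightarrow> okw n v \<longrightarrow> relations n q (\<lambda>w. f (u @ w @ v)))"
proof -
  have eq: "(\<forall>r\<in>osp_relations n q. ev g r = 0) \<longleftrightarrow> relations n q g" if "k_closed g" for g
  proof -
    have "ev g ((Ad_E n i ^^ m) (gen (E j))) = (ad E i ^^ m) g [E j]"
      "ev g ((Ad_F n i ^^ m) (gen (F j))) = (ad F i ^^ m) g [F j]"
      if ij: "i \<in> {1..n}" "j \<in> {1..n}" for i j m
    proof -
      have E: "gen (E j) \<in> carrier (free_alg n)" and F: "gen (F j) \<in> carrier (free_alg n)"
        using ij gen_closed[of "E j"] gen_closed[of "F j"] by auto
      show "ev g ((Ad_E n i ^^ m) (gen (E j))) = (ad E i ^^ m) g [E j]"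
        unfolding ev_Ad_power(1)[OF conj_closedI[OF \<open>k_closed g\<close>] ij(1) E] by simp
      show "ev g ((Ad_F n i ^^ m) (gen (F j))) = (ad F i ^^ m) g [F j]"
        unfolding ev_Ad_power(2)[OF conj_closedI[OF \<open>k_closed g\<close>] ij(1) F] by simp
    qed
    then have "(ev g ((Ad_E n i ^^ nat (1 - cartan n i j)) (gen (E j))) = 0 \<longleftrightarrow> serre n q E i j g) \<and>
        (ev g ((Ad_F n i ^^ nat (1 - cartan n i j)) (gen (F j))) = 0 \<longleftrightarrow> serre n q F i j g)"
      if "i \<in> {1..n}" "j \<in> {1..n}" "i \<noteq> j" for i j
      using that serre_iff[of E i j g] serre_iff[of F i j g] by auto
    then show ?thesis
      unfolding vanishes_on_relations_iff relations_def
      by (intro conj_cong refl ball_cong imp_cong) simp_all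
  qed
  have resp: "resp n q f \<longleftrightarrow>
      (\<forall>u v. okw n u \<longrightarrow> okw n v \<longrightarrow> (\<forall>r\<in>osp_relations n q. ev (\<lambda>w. f (u @ w @ v)) r = 0))"
    unfolding resp_def by blast
  show ?thesis
  proof (cases "k_closed f")
    case True
    show ?thesis
      unfolding resp by (intro iff_allI imp_cong refl eq k_closed_context[OF True])
  next
    \<comment> \<open>Both sides contain the Cartan relations in every context, so now both
      fail.\<close>
    case False
    then obtain u v where uv: "okw n u" "okw n v" "\<not> k_relations n q (\<lambda>w. f (u @ w @ v))"
      unfolding k_closed_def by blast
    have "\<not> relations n q (\<lambda>w. f (u @ w @ v))"
      "\<not> (\<forall>r\<in>osp_relations n q. ev (\<lambda>w. f (u @ w @ v)) r = 0)"
      using uv(3) by (simp_all add: relations_def vanishes_on_relations_iff)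
    then show ?thesis unfolding resp using uv(1,2) by blast
  qed
qed

lemma resp_k_closed: "resp n q f \<Longrightarrow> k_closed f"
  by (simp add: resp_iff relations_def k_closed_def)

end

text \<open>Parities are to stay sums, as \<open>word_parity_append\<close> and the addition laws of
  \<open>sgn2\<close> expect.\<close>

declare add_bit_eq_xor [simp del]

lemma bit_add_self [simp]: "(a :: bit) + a = 0" "a + (a + b) = b"
  by (cases a; cases b; simp add: add_bit_eq_xor)+

section \<open>Closure properties of functionals on the quotient\<close>

context quantum_osp
begin

lemma relations_zero: "relations n q (\<lambda>w. 0)"
  by (simp add: relations_def k_relations_def serre_def ef_relation_def)

lemma relations_add:
  assumes "relations n q f" "relations n q g"
  shows "relations n q (\<lambda>w. f w + g w)"
proof -
  have s: "serre n q X i j (\<lambda>w. f w + g w)" if "serre n q X i j f" "serre n q X i j g" for X i j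
    using that by (auto simp: serre_def algebra_simps split: if_splits)
  have "ef_relation n q i j (\<lambda>w. f w + g w)"
    if "ef_relation n q i j f" "ef_relation n q i j g" for i j
    unfolding ef_relation_def
    using arg_cong2[OF that[unfolded ef_relation_def], of "(+)"]
    by (cases "i = j") (simp_all add: algebra_simps add_divide_distrib diff_divide_distrib)
  then show ?thesis
    using assms by (simp add: relations_def k_relations_def s distrib_left)
qed

lemma relations_scale:
  assumes "relations n q f"
  shows "relations n q (\<lambda>w. c * f w)"
proof -
  have s: "serre n q X i j (\<lambda>w. c * f w)" if "serre n q X i j f" for X i j
    using that unfolding serre_def
    by (auto simp: mult.left_commute simp flip: distrib_left)
  have "ef_relation n q i j (\<lambda>w. c * f w)" if "ef_relation n q i j f" for i j
    unfolding ef_relation_def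
    using arg_cong[OF that[unfolded ef_relation_def], of "\<lambda>x. c * x"]
    by (cases "i = j") (simp_all add: algebra_simps)
  then show ?thesis
    using assms by (simp add: relations_def k_relations_def s mult.left_commute)
qed

text \<open>Every relation is homogeneous for the grading of words by the root lattice; for
  \<open>E i\<close>, \<open>F i\<close> against \<open>K i\<close> this is the hypothesis
  \<open>c [E i] * c [F i] = 1\<close>. So a multiplicative \<open>c\<close> scales each relation by
  a constant. It is applied to the parity sign and to the inverse eigenvalues of
  \<open>S^2\<close>.\<close>

lemma relations_character:
  assumes f: "relations n q f"
    and c: "\<And>u v. c (u @ v) = c u * c v" "\<And>i. c [K i] = 1" "\<And>i. c [Kinv i] = 1"
      "\<And>i. c [E i] * c [F i] = 1"
  shows "relations n q (\<lambda>w. c w * f w)"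
proof -
  have Cons: "c (g # h # w) = c [g] * c (h # w)" for g h w
    using c(1)[of "[g]" "h # w"] by simp
  have Nil: "c [] = 1" using c(1)[of "[K 0]" "[]"] c(2) by simp
  have s: "serre n q X i j (\<lambda>w. c w * f w)" if "serre n q X i j f" for X i j
  proof -
    have "a * a * b * x + b * a * a * y = (q + inverse q) * (a * b * a * z)"
      if "x + y = (q + inverse q) * z" for a b x y z
      using arg_cong[OF that, of "\<lambda>x. a * a * b * x"] by (simp add: algebra_simps)
    moreover have "a * a * a * b * x + b * a * a * a * y =
        (q + inverse q - 1) * (a * a * b * a * z + a * b * a * a * z')"
      if "x + y = (q + inverse q - 1) * (z + z')" for a b x y z z'
      using arg_cong[OF that, of "\<lambda>x. a * a * a * b * x"] by (simp add: algebra_simps)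
    ultimately show ?thesis
      using that unfolding serre_def Cons by (auto simp: mult.assoc)
  qed
  have e: "ef_relation n q i j (\<lambda>w. c w * f w)" if "ef_relation n q i j f" for i j
  proof -
    have "c [E i] * c [F j] * (f [E i, F j]
          - sgn2 (gen_parity n (E i)) (gen_parity n (F j)) * f [F j, E i])
        = (if i = j then (f [K i] - f [Kinv i]) / (q - inverse q) else 0)"
      using that by (simp add: ef_relation_def c(4))
    then show ?thesis by (simp add: ef_relation_def Cons c(2,3) algebra_simps)
  qed
  show ?thesis
    using f by (simp add: relations_def k_relations_def s Cons Nil c(2,3) mult.left_commute e)
qed

lemma relations_ev:
  assumes "\<And>x. x \<in> Poly_Mapping.keys a \<Longrightarrow> relations n q (f x)"
  shows "relations n q (\<lambda>w. ev (\<lambda>x. f x w) a)"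
proof -
  have "relations n q (\<lambda>w. \<Sum>x\<in>A. Poly_Mapping.lookup a x * f x w)"
    if "finite A" "A \<subseteq> Poly_Mapping.keys a" for A
    using that
    by (induction A) (auto intro!: relations_zero relations_add relations_scale assms)
  then show ?thesis unfolding ev_def by simp
qed

lemma resp_relations: "resp n q f \<Longrightarrow> okw n u \<Longrightarrow> okw n v \<Longrightarrow> relations n q (\<lambda>w. f (u @ w @ v))"
  by (simp add: resp_iff)

lemma resp_context:
  assumes "resp n q f" "okw n u" "okw n v"
  shows "resp n q (\<lambda>w. f (u @ w @ v))"
  unfolding resp_iff
proof (intro allI impI)
  fix u' v'
  assume "okw n u'" "okw n v'"
  then show "relations n q (\<lambda>w. f (u @ (u' @ w @ v') @ v))"
    using resp_relations[OF assms(1), of "u @ u'" "v' @ v"] assms(2,3) by simp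
qed

lemma resp_left: "resp n q f \<Longrightarrow> okw n u \<Longrightarrow> resp n q (\<lambda>w. f (u @ w))"
  using resp_context[of f u "[]"] by simp

lemma resp_right: "resp n q f \<Longrightarrow> okw n v \<Longrightarrow> resp n q (\<lambda>w. f (w @ v))"
  using resp_context[of f "[]" v] by simp

lemma resp_add: "resp n q f \<Longrightarrow> resp n q g \<Longrightarrow> resp n q (\<lambda>w. f w + g w)"
  by (simp add: resp_iff relations_add)

lemma resp_scale: "resp n q f \<Longrightarrow> resp n q (\<lambda>w. c * f w)"
  by (simp add: resp_iff relations_scale)

lemma resp_ev:
  "(\<And>x. x \<in> Poly_Mapping.keys a \<Longrightarrow> resp n q (f x)) \<Longrightarrow> resp n q (\<lambda>w. ev (\<lambda>x. f x w) a)"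
  by (simp add: resp_iff relations_ev)

lemma resp_character:
  assumes f: "resp n q f"
    and c: "\<And>u v. c (u @ v) = c u * c v" "\<And>i. c [K i] = 1" "\<And>i. c [Kinv i] = 1"
      "\<And>i. c [E i] * c [F i] = (1 :: complex)"
  shows "resp n q (\<lambda>w. c w * f w)"
  unfolding resp_iff
proof (intro allI impI)
  fix u v
  assume "okw n u" "okw n v"
  then have "relations n q (\<lambda>w. (c u * c v) * (c w * f (u @ w @ v)))"
    by (intro relations_scale relations_character resp_relations f c)
  then show "relations n q (\<lambda>w. c (u @ w @ v) * f (u @ w @ v))"
    by (simp add: c(1) mult_ac)
qed

lemma resp_twist: "resp n q f \<Longrightarrow> resp n q (\<lambda>w. sgn2 p (word_parity n w) * f w)"
  by (rule resp_character) (auto simp: sgn2_add_right)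

lemma resp_cong:
  assumes "\<And>w. okw n w \<Longrightarrow> f w = g w" "resp n q g"
  shows "resp n q f"
  using assms(2) unfolding resp_def
proof (intro ballI allI impI)
  fix r u v
  assume *: "\<forall>r\<in>osp_relations n q. \<forall>u v. okw n u \<longrightarrow> okw n v \<longrightarrow> ev (\<lambda>w. g (u @ w @ v)) r = 0"
    "r \<in> osp_relations n q" "okw n u" "okw n v"
  have "ev (\<lambda>w. f (u @ w @ v)) r = ev (\<lambda>w. g (u @ w @ v)) r"
    using *(2-) osp_relations_closed by (intro ev_cong[of r n] assms(1)) auto
  then show "ev (\<lambda>w. f (u @ w @ v)) r = 0" using * by simp
qed

section \<open>The antipode\<close>

lemma antipode_gen_closed: "gen_index g \<in> {1..n} \<Longrightarrow> antipode_gen g \<in> carrier (free_alg n)"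
  by (cases g) (auto intro!: free_alg_closed gen_closed)

lemma antipode_word_closed: "okw n w \<Longrightarrow> antipode_word n w \<in> carrier (free_alg n)"
  by (induction w) (auto simp: zero_one_closed intro!: free_alg_closed scale_closed antipode_gen_closed)

text \<open>The transpose of the antipode, \<open>f o S\<close>.\<close>

definition anti :: "(gen list \<Rightarrow> complex) \<Rightarrow> gen list \<Rightarrow> complex" where
  "anti f w = ev f (antipode_word n w)"

lemma anti_simps:
  "anti f [] = f []"
  "anti f (K i # w) = anti (\<lambda>u. f (u @ [Kinv i])) w"
  "anti f (Kinv i # w) = anti (\<lambda>u. f (u @ [K i])) w"
  "anti f (E i # w) = - sgn2 (of_bool (i = n)) (word_parity n w) * anti (\<lambda>u. f (u @ [E i, Kinv i])) w"
  "anti f (F i # w) = - sgn2 (of_bool (i = n)) (word_parity n w) * anti (\<lambda>u. f (u @ [K i, F i])) w"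
  by (simp_all add: anti_def ev_mult mon_mult ev_fun_uminus)

text \<open>Graded antimultiplicativity of \<open>S\<close> in transposed form: \<open>S(v)\<close>
  stands in front, so \<open>v\<close> belongs to the outer functional.\<close>

lemma anti_append:
  "anti f (u @ v) = sgn2 (word_parity n u) (word_parity n v) * anti (\<lambda>y. anti (\<lambda>z. f (y @ z)) u) v"
proof (induction u arbitrary: f)
  case Nil
  then show ?case by (simp add: anti_simps)
next
  case (Cons g u)
  have "anti f ((g # u) @ v) = sgn2 (gen_parity n g) (word_parity n (u @ v))
      * anti (\<lambda>y. ev (\<lambda>z. f (y @ z)) (antipode_gen g)) (u @ v)"
    by (simp add: anti_def ev_mult)
  also have "\<dots> = sgn2 (gen_parity n g) (word_parity n (u @ v)) * sgn2 (word_parity n u) (word_parity n v)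
      * anti (\<lambda>y. anti (\<lambda>z. ev (\<lambda>t. f (y @ z @ t)) (antipode_gen g)) u) v"
    unfolding Cons.IH by simp
  also have "\<dots> = sgn2 (word_parity n (g # u)) (word_parity n v) *
      anti (\<lambda>y. sgn2 (gen_parity n g) (word_parity n u) * anti (\<lambda>z. ev (\<lambda>t. f (y @ z @ t)) (antipode_gen g)) u) v"
    unfolding word_parity_append word_parity_Cons anti_def ev_fun_scale
    by (simp only: sgn2_add_left sgn2_add_right mult_ac)
  finally show ?case
    by (simp add: anti_def ev_mult)
qed


text \<open>The antipode of \<open>u w v\<close> is \<open>S(v) S(w) S(u)\<close> up to sign. The
  outer factors are absorbed into another respectful functional, and the sign is a constant times a
  parity character of \<open>w\<close>, so it suffices to check the bare relations.\<close>

lemma resp_antiI: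
  assumes "\<And>g. resp n q g \<Longrightarrow> relations n q (anti g)" and f: "resp n q f"
  shows "resp n q (anti f)"
  unfolding resp_iff
proof (intro allI impI)
  fix u v
  assume uv: "okw n u" "okw n v"
  \<comment> \<open>This is \<open>z \<mapsto> f (S(v) z S(u))\<close>.\<close>
  define g where "g = (\<lambda>z. anti (\<lambda>y. anti (\<lambda>t. f (y @ z @ t)) u) v)"
  have "resp n q g"
    unfolding g_def anti_def
    using uv f antipode_word_closed[OF uv(1)] antipode_word_closed[OF uv(2)]
    by (intro resp_ev resp_context) (auto simp: carrier_free_alg)
  then have "relations n q (\<lambda>w. sgn2 (word_parity n u) (word_parity n v) *
      (sgn2 (word_parity n u + word_parity n v) (word_parity n w) * anti g w))"
    by (intro relations_scale relations_character assms(1)) (auto simp: sgn2_add_right)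
  moreover have "anti f (u @ w @ v) = sgn2 (word_parity n u) (word_parity n v) *
      (sgn2 (word_parity n u + word_parity n v) (word_parity n w) * anti g w)" for w
  proof -
    have "anti (\<lambda>y. anti (\<lambda>z. anti (\<lambda>t. f (y @ z @ t)) u) w) v = anti g w"
      unfolding g_def anti_def by (rule ev_swap)
    moreover have "anti f (u @ w @ v) = sgn2 (word_parity n u) (word_parity n w + word_parity n v) *
        sgn2 (word_parity n w) (word_parity n v) *
        anti (\<lambda>y. anti (\<lambda>z. anti (\<lambda>t. f (y @ z @ t)) u) w) v"
      unfolding anti_append[of f u] anti_append[of _ w] word_parity_append by simp
    ultimately show ?thesis
      by (simp only: sgn2_add_left sgn2_add_right sgn2_commute[of "word_parity n w"] mult_ac)
  qed
  ultimately show "relations n q (\<lambda>w. anti f (u @ w @ v))" by simp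
qed

section \<open>Normal ordering: Cartan letters move to the right in short words\<close>

context
  fixes f assumes k: "k_closed f"
begin

lemma k_normal:
  assumes "i \<in> {1..n}" "j \<in> {1..n}" "okw n u" "okw n v"
  shows "f (u @ K i # E j # v) = q powi ip n (simple_root n i) (simple_root n j) * f (u @ E j # K i # v)"
    and "f (u @ K i # F j # v) = q powi - ip n (simple_root n i) (simple_root n j) * f (u @ F j # K i # v)"
    and "f (u @ Kinv i # E j # v) = q powi - ip n (simple_root n i) (simple_root n j) * f (u @ E j # Kinv i # v)"
    and "f (u @ Kinv i # F j # v) = q powi ip n (simple_root n i) (simple_root n j) * f (u @ F j # Kinv i # v)"
    and "f (u @ Kinv i # K j # v) = f (u @ K j # Kinv i # v)"
  using assms k_move[OF k, of i u "[E j]" v] k_move[OF k, of i u "[F j]" v]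
    kinv_move[OF k, of i u "[E j]" v] kinv_move[OF k, of i u "[F j]" v]
    kinv_move[OF k, of i u "[K j]" v]
  by simp_all

lemma k_commute:
  assumes "i \<in> {1..n}" "j \<in> {1..n}" "okw n u" "okw n v"
  shows "f (u @ K i # K j # v) = f (u @ K j # K i # v)"
    and "f (u @ Kinv i # Kinv j # v) = f (u @ Kinv j # Kinv i # v)"
  using assms k_move[OF k, of i u "[K j]" v] kinv_move[OF k, of i u "[Kinv j]" v]
  by simp_all

text \<open>In a concrete list the prefix is not visible as a list \<open>u\<close> in front of
  \<open>@\<close>, so the rules are instantiated with explicit prefixes of increasing
  length.\<close>

lemmas k_simps =
  k_cancel[OF k, of _ "[]", simplified] k_cancel[OF k, of _ "[a]" for a, simplified]
  k_cancel[OF k, of _ "[a, b]" for a b, simplified] k_cancel[OF k, of _ "[a, b, c]" for a b c, simplified]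
  k_cancel[OF k, of _ "[a, b, c, d]" for a b c d, simplified]
  k_normal[of _ _ "[]", simplified] k_normal[of _ _ "[a]" for a, simplified]
  k_normal[of _ _ "[a, b]" for a b, simplified] k_normal[of _ _ "[a, b, c]" for a b c, simplified]
  k_normal[of _ _ "[a, b, c, d]" for a b c d, simplified]
  k_normal[of _ _ "[a, b, c, d, e]" for a b c d e, simplified]
  k_normal[of _ _ "[a, b, c, d, e, g]" for a b c d e g, simplified]

lemmas k_order =
  k_commute[of _ _ "[]", simplified] k_commute[of _ _ "[a]" for a, simplified]
  k_commute[of _ _ "[a, b]" for a b, simplified] k_commute[of _ _ "[a, b, c]" for a b c, simplified]
  k_commute[of _ _ "[a, b, c, d]" for a b c d, simplified]
  k_commute[of _ _ "[a, b, c, d, e]" for a b c d e, simplified]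
  k_commute[of _ _ "[a, b, c, d, e, g]" for a b c d e g, simplified]

end

text \<open>Up to sign, \<open>S\<close> multiplies \<open>E i\<close> and \<open>F i\<close> by a
  Cartan letter. After normal ordering each relation for \<open>f o S\<close> is a relation for
  \<open>f\<close>, read in reverse order and up to a tail of Cartan letters; the Serre coefficients
  are symmetric under reversal.\<close>

lemma relations_anti:
  assumes f: "resp n q f"
  shows "relations n q (anti f)"
  unfolding relations_def
proof (intro conjI ballI impI)
  note ks = k_simps[OF resp_k_closed[OF f]] and ko = k_order[OF resp_k_closed[OF f]]
  show "k_relations n q (anti f)"
    by (simp add: k_relations_def anti_simps ks ko power_int_minus q_nonzero)
  fix i j
  assume ij: "i \<in> {1..n}" "j \<in> {1..n}"
  have ef: "ef_relation n q i j (\<lambda>w. f (w @ v))" if "okw n v" for v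
    using resp_relations[OF f, of "[]" v] that ij by (simp add: relations_def)
  show "ef_relation n q i j (anti f)"
  proof -
    \<comment> \<open>\<open>q - inverse q\<close> may vanish here, since only
      \<open>q \<noteq> 0\<close> is assumed; its inverse is kept opaque.\<close>
    obtain d where d: "inverse (q - inverse q) = d" by blast
    have [simp]: "inverse (q ^ m) * (q ^ m * x) = x" "q ^ m * (inverse (q ^ m) * x) = x"
        "inverse q * (q * x) = x" "q * (inverse q * x) = x" for m x
      by (simp_all add: q_nonzero)
    show ?thesis
      using ij ef[of "[]"] ef[of "[K j, Kinv i]"]
      unfolding ef_relation_def divide_inverse d
      by (cases "i = j"; cases "i = n"; cases "j = n")
        (simp_all add: anti_simps ks power_int_minus ip_simple_root, simp_all add: algebra_simps)
  qed
  assume "i \<noteq> j"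
  have serre: "serre n q E i j (\<lambda>w. f (w @ v))" "serre n q F i j (\<lambda>w. f (w @ v))" if "okw n v" for v
    using resp_relations[OF f, of "[]" v] that ij \<open>i \<noteq> j\<close> by (simp_all add: relations_def)
  consider "j \<noteq> i + 1" "i \<noteq> j + 1" | "j = i + 1 \<or> i = j + 1" "i < n" | "i = n" "Suc j = n"
    using ij \<open>i \<noteq> j\<close> by fastforce
  then have "serre n q E i j (anti f) \<and> serre n q F i j (anti f)"
  proof cases
    case 1
    have "f [E i, E j, Kinv i, Kinv j] = f [E j, E i, Kinv i, Kinv j]"
      "f [F i, F j, K i, K j] = f [F j, F i, K i, K j]"
      using 1 serre(1)[of "[Kinv i, Kinv j]"] serre(2)[of "[K i, K j]"] ij by (auto simp: serre_def)
    then show ?thesis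
      using ij 1 \<open>i \<noteq> j\<close>
      by (auto simp add: serre_def anti_simps ks ko[of j i] ip_simple_root)
  next
    case 2
    have ip: "ip n (simple_root n i) (simple_root n i) = 2" "ip n (simple_root n i) (simple_root n j) = - 1"
        "ip n (simple_root n j) (simple_root n i) = - 1"
      using ij 2 by (auto simp: ip_simple_root)
    \<comment> \<open>The Serre relation for \<open>f\<close>, with the tail that normal ordering
      leaves, is solved for its first word so as to serve as a rewrite rule.\<close>
    have "f [E i, E i, E j, Kinv i, Kinv i, Kinv j] = (q + inverse q) * f [E i, E j, E i, Kinv i, Kinv i, Kinv j]
        - f [E j, E i, E i, Kinv i, Kinv i, Kinv j]"
      "f [F i, F i, F j, K i, K i, K j] = (q + inverse q) * f [F i, F j, F i, K i, K i, K j]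
        - f [F j, F i, F i, K i, K i, K j]"
      using 2 serre(1)[of "[Kinv i, Kinv i, Kinv j]"] serre(2)[of "[K i, K i, K j]"] ij
      by (auto simp: serre_def eq_diff_eq)
    then show ?thesis
      using ij 2
      by (simp add: serre_def anti_simps ks ko[of j i] ip power_int_minus)
        (simp add: field_simps power2_eq_square q_nonzero)
  next
    case 3
    have ip: "ip n (simple_root n n) (simple_root n n) = 1" "ip n (simple_root n n) (simple_root n j) = - 1"
        "ip n (simple_root n j) (simple_root n n) = - 1"
      using ij 3 by (auto simp: ip_simple_root)
    have "f [E i, E i, E i, E j, Kinv i, Kinv i, Kinv i, Kinv j] = (q + inverse q - 1) *
        (f [E i, E i, E j, E i, Kinv i, Kinv i, Kinv i, Kinv j] + f [E i, E j, E i, E i, Kinv i, Kinv i, Kinv i, Kinv j])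
        - f [E j, E i, E i, E i, Kinv i, Kinv i, Kinv i, Kinv j]"
      "f [F i, F i, F i, F j, K i, K i, K i, K j] = (q + inverse q - 1) *
        (f [F i, F i, F j, F i, K i, K i, K i, K j] + f [F i, F j, F i, F i, K i, K i, K i, K j])
        - f [F j, F i, F i, F i, K i, K i, K i, K j]"
      using 3 serre(1)[of "[Kinv i, Kinv i, Kinv i, Kinv j]"] serre(2)[of "[K i, K i, K i, K j]"] ij
      by (auto simp: serre_def eq_diff_eq)
    then show ?thesis
      using ij \<open>i \<noteq> j\<close> 3
      by (simp add: serre_def anti_simps ks ko[of j n] ip power_int_minus)
        (simp add: field_simps power2_eq_square q_nonzero)
  qed
  then show "serre n q E i j (anti f)" "serre n q F i j (anti f)" by auto
qed

lemma resp_anti: "resp n q f \<Longrightarrow> resp n q (anti f)"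
  by (rule resp_antiI[OF relations_anti])

section \<open>The square of the antipode\<close>

lemma anti_cong:
  assumes "okw n w" "\<And>u. okw n u \<Longrightarrow> word_parity n u = word_parity n w \<Longrightarrow> f u = g u"
  shows "anti f w = anti g w"
  using assms
proof (induction w arbitrary: f g)
  case Nil
  then show ?case by (simp add: anti_simps)
next
  case (Cons x w)
  have "anti (\<lambda>u. f (u @ v)) w = anti (\<lambda>u. g (u @ v)) w"
    if "okw n v" "word_parity n v = gen_parity n x" for v
    using that Cons.prems by (intro Cons.IH) (auto simp: add.commute)
  then show ?case
    using Cons.prems(1) by (cases x) (auto simp: anti_simps)
qed

lemma anti_scale: "anti (\<lambda>w. c * f w) w = c * anti f w"
  by (simp add: anti_def ev_fun_scale)

text \<open>\<open>S^2\<close> acts on \<open>E i\<close> and \<open>F i\<close> as conjugation by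
  \<open>K i\<close>, and these are its eigenvalues.\<close>

fun square_gen :: "gen \<Rightarrow> complex" where
  "square_gen (K i) = 1"
| "square_gen (Kinv i) = 1"
| "square_gen (E i) = q powi ip n (simple_root n i) (simple_root n i)"
| "square_gen (F i) = q powi - ip n (simple_root n i) (simple_root n i)"

lemma anti_single:
  assumes "resp n q k" "gen_index g \<in> {1..n}"
  shows "ev (\<lambda>z. anti k z) (antipode_gen g) = square_gen g * k [g]"
proof -
  note ks = k_simps[OF resp_k_closed[OF assms(1)]]
  show ?thesis
    using assms(2) by (cases g) (simp_all add: anti_simps mon_mult ks)
qed

text \<open>\<open>S^2\<close> is an algebra homomorphism, since the signs of two reversals cancel;
  being diagonal on letters it is diagonal on words. This makes \<open>S\<close> invertible without
  an explicit formula for its inverse.\<close>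

lemma anti_anti:
  assumes "resp n q f" "okw n w"
  shows "anti (anti f) w = prod_list (map square_gen w) * f w"
  using assms
proof (induction w arbitrary: f)
  case Nil
  then show ?case by (simp add: anti_simps)
next
  case (Cons g w)
  have g: "gen_index g \<in> {1..n}" and w: "okw n w" using Cons.prems by auto
  define h where "h = (\<lambda>t. f (g # t))"
  have h: "resp n q h"
    using resp_left[OF Cons.prems(1), of "[g]"] g by (simp add: h_def)
  \<comment> \<open>Only words \<open>y\<close> with the parity of \<open>w\<close> occur in
    \<open>S(w)\<close>, which fixes the sign.\<close>
  have key: "ev (\<lambda>z. anti f (y @ z)) (antipode_gen g) = sgn2 (gen_parity n g) (word_parity n w)
      * (square_gen g * anti h y)"
    if y: "okw n y" "word_parity n y = word_parity n w" for y
  proof -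
    define k where "k s = anti (\<lambda>t. f (s @ t)) y" for s
    have k: "resp n q k"
      unfolding k_def anti_def
      using antipode_word_closed[OF y(1)] Cons.prems(1)
      by (intro resp_ev resp_right) (auto simp: carrier_free_alg)
    have "ev (\<lambda>z. anti f (y @ z)) (antipode_gen g)
        = ev (\<lambda>z. sgn2 (gen_parity n g) (word_parity n w) * anti k z) (antipode_gen g)"
      using g by (cases g) (auto simp: mon_mult anti_append[of f y] k_def[abs_def] y sgn2_commute)
    also have "\<dots> = sgn2 (gen_parity n g) (word_parity n w) * (square_gen g * k [g])"
      by (simp add: ev_fun_scale anti_single[OF k g])
    finally show ?thesis by (simp add: k_def h_def)
  qed
  have "anti (anti f) (g # w) = sgn2 (gen_parity n g) (word_parity n w)
      * anti (\<lambda>y. ev (\<lambda>z. anti f (y @ z)) (antipode_gen g)) w"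
    by (simp add: anti_def[of _ "g # w"] ev_mult) (simp add: anti_def)
  also have "\<dots> = sgn2 (gen_parity n g) (word_parity n w)
      * anti (\<lambda>y. sgn2 (gen_parity n g) (word_parity n w) * (square_gen g * anti h y)) w"
    using anti_cong[OF w key] by simp
  also have "\<dots> = square_gen g * anti (anti h) w"
    by (simp add: anti_scale)
  finally show ?case
    using Cons.IH[OF h w] by (simp add: h_def)
qed

lemma square_gen_nonzero: "prod_list (map square_gen w) \<noteq> 0"
proof (induction w)
  case (Cons g w)
  then show ?case by (cases g) (simp_all add: q_nonzero)
qed simp

lemma resp_unscale:
  assumes "resp n q f"
  shows "resp n q (\<lambda>w. inverse (prod_list (map square_gen w)) * f w)"
  using assms
  by (rule resp_character) (auto simp: power_int_minus q_nonzero)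

end

section \<open>The grading and the antipode of the quantum superalgebra\<close>

lemma ev_keys_cong: "(\<And>w. w \<in> Poly_Mapping.keys a \<Longrightarrow> f w = g w) \<Longrightarrow> ev f a = ev g a"
  by (simp add: ev_def)

lemma upartE:
  assumes "x \<in> upart n q p"
  obtains a where "a \<in> carrier (free_alg n)" "\<And>w. w \<in> Poly_Mapping.keys a \<Longrightarrow> word_parity n w = p"
    "x = cls n q a"
  using assms by (auto simp: upart_def)

lemma upartI:
  "a \<in> carrier (free_alg n) \<Longrightarrow> (\<And>w. w \<in> Poly_Mapping.keys a \<Longrightarrow> word_parity n w = p) \<Longrightarrow>
    cls n q a \<in> upart n q p"
  by (auto simp: upart_def)

lemma upart_mon: "okw n w \<Longrightarrow> cls n q (mon w) \<in> upart n q (word_parity n w)"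
  by (rule upartI[OF mon_closed]) (auto simp: mon_def)

lemma upart_add:
  assumes "x \<in> upart n q p" "y \<in> upart n q p"
  shows "x \<oplus>\<^bsub>Uq n q\<^esub> y \<in> upart n q p"
proof -
  obtain a b where *: "a \<in> carrier (free_alg n)" "\<And>w. w \<in> Poly_Mapping.keys a \<Longrightarrow> word_parity n w = p"
      "b \<in> carrier (free_alg n)" "\<And>w. w \<in> Poly_Mapping.keys b \<Longrightarrow> word_parity n w = p"
      "x = cls n q a" "y = cls n q b"
    using assms by (elim upartE) blast
  then have "cls n q (a + b) \<in> upart n q p"
    using Poly_Mapping.keys_add[of a b] by (intro upartI free_alg_plus_closed) auto
  then show ?thesis using * by (simp add: cls_add)
qed

lemma upart_uscale:
  assumes "x \<in> upart n q p"
  shows "uscale n q c x \<in> upart n q p"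
proof -
  obtain a where *: "a \<in> carrier (free_alg n)" "\<And>w. w \<in> Poly_Mapping.keys a \<Longrightarrow> word_parity n w = p"
      "x = cls n q a"
    using assms by (elim upartE) blast
  then have "cls n q (pm_scale c a) \<in> upart n q p"
    using keys_pm_scale[of c a] by (intro upartI scale_closed) auto
  then show ?thesis using * by (simp add: uscale_cls)
qed

lemma upart_mult:
  assumes "x \<in> upart n q p" "y \<in> upart n q r"
  shows "x \<otimes>\<^bsub>Uq n q\<^esub> y \<in> upart n q (p + r)"
proof -
  obtain a b where *: "a \<in> carrier (free_alg n)" "\<And>w. w \<in> Poly_Mapping.keys a \<Longrightarrow> word_parity n w = p"
      "b \<in> carrier (free_alg n)" "\<And>w. w \<in> Poly_Mapping.keys b \<Longrightarrow> word_parity n w = r"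
      "x = cls n q a" "y = cls n q b"
    using assms by (elim upartE) blast
  have "cls n q (a * b) \<in> upart n q (p + r)"
    using * Poly_Mapping.keys_mult[of a b]
    by (intro upartI free_alg_times_closed) (auto simp: plus_list_def)
  then show ?thesis using * by (simp add: cls_mult)
qed

lemma upart_one: "\<one>\<^bsub>Uq n q\<^esub> \<in> upart n q 0"
  using upart_mon[of n "[]" q] by (simp add: cls_one flip: one_falg)

lemma upart_zero: "\<zero>\<^bsub>Uq n q\<^esub> \<in> upart n q p"
proof -
  have "cls n q 0 = \<zero>\<^bsub>Uq n q\<^esub>"
    using ring_hom_zero[OF cls_ring_hom ring_free_alg ring_Uq] by simp
  then show ?thesis using upartI[OF zero_one_closed(1), of n p q] by simp
qed

lemma upart_generators:
  "i \<in> {1..n} \<Longrightarrow> cls n q (gen (K i)) \<in> upart n q 0"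
  "i \<in> {1..n} \<Longrightarrow> cls n q (gen (Kinv i)) \<in> upart n q 0"
  "i \<in> {1..n} \<Longrightarrow> cls n q (gen (E i)) \<in> upart n q (of_bool (i = n))"
  "i \<in> {1..n} \<Longrightarrow> cls n q (gen (F i)) \<in> upart n q (of_bool (i = n))"
  using upart_mon[of n "[K i]" q] upart_mon[of n "[Kinv i]" q]
    upart_mon[of n "[E i]" q] upart_mon[of n "[F i]" q] by auto

context quantum_osp
begin

lemma ext_twist:
  assumes "resp n q f" "x \<in> upart n q p"
  shows "ext n q (\<lambda>w. sgn2 r (word_parity n w) * f w) x = sgn2 r p * ext n q f x"
proof -
  obtain a where a: "a \<in> carrier (free_alg n)" "\<And>w. w \<in> Poly_Mapping.keys a \<Longrightarrow> word_parity n w = p"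
      "x = cls n q a"
    using assms(2) by (elim upartE) blast
  have "ev (\<lambda>w. sgn2 r (word_parity n w) * f w) a = ev (\<lambda>w. sgn2 r p * f w) a"
    using a(2) by (intro ev_keys_cong) simp
  then show ?thesis
    using a by (simp add: ext_cls resp_twist assms(1) ev_fun_scale)
qed

text \<open>Homogeneity of the ideal without looking at the ideal: with \<open>f\<close> also its
  parity twist is a functional on the quotient, and the two together see the sum and the difference
  of the components.\<close>

lemma upart_sum_unique:
  assumes "x0 \<in> upart n q 0" "y0 \<in> upart n q 0" "x1 \<in> upart n q 1" "y1 \<in> upart n q 1"
    and eq: "x0 \<oplus>\<^bsub>Uq n q\<^esub> x1 = y0 \<oplus>\<^bsub>Uq n q\<^esub> y1"
  shows "x0 = y0 \<and> x1 = y1"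
proof -
  interpret ring "Uq n q" by (rule ring_Uq)
  have carr: "x0 \<in> carrier (Uq n q)" "x1 \<in> carrier (Uq n q)" "y0 \<in> carrier (Uq n q)" "y1 \<in> carrier (Uq n q)"
    using assms upart_carrier by auto
  have "ext n q f x0 = ext n q f y0 \<and> ext n q f x1 = ext n q f y1" if f: "resp n q f" for f
  proof -
    have add: "g (x0 \<oplus>\<^bsub>Uq n q\<^esub> x1) = g x0 + g x1" "g (y0 \<oplus>\<^bsub>Uq n q\<^esub> y1) = g y0 + g y1"
      if "linear_on_Uq n q g" for g
      using that carr unfolding linear_on_Uq_def by blast+
    have 1: "ext n q f x0 + ext n q f x1 = ext n q f y0 + ext n q f y1"
      using add[OF linear_ext[OF f]] eq by simp
    have 2: "ext n q f x0 - ext n q f x1 = ext n q f y0 - ext n q f y1"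
      using add[OF linear_ext[OF resp_twist[OF f, of 1]]] eq ext_twist[OF f assms(1)]
        ext_twist[OF f assms(2)] ext_twist[OF f assms(3)] ext_twist[OF f assms(4)] by simp
    have "2 * ext n q f x0 = 2 * ext n q f y0"
      using arg_cong2[OF 1 2, of "(+)"] by simp
    then show ?thesis using 1 by simp
  qed
  then show ?thesis using Uq_eqI carr by blast
qed

lemma ucomps_unique:
  assumes "x0 \<in> upart n q 0" "x1 \<in> upart n q 1" "x = x0 \<oplus>\<^bsub>Uq n q\<^esub> x1"
  shows "ucomps n q x 0 = x0" "ucomps n q x 1 = x1"
proof -
  interpret ring "Uq n q" by (rule ring_Uq)
  have x: "x \<in> carrier (Uq n q)" using assms upart_carrier by auto
  show "ucomps n q x 0 = x0" "ucomps n q x 1 = x1"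
    using upart_sum_unique[OF ucomps(1)[OF x] assms(1) ucomps(1)[OF x] assms(2)] ucomps(2)[OF x] assms(3)
    by auto
qed

lemma ucomps_homogeneous:
  assumes "x \<in> upart n q p"
  shows "ucomps n q x r = (if r = p then x else \<zero>\<^bsub>Uq n q\<^esub>)"
proof -
  interpret ring "Uq n q" by (rule ring_Uq)
  have x: "x \<in> carrier (Uq n q)" using assms upart_carrier by auto
  show ?thesis
    using ucomps_unique[of x "\<zero>\<^bsub>Uq n q\<^esub>" x] ucomps_unique[of "\<zero>\<^bsub>Uq n q\<^esub>" x x] assms upart_zero x
    by (cases p; cases r) auto
qed

text \<open>Independence of the representative picked by \<open>rep\<close>: with \<open>f\<close>
  also \<open>f o S\<close> respects the relations, so it takes equal values on two
  representatives.\<close>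

lemma antipode_cls:
  assumes "a \<in> carrier (free_alg n)"
  shows "antipode n q (cls n q a) = cls n q (lin_ext (antipode_word n) a)"
proof -
  have r: "rep (cls n q a) \<in> carrier (free_alg n)" "cls n q (rep (cls n q a)) = cls n q a"
    using rep_closed[OF cls_closed[OF assms, of q]] cls_rep[OF cls_closed[OF assms, of q]] .
  have "ev f (rep (cls n q a)) = ev f a" if "resp n q f" for f
    using r assms that cls_eq_iff by blast
  then show ?thesis
    unfolding antipode_def
    using r(1) assms resp_anti
    by (subst cls_eq_iff) (auto simp: lin_ext_closed antipode_word_closed ev_lin_ext simp flip: anti_def)
qed

lemma antipode_closed: "x \<in> carrier (Uq n q) \<Longrightarrow> antipode n q x \<in> carrier (Uq n q)"
  by (auto simp: cls_surj antipode_cls lin_ext_closed antipode_word_closed)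

lemma ext_antipode:
  assumes "resp n q f" "x \<in> carrier (Uq n q)"
  shows "ext n q f (antipode n q x) = ext n q (anti f) x"
proof -
  obtain a where "a \<in> carrier (free_alg n)" "x = cls n q a"
    using assms(2) by (auto simp: cls_surj)
  then show ?thesis
    using assms(1)
    by (simp add: antipode_cls ext_cls resp_anti lin_ext_closed antipode_word_closed ev_lin_ext)
      (simp add: anti_def[abs_def])
qed

lemma antipode_add:
  assumes "x \<in> carrier (Uq n q)" "y \<in> carrier (Uq n q)"
  shows "antipode n q (x \<oplus>\<^bsub>Uq n q\<^esub> y) = antipode n q x \<oplus>\<^bsub>Uq n q\<^esub> antipode n q y"
proof (rule Uq_eqI)
  interpret ring "Uq n q" by (rule ring_Uq)
  show "antipode n q (x \<oplus>\<^bsub>Uq n q\<^esub> y) \<in> carrier (Uq n q)"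
      "antipode n q x \<oplus>\<^bsub>Uq n q\<^esub> antipode n q y \<in> carrier (Uq n q)"
    using assms antipode_closed by auto
  fix f
  assume f: "resp n q f"
  have lin: "ext n q g (x \<oplus>\<^bsub>Uq n q\<^esub> y) = ext n q g x + ext n q g y"
    if "resp n q g" "x \<in> carrier (Uq n q)" "y \<in> carrier (Uq n q)" for g x y
    using linear_ext[OF that(1)] that unfolding linear_on_Uq_def by blast
  show "ext n q f (antipode n q (x \<oplus>\<^bsub>Uq n q\<^esub> y))
      = ext n q f (antipode n q x \<oplus>\<^bsub>Uq n q\<^esub> antipode n q y)"
    using f assms by (simp add: ext_antipode lin resp_anti antipode_closed)
qed

lemma antipode_uscale:
  assumes "x \<in> carrier (Uq n q)"
  shows "antipode n q (uscale n q c x) = uscale n q c (antipode n q x)"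
proof (rule Uq_eqI)
  show "antipode n q (uscale n q c x) \<in> carrier (Uq n q)" "uscale n q c (antipode n q x) \<in> carrier (Uq n q)"
    using assms antipode_closed uscale_closed by auto
  fix f
  assume f: "resp n q f"
  have lin: "ext n q g (uscale n q c x) = c * ext n q g x"
    if "resp n q g" "x \<in> carrier (Uq n q)" for g x
    using linear_ext[OF that(1)] that unfolding linear_on_Uq_def by blast
  show "ext n q f (antipode n q (uscale n q c x)) = ext n q f (uscale n q c (antipode n q x))"
    using f assms by (simp add: ext_antipode lin resp_anti antipode_closed uscale_closed)
qed

lemma antipode_zero: "antipode n q \<zero>\<^bsub>Uq n q\<^esub> = \<zero>\<^bsub>Uq n q\<^esub>"
proof -
  interpret ring "Uq n q" by (rule ring_Uq)
  have "antipode n q \<zero>\<^bsub>Uq n q\<^esub> \<oplus>\<^bsub>Uq n q\<^esub> antipode n q \<zero>\<^bsub>Uq n q\<^esub> = antipode n q \<zero>\<^bsub>Uq n q\<^esub>"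
    using antipode_add[of "\<zero>\<^bsub>Uq n q\<^esub>" "\<zero>\<^bsub>Uq n q\<^esub>"] by simp
  then show ?thesis
    using antipode_closed[of "\<zero>\<^bsub>Uq n q\<^esub>"] by (simp add: add.r_cancel_one)
qed

lemma antipode_word_parity:
  "u \<in> Poly_Mapping.keys (antipode_word n w) \<Longrightarrow> word_parity n u = word_parity n w"
proof (induction w arbitrary: u)
  case Nil
  then show ?case by (simp add: zero_list_def)
next
  case (Cons g w)
  have g: "word_parity n v = gen_parity n g" if "v \<in> Poly_Mapping.keys (antipode_gen g)" for v
    using that by (cases g) (auto simp: mon_mult, auto simp: mon_def)
  have "u \<in> Poly_Mapping.keys (antipode_word n w * antipode_gen g)"
    using Cons.prems keys_pm_scale by fastforce
  then obtain v v' where "u = v @ v'" "v \<in> Poly_Mapping.keys (antipode_word n w)"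
      "v' \<in> Poly_Mapping.keys (antipode_gen g)"
    using Poly_Mapping.keys_mult[of "antipode_word n w" "antipode_gen g"] by (auto simp: plus_list_def)
  then show ?case using Cons.IH g by (simp add: add.commute)
qed

lemma antipode_upart:
  assumes "x \<in> upart n q p"
  shows "antipode n q x \<in> upart n q p"
proof -
  obtain a where a: "a \<in> carrier (free_alg n)" "\<And>w. w \<in> Poly_Mapping.keys a \<Longrightarrow> word_parity n w = p"
      "x = cls n q a"
    using assms by (elim upartE) blast
  have "word_parity n u = p" if u: "u \<in> Poly_Mapping.keys (lin_ext (antipode_word n) a)" for u
  proof -
    have "Poly_Mapping.lookup (lin_ext (antipode_word n) a) u
        = ev (\<lambda>w. Poly_Mapping.lookup (antipode_word n w) u) a"
      by (simp add: lookup_eq_ev ev_lin_ext)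
    then obtain w where "w \<in> Poly_Mapping.keys a" "u \<in> Poly_Mapping.keys (antipode_word n w)"
      using u ev_keys_cong[of a "\<lambda>w. Poly_Mapping.lookup (antipode_word n w) u" "\<lambda>w. 0"]
      by (auto simp: in_keys_iff)
    then show ?thesis using a(2) antipode_word_parity by metis
  qed
  then show ?thesis
    using a(1) by (simp add: a(3) antipode_cls upartI lin_ext_closed antipode_word_closed)
qed

lemma antipode_mult:
  assumes "x \<in> upart n q p" "y \<in> upart n q r"
  shows "antipode n q (x \<otimes>\<^bsub>Uq n q\<^esub> y)
    = uscale n q (sgn2 p r) (antipode n q y \<otimes>\<^bsub>Uq n q\<^esub> antipode n q x)"
proof -
  obtain a b where a: "a \<in> carrier (free_alg n)" "\<And>w. w \<in> Poly_Mapping.keys a \<Longrightarrow> word_parity n w = p"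
      and b: "b \<in> carrier (free_alg n)" "\<And>w. w \<in> Poly_Mapping.keys b \<Longrightarrow> word_parity n w = r"
      and xy: "x = cls n q a" "y = cls n q b"
    using assms by (elim upartE) blast
  let ?S = "lin_ext (antipode_word n)"
  have S: "?S a \<in> carrier (free_alg n)" "?S b \<in> carrier (free_alg n)" "?S (a * b) \<in> carrier (free_alg n)"
    using a(1) b(1) by (auto intro!: lin_ext_closed antipode_word_closed free_alg_times_closed)
  have "ev f (?S (a * b)) = ev f (pm_scale (sgn2 p r) (?S b * ?S a))" for f
  proof -
    have "ev f (?S (a * b)) = ev (\<lambda>u. ev (\<lambda>v. anti f (u @ v)) b) a"
      by (simp add: ev_lin_ext ev_mult flip: anti_def)
    also have "\<dots> = ev (\<lambda>u. ev (\<lambda>v. sgn2 p r * anti (\<lambda>y. anti (\<lambda>z. f (y @ z)) u) v) b) a"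
      using a(2) b(2) by (intro ev_keys_cong) (simp add: anti_append)
    also have "\<dots> = sgn2 p r * ev (\<lambda>v. ev (\<lambda>u. ev (\<lambda>y. ev (\<lambda>z. f (y @ z)) (antipode_word n u))
        (antipode_word n v)) a) b"
      by (simp add: ev_fun_scale anti_def) (rule disjI2, rule ev_swap)
    also have "\<dots> = sgn2 p r * ev (\<lambda>v. ev (\<lambda>y. ev (\<lambda>u. ev (\<lambda>z. f (y @ z)) (antipode_word n u)) a)
        (antipode_word n v)) b"
      by (subst ev_swap[of _ "antipode_word n _"]) simp
    finally show ?thesis by (simp add: ev_mult ev_lin_ext)
  qed
  then have "?S (a * b) = pm_scale (sgn2 p r) (?S b * ?S a)" by (rule pm_eqI_ev)
  then show ?thesis
    using a(1) b(1) S
    by (simp add: xy antipode_cls uscale_cls free_alg_times_closed flip: cls_mult)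
qed

lemma antipode_generators:
  assumes "i \<in> {1..n}"
  shows "antipode n q \<one>\<^bsub>Uq n q\<^esub> = \<one>\<^bsub>Uq n q\<^esub>"
    and "antipode n q (cls n q (gen (K i))) = cls n q (gen (Kinv i))"
    and "antipode n q (cls n q (gen (Kinv i))) = cls n q (gen (K i))"
    and "antipode n q (cls n q (gen (E i)))
      = uscale n q (- 1) (cls n q (gen (E i)) \<otimes>\<^bsub>Uq n q\<^esub> cls n q (gen (Kinv i)))"
    and "antipode n q (cls n q (gen (F i)))
      = uscale n q (- 1) (cls n q (gen (K i)) \<otimes>\<^bsub>Uq n q\<^esub> cls n q (gen (F i)))"
proof -
  have S: "lin_ext (antipode_word n) (mon w) = antipode_word n w" for w
    by (rule pm_eqI_ev) (simp add: ev_lin_ext)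
  have scale1: "pm_scale 1 a = a" for a :: falg
    by (rule pm_eqI_ev) simp
  have minus: "pm_scale (- 1) a = - a" for a :: falg
    by (rule pm_eqI_ev) simp
  have cl: "gen (K i) \<in> carrier (free_alg n)" "gen (Kinv i) \<in> carrier (free_alg n)"
    "gen (E i) \<in> carrier (free_alg n)" "gen (F i) \<in> carrier (free_alg n)"
    using assms by (auto intro!: gen_closed)
  show "antipode n q \<one>\<^bsub>Uq n q\<^esub> = \<one>\<^bsub>Uq n q\<^esub>"
    using antipode_cls[OF mon_closed[of n "[]"]] S[of "[]"]
    by (simp only: cls_one[symmetric] one_falg) (simp add: one_falg)
  show "antipode n q (cls n q (gen (K i))) = cls n q (gen (Kinv i))"
    and "antipode n q (cls n q (gen (Kinv i))) = cls n q (gen (K i))"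
    and "antipode n q (cls n q (gen (E i)))
      = uscale n q (- 1) (cls n q (gen (E i)) \<otimes>\<^bsub>Uq n q\<^esub> cls n q (gen (Kinv i)))"
    and "antipode n q (cls n q (gen (F i)))
      = uscale n q (- 1) (cls n q (gen (K i)) \<otimes>\<^bsub>Uq n q\<^esub> cls n q (gen (F i)))"
    using cl by (simp_all add: antipode_cls S scale1 minus uscale_cls free_alg_times_closed flip: cls_mult)
qed

text \<open>Every \<open>f\<close> has the form \<open>g o S^2\<close> with \<open>g\<close>
  respectful, namely \<open>f\<close> divided by the eigenvalues of \<open>S^2\<close>. Hence
  \<open>f x\<close> depends only on \<open>S x\<close>.\<close>

lemma antipode_inj: "inj_on (antipode n q) (carrier (Uq n q))"
proof (rule inj_onI)
  fix x y
  assume xy: "x \<in> carrier (Uq n q)" "y \<in> carrier (Uq n q)" "antipode n q x = antipode n q y"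
  show "x = y"
  proof (rule Uq_eqI[OF xy(1,2)])
    fix f
    assume f: "resp n q f"
    let ?g = "\<lambda>w. inverse (prod_list (map square_gen w)) * f w"
    have g: "resp n q ?g" by (rule resp_unscale[OF f])
    have "ext n q (anti (anti ?g)) x = ext n q (anti (anti ?g)) y"
      using ext_antipode[OF resp_anti[OF g] xy(1)] ext_antipode[OF resp_anti[OF g] xy(2)] xy(3) by simp
    moreover have "ext n q (anti (anti ?g)) z = ext n q f z" if z: "z \<in> carrier (Uq n q)" for z
    proof -
      obtain a where a: "a \<in> carrier (free_alg n)" "z = cls n q a"
        using z by (auto simp: cls_surj)
      have "ev (anti (anti ?g)) a = ev f a"
        using anti_anti[OF g] square_gen_nonzero by (intro ev_cong[OF a(1)]) simp
      then show ?thesis using a by (simp add: ext_cls resp_anti g f)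
    qed
    ultimately show "ext n q f x = ext n q f y" using xy by simp
  qed
qed

lemma antipode_surj: "antipode n q ` carrier (Uq n q) = carrier (Uq n q)"
proof
  show "antipode n q ` carrier (Uq n q) \<subseteq> carrier (Uq n q)" using antipode_closed by auto
  have "cls n q a \<in> antipode n q ` carrier (Uq n q)" if "a \<in> carrier (free_alg n)" for a
    using that
  proof (induction rule: free_alg_span_induct)
    case (mon w)
    \<comment> \<open>\<open>S^2\<close> multiplies \<open>w\<close> by a nonzero scalar; dividing
      by it and applying \<open>S\<close> once gives a preimage.\<close>
    let ?x = "antipode n q (cls n q (pm_scale (inverse (prod_list (map square_gen w))) (mon w)))"
    have cl: "cls n q (pm_scale c (mon w)) \<in> carrier (Uq n q)" for c
      using mon by (intro cls_closed scale_closed mon_closed)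
    have "antipode n q ?x = cls n q (mon w)"
    proof (rule Uq_eqI)
      show "antipode n q ?x \<in> carrier (Uq n q)" using cl antipode_closed by simp
      show "cls n q (mon w) \<in> carrier (Uq n q)" using mon by (intro cls_closed mon_closed)
      fix f
      assume f: "resp n q f"
      then show "ext n q f (antipode n q ?x) = ext n q f (cls n q (mon w))"
        using mon cl square_gen_nonzero[of w]
        by (simp add: ext_antipode resp_anti antipode_closed ext_cls scale_closed mon_closed anti_anti)
    qed
    then show ?case using cl antipode_closed by (metis imageI)
  next
    case (scale a c)
    then obtain y where "y \<in> carrier (Uq n q)" "cls n q a = antipode n q y" by auto
    then have "cls n q (pm_scale c a) = antipode n q (uscale n q c y)"
      using scale by (simp add: antipode_uscale flip: uscale_cls)
    then show ?case using \<open>y \<in> carrier (Uq n q)\<close> uscale_closed by blast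
  next
    case (add a b)
    interpret ring "Uq n q" by (rule ring_Uq)
    obtain x y where "x \<in> carrier (Uq n q)" "y \<in> carrier (Uq n q)"
        "cls n q a = antipode n q x" "cls n q b = antipode n q y"
      using add by auto
    then have "cls n q (a + b) = antipode n q (x \<oplus>\<^bsub>Uq n q\<^esub> y)"
      using add by (simp add: cls_add antipode_add)
    then show ?case using \<open>x \<in> carrier (Uq n q)\<close> \<open>y \<in> carrier (Uq n q)\<close> by auto
  qed
  then show "carrier (Uq n q) \<subseteq> antipode n q ` carrier (Uq n q)" by (auto simp: cls_surj)
qed

lemma antipode_inv:
  assumes "x \<in> carrier (Uq n q)"
  shows "antipode_inv n q x \<in> carrier (Uq n q)" "antipode n q (antipode_inv n q x) = x"
    "antipode_inv n q (antipode n q x) = x"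
  using assms antipode_surj antipode_inj
  by (auto simp: antipode_inv_def inv_into_into f_inv_into_f inv_into_f_f)

text \<open>\<open>S\<close> preserves parities and is injective, so the component of
  \<open>S^{-1}(x)\<close> of the wrong parity is mapped to 0 and vanishes.\<close>

lemma antipode_inv_upart:
  assumes "x \<in> upart n q p"
  shows "antipode_inv n q x \<in> upart n q p"
proof -
  let ?y = "antipode_inv n q x"
  have x: "x \<in> carrier (Uq n q)" using assms upart_carrier by blast
  note y = antipode_inv[OF x]
  interpret ring "Uq n q" by (rule ring_Uq)
  define y0 where "y0 = ucomps n q ?y 0"
  define y1 where "y1 = ucomps n q ?y 1"
  have u: "y0 \<in> upart n q 0" "y1 \<in> upart n q 1" "?y = y0 \<oplus>\<^bsub>Uq n q\<^esub> y1"
    using ucomps[OF y(1)] by (simp_all add: y0_def y1_def)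
  have c: "y0 \<in> carrier (Uq n q)" "y1 \<in> carrier (Uq n q)" using u upart_carrier by auto
  have xx: "x = antipode n q y0 \<oplus>\<^bsub>Uq n q\<^esub> antipode n q y1"
    using y(2) u(3) c by (simp add: antipode_add)
  note uc = ucomps_unique[OF antipode_upart[OF u(1)] antipode_upart[OF u(2)] xx]
  have z: "z = \<zero>\<^bsub>Uq n q\<^esub>" if "antipode n q z = \<zero>\<^bsub>Uq n q\<^esub>" "z \<in> carrier (Uq n q)" for z
    using that antipode_zero inj_onD[OF antipode_inj, of z "\<zero>\<^bsub>Uq n q\<^esub>"] by simp
  show ?thesis
  proof (cases p)
    case zero
    then have "y1 = \<zero>\<^bsub>Uq n q\<^esub>"
      using uc(2) ucomps_homogeneous[OF assms, of 1] c z by simp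
    then show ?thesis using u c zero by simp
  next
    case one
    then have "y0 = \<zero>\<^bsub>Uq n q\<^esub>"
      using uc(1) ucomps_homogeneous[OF assms, of 0] c z by simp
    then show ?thesis using u c one by simp
  qed
qed

end

section \<open>The coproduct\<close>

lemma ev_tmult:
  "ev f (tmult n s t) =
    ev (\<lambda>(a, b). ev (\<lambda>(c, d). sgn2 (word_parity n b) (word_parity n c) * f (a @ c, b @ d)) t) s"
  by (simp add: tmult_def case_prod_unfold) (simp add: ev_def sum_distrib_left mult_ac)

lemma keys_tmult:
  assumes "x \<in> Poly_Mapping.keys (tmult n s t)"
  shows "\<exists>a b c d. (a, b) \<in> Poly_Mapping.keys s \<and> (c, d) \<in> Poly_Mapping.keys t \<and> x = (a @ c, b @ d)"
proof (rule ccontr)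
  assume "\<not> ?thesis"
  then have no: "x \<noteq> (a @ c, b @ d)" if "(a, b) \<in> Poly_Mapping.keys s" "(c, d) \<in> Poly_Mapping.keys t" for a b c d
    using that by blast
  have "ev (\<lambda>(c, d). sgn2 (word_parity n b) (word_parity n c) * of_bool ((a @ c, b @ d) = x)) t = 0"
    if "(a, b) \<in> Poly_Mapping.keys s" for a b
    by (subst ev_keys_cong[of t _ "\<lambda>y. 0"]) (clarsimp simp: no[OF that, symmetric], simp)
  then have "ev (\<lambda>y. of_bool (y = x)) (tmult n s t) = 0"
    unfolding ev_tmult by (subst ev_keys_cong[of s _ "\<lambda>y. 0"]) auto
  then show False
    using assms by (simp add: in_keys_iff lookup_eq_ev)
qed

context quantum_osp
begin

text \<open>The transpose of the coproduct: a function \<open>B\<close> of two words, extended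
  linearly to pairs, is evaluated at the coproduct of \<open>w\<close>. The tensor square of
  \<open>Uq\<close> itself is not formed.\<close>

definition coprod :: "(gen list \<Rightarrow> gen list \<Rightarrow> complex) \<Rightarrow> gen list \<Rightarrow> complex" where
  "coprod B w = ev (\<lambda>(u, v). B u v) (coproduct_word n w)"

lemma coprod_simps:
  "coprod B [] = B [] []"
  "coprod B (K i # w) = coprod (\<lambda>c d. B (K i # c) (K i # d)) w"
  "coprod B (Kinv i # w) = coprod (\<lambda>c d. B (Kinv i # c) (Kinv i # d)) w"
  "coprod B (E i # w) = coprod (\<lambda>c d. B (E i # c) (K i # d)
     + sgn2 (of_bool (i = n)) (word_parity n c) * B c (E i # d)) w"
  "coprod B (F i # w) = coprod (\<lambda>c d. B (F i # c) d
     + sgn2 (of_bool (i = n)) (word_parity n c) * B (Kinv i # c) (F i # d)) w"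
  by (simp_all add: coprod_def ev_tmult case_prod_unfold flip: ev_fun_add)

lemma coprod_add: "coprod (\<lambda>a b. B a b + C a b) w = coprod B w + coprod C w"
  by (simp add: coprod_def case_prod_unfold ev_fun_add)

lemma coprod_scale: "coprod (\<lambda>a b. c * B a b) w = c * coprod B w"
  by (simp add: coprod_def case_prod_unfold ev_fun_scale)

text \<open>Multiplicativity of the coproduct; the sign comes from exchanging the second factor of
  \<open>\<Delta>(u)\<close> with the first factor of \<open>\<Delta>(v)\<close>.\<close>

lemma coprod_append:
  "coprod B (u @ v) = coprod (\<lambda>a b. coprod (\<lambda>c d.
     sgn2 (word_parity n b) (word_parity n c) * B (a @ c) (b @ d)) v) u"
proof (induction u arbitrary: B)
  case Nil
  then show ?case by (simp add: coprod_simps)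
next
  case (Cons g u)
  show ?case
    by (cases g)
      (simp_all add: Cons.IH coprod_simps sgn2_add_left sgn2_add_right distrib_left mult_ac
        flip: coprod_add coprod_scale)
qed

lemma coproduct_gen_keys:
  assumes "gen_index g \<in> {1..n}" "(u, v) \<in> Poly_Mapping.keys (coproduct_gen g)"
  shows "okw n u \<and> okw n v \<and> word_parity n u + word_parity n v = gen_parity n g"
proof -
  have keys: "(u, v) \<in> Poly_Mapping.keys a \<or> (u, v) \<in> Poly_Mapping.keys b"
    if "(u, v) \<in> Poly_Mapping.keys (a + b)" for a b :: falg2
    using that Poly_Mapping.keys_add[of a b] by blast
  show ?thesis
    using assms by (cases g) (auto dest!: keys)
qed

lemma coproduct_word_keys:
  assumes "okw n w" "(u, v) \<in> Poly_Mapping.keys (coproduct_word n w)"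
  shows "okw n u" "okw n v" "word_parity n u + word_parity n v = word_parity n w"
proof -
  have "okw n u \<and> okw n v \<and> word_parity n u + word_parity n v = word_parity n w"
    using assms
  proof (induction w arbitrary: u v)
    case (Cons g w)
    obtain a b c d where *: "(a, b) \<in> Poly_Mapping.keys (coproduct_gen g)"
        "(c, d) \<in> Poly_Mapping.keys (coproduct_word n w)" "(u, v) = (a @ c, b @ d)"
      using keys_tmult[OF Cons.prems(2)[unfolded coproduct_word.simps]] by (elim exE conjE)
    have 1: "okw n a \<and> okw n b" "word_parity n a + word_parity n b = gen_parity n g"
      using coproduct_gen_keys[OF _ *(1)] Cons.prems(1) by auto
    have 2: "okw n c \<and> okw n d" "word_parity n c + word_parity n d = word_parity n w"
      using Cons.IH[OF _ *(2)] Cons.prems(1) by auto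
    have "word_parity n u + word_parity n v
        = (word_parity n a + word_parity n b) + (word_parity n c + word_parity n d)"
      using *(3) by (simp only: prod.inject word_parity_append add_ac)
    then show ?case using 1 2 *(3) by simp
  qed auto
  then show "okw n u" "okw n v" "word_parity n u + word_parity n v = word_parity n w" by auto
qed

lemma coprod_cong:
  assumes "okw n w"
    and "\<And>a b. okw n a \<Longrightarrow> okw n b \<Longrightarrow> word_parity n a + word_parity n b = word_parity n w \<Longrightarrow> B a b = C a b"
  shows "coprod B w = coprod C w"
  unfolding coprod_def
proof (rule ev_keys_cong)
  fix x
  assume "x \<in> Poly_Mapping.keys (coproduct_word n w)"
  then show "(case x of (u, v) \<Rightarrow> B u v) = (case x of (u, v) \<Rightarrow> C u v)"
    using assms(2) coproduct_word_keys[OF assms(1)] by (cases x) simp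
qed

text \<open>These are the functions that descend to bilinear forms on \<open>Uq\<close>.\<close>

definition biresp :: "(gen list \<Rightarrow> gen list \<Rightarrow> complex) \<Rightarrow> bool" where
  "biresp B \<longleftrightarrow> (\<forall>a. okw n a \<longrightarrow> resp n q (B a)) \<and> (\<forall>b. okw n b \<longrightarrow> resp n q (\<lambda>a. B a b))"

lemma biresp_context:
  assumes B: "biresp B" and ok: "okw n a" "okw n b" "okw n v"
  shows "biresp (\<lambda>c d. coprod (\<lambda>e f. sgn2 (word_parity n d) (word_parity n e)
    * (sgn2 (word_parity n b) (word_parity n (c @ e)) * B (a @ c @ e) (b @ d @ f))) v)"
  (is "biresp ?C")
proof -
  let ?p = "word_parity n"
  have keys: "okw n (fst p) \<and> okw n (snd p)" if "p \<in> Poly_Mapping.keys (coproduct_word n v)" for p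
    using coproduct_word_keys(1,2)[OF ok(3), of "fst p" "snd p"] that by simp
  have 1: "?C c = (\<lambda>d. ev (\<lambda>p. sgn2 (?p b) (?p (c @ fst p))
      * (sgn2 (?p (fst p)) (?p d) * B (a @ c @ fst p) (b @ d @ snd p))) (coproduct_word n v))" for c
    by (simp add: fun_eq_iff coprod_def case_prod_unfold sgn2_commute[of _ "?p (fst _)"] mult.left_commute
      del: word_parity_append)
  have 2: "(\<lambda>c. ?C c d) = (\<lambda>c. ev (\<lambda>p. (sgn2 (?p d) (?p (fst p)) * sgn2 (?p b) (?p (fst p)))
      * (sgn2 (?p b) (?p c) * B (a @ c @ fst p) (b @ d @ snd p))) (coproduct_word n v))" for d
    by (simp add: fun_eq_iff coprod_def case_prod_unfold sgn2_add_right mult_ac)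
  have "resp n q (?C c)" if "okw n c" for c
    unfolding 1 using that keys ok B
    by (intro resp_ev resp_scale resp_twist resp_context) (auto simp: biresp_def)
  moreover have "resp n q (\<lambda>c. ?C c d)" if "okw n d" for d
    unfolding 2 using that keys ok B
    by (intro resp_ev resp_scale resp_twist resp_context[where f = "\<lambda>a. B a _"]) (auto simp: biresp_def)
  ultimately show ?thesis by (simp add: biresp_def)
qed

text \<open>As for the antipode, contexts are absorbed into the functional: the coproducts of
  \<open>u\<close> and \<open>v\<close> only change \<open>B\<close> into a finite combination of
  functions that again satisfy \<open>biresp\<close>.\<close>

lemma resp_coprodI:
  assumes "\<And>C. biresp C \<Longrightarrow> relations n q (coprod C)" and B: "biresp B"
  shows "resp n q (coprod B)"
  unfolding resp_iff
proof (intro allI impI)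
  fix u v
  assume uv: "okw n u" "okw n v"
  define C where "C a b = (\<lambda>c d. coprod (\<lambda>e f. sgn2 (word_parity n d) (word_parity n e)
    * (sgn2 (word_parity n b) (word_parity n (c @ e)) * B (a @ c @ e) (b @ d @ f))) v)" for a b
  have "coprod B (u @ w @ v) = ev (\<lambda>p. coprod (C (fst p) (snd p)) w) (coproduct_word n u)" for w
    unfolding coprod_append[of B u "w @ v"] coprod_append[of _ w v] C_def
    by (simp add: coprod_def[of _ u] case_prod_unfold)
  moreover have "relations n q (\<lambda>w. ev (\<lambda>p. coprod (C (fst p) (snd p)) w) (coproduct_word n u))"
    using uv coproduct_word_keys(1,2)[OF uv(1)]
    by (intro relations_ev assms(1)) (auto simp: C_def simp del: word_parity_append intro!: biresp_context[OF B])
  ultimately show "relations n q (\<lambda>w. coprod B (u @ w @ v))" by simp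
qed

text \<open>After normal ordering in each tensor factor, only the terms with all root vectors in one
  factor call for a relation between root vectors; the mixed terms cancel by themselves.\<close>

lemma relations_coprod:
  assumes "biresp B"
  shows "relations n q (coprod B)"
  unfolding relations_def
proof (intro conjI ballI impI)
  have B1: "resp n q (\<lambda>a. B a b)" if "okw n b" for b
    using assms that by (simp add: biresp_def)
  have B2: "resp n q (B a)" if "okw n a" for a
    using assms that by (simp add: biresp_def)
  note ks = k_simps[OF resp_k_closed[OF B1]] k_simps[OF resp_k_closed[OF B2]]
  note ko = k_order[OF resp_k_closed[OF B1]] k_order[OF resp_k_closed[OF B2]]
  show "k_relations n q (coprod B)"
    by (simp add: k_relations_def coprod_simps ks ko power_int_minus q_nonzero distrib_left)
  fix i j
  assume ij: "i \<in> {1..n}" "j \<in> {1..n}"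
  have ef1: "ef_relation n q i j (\<lambda>a. B (a @ v) b)" if "okw n b" "okw n v" for v b
    using resp_relations[OF B1, of b "[]" v] that ij by (simp add: relations_def)
  have ef2: "ef_relation n q i j (\<lambda>b. B a (b @ v))" if "okw n a" "okw n v" for a v
    using resp_relations[OF B2, of a "[]" v] that ij by (simp add: relations_def)
  show "ef_relation n q i j (coprod B)"
  proof -
    obtain d where d: "inverse (q - inverse q) = d" by blast
    have [simp]: "inverse (q ^ m) * (q ^ m * x) = x" "q ^ m * (inverse (q ^ m) * x) = x"
        "inverse q * (q * x) = x" "q * (inverse q * x) = x" for m x
      by (simp_all add: q_nonzero)
    have "B [E i, F j] [K i] = sgn2 (of_bool (i = n)) (of_bool (j = n)) * B [F j, E i] [K i]
        + (if i = j then (B [K i] [K i] - B [Kinv i] [K i]) * d else 0)"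
      "B [Kinv j] [E i, F j] = sgn2 (of_bool (i = n)) (of_bool (j = n)) * B [Kinv j] [F j, E i]
        + (if i = j then (B [Kinv j] [K i] - B [Kinv j] [Kinv i]) * d else 0)"
      using ij ef1[of "[K i]" "[]"] ef2[of "[Kinv j]" "[]"]
      by (simp_all add: ef_relation_def divide_inverse d diff_eq_eq add.commute)
    then show ?thesis
      using ij unfolding ef_relation_def divide_inverse d
      by (cases "i = j"; cases "i = n"; cases "j = n")
        (simp_all add: coprod_simps ks power_int_minus ip_simple_root, simp_all add: algebra_simps)
  qed
  \<comment> \<open>With \<open>inverse q\<close> opaque and \<open>q * r = 1\<close> as the rule
    about it, the cancellation of the mixed terms is a polynomial identity.\<close>
  obtain r where r: "inverse q = r" by blast
  have "q * r = 1" using q_nonzero r by auto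
  then have qr: "q * r = 1" "q * (r * x) = x" for x by (simp_all flip: mult.assoc)
  assume "i \<noteq> j"
  have se1: "serre n q E i j (\<lambda>a. B (a @ v) b)" "serre n q F i j (\<lambda>a. B (a @ v) b)" if "okw n b" "okw n v" for v b
    using resp_relations[OF B1, of b "[]" v] that ij \<open>i \<noteq> j\<close> by (simp_all add: relations_def)
  have se2: "serre n q E i j (\<lambda>b. B a (b @ v))" "serre n q F i j (\<lambda>b. B a (b @ v))" if "okw n a" "okw n v" for a v
    using resp_relations[OF B2, of a "[]" v] that ij \<open>i \<noteq> j\<close> by (simp_all add: relations_def)
  consider "j \<noteq> i + 1" "i \<noteq> j + 1" | "j = i + 1 \<or> i = j + 1" "i < n" | "i = n" "Suc j = n"
    using ij \<open>i \<noteq> j\<close> by fastforce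
  then have "serre n q E i j (coprod B) \<and> serre n q F i j (coprod B)"
  proof cases
    case 1
    have ip: "ip n (simple_root n i) (simple_root n j) = 0" "ip n (simple_root n j) (simple_root n i) = 0"
      using ij 1 \<open>i \<noteq> j\<close> by (auto simp: ip_simple_root)
    have "B [E i, E j] [K i, K j] = B [E j, E i] [K i, K j]" "B [] [E i, E j] = B [] [E j, E i]"
      "B [F i, F j] [] = B [F j, F i] []" "B [Kinv i, Kinv j] [F i, F j] = B [Kinv i, Kinv j] [F j, F i]"
      using 1 se1(1)[of "[K i, K j]" "[]"] se1(2)[of "[]" "[]"] se2(1)[of "[]" "[]"]
        se2(2)[of "[Kinv i, Kinv j]" "[]"] ij by (auto simp: serre_def)
    moreover have "sgn2 (of_bool (i = n)) (of_bool (j = n)) = 1" "sgn2 (of_bool (j = n)) (of_bool (i = n)) = 1"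
      using \<open>i \<noteq> j\<close> by auto
    ultimately show ?thesis
      using ij 1 by (simp add: serre_def coprod_simps ks ko[of _ j i] ip)
  next
    case 2
    have ip: "ip n (simple_root n i) (simple_root n i) = 2" "ip n (simple_root n i) (simple_root n j) = - 1"
        "ip n (simple_root n j) (simple_root n i) = - 1"
      using ij 2 by (auto simp: ip_simple_root)
    have "B [E i, E i, E j] [K i, K i, K j] = (q + inverse q) * B [E i, E j, E i] [K i, K i, K j]
        - B [E j, E i, E i] [K i, K i, K j]"
      "B [] [E i, E i, E j] = (q + inverse q) * B [] [E i, E j, E i] - B [] [E j, E i, E i]"
      "B [F i, F i, F j] [] = (q + inverse q) * B [F i, F j, F i] [] - B [F j, F i, F i] []"
      "B [Kinv i, Kinv i, Kinv j] [F i, F i, F j] = (q + inverse q) * B [Kinv i, Kinv i, Kinv j] [F i, F j, F i]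
        - B [Kinv i, Kinv i, Kinv j] [F j, F i, F i]"
      using 2 se1(1)[of "[K i, K i, K j]" "[]"] se1(2)[of "[]" "[]"] se2(1)[of "[]" "[]"]
        se2(2)[of "[Kinv i, Kinv i, Kinv j]" "[]"] ij
      by (auto simp: serre_def eq_diff_eq)
    note S = this
    have "coprod B [E i, E i, E j] + coprod B [E j, E i, E i] = (q + inverse q) * coprod B [E i, E j, E i]"
      by (simp add: coprod_simps ks ko[of _ j i] ip power_int_minus ij ij[simplified] 2(2) less_imp_neq[OF 2(2)] S(1,2) r)
        (simp add: algebra_simps power2_eq_square qr)
    moreover have "coprod B [F i, F i, F j] + coprod B [F j, F i, F i] = (q + inverse q) * coprod B [F i, F j, F i]"
      by (simp add: coprod_simps ks ko[of _ j i] ip power_int_minus ij ij[simplified] 2(2) less_imp_neq[OF 2(2)] S(3,4) r)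
        (simp add: algebra_simps power2_eq_square qr)
    ultimately show ?thesis
      using 2 by (simp add: serre_def)
  next
    case 3
    have ip: "ip n (simple_root n n) (simple_root n n) = 1" "ip n (simple_root n n) (simple_root n j) = - 1"
        "ip n (simple_root n j) (simple_root n n) = - 1"
      using ij 3 by (auto simp: ip_simple_root)
    have "B [E i, E i, E i, E j] [K i, K i, K i, K j] = (q + inverse q - 1) *
        (B [E i, E i, E j, E i] [K i, K i, K i, K j] + B [E i, E j, E i, E i] [K i, K i, K i, K j])
        - B [E j, E i, E i, E i] [K i, K i, K i, K j]"
      "B [] [E i, E i, E i, E j] = (q + inverse q - 1) *
        (B [] [E i, E i, E j, E i] + B [] [E i, E j, E i, E i]) - B [] [E j, E i, E i, E i]"
      "B [F i, F i, F i, F j] [] = (q + inverse q - 1) *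
        (B [F i, F i, F j, F i] [] + B [F i, F j, F i, F i] []) - B [F j, F i, F i, F i] []"
      "B [Kinv i, Kinv i, Kinv i, Kinv j] [F i, F i, F i, F j] = (q + inverse q - 1) *
        (B [Kinv i, Kinv i, Kinv i, Kinv j] [F i, F i, F j, F i] + B [Kinv i, Kinv i, Kinv i, Kinv j] [F i, F j, F i, F i])
        - B [Kinv i, Kinv i, Kinv i, Kinv j] [F j, F i, F i, F i]"
      using 3 se1(1)[of "[K i, K i, K i, K j]" "[]"] se1(2)[of "[]" "[]"] se2(1)[of "[]" "[]"]
        se2(2)[of "[Kinv i, Kinv i, Kinv i, Kinv j]" "[]"] ij
      by (auto simp: serre_def eq_diff_eq)
    note S = this
    have [simp]: "Suc 0 \<le> n" "Suc 0 \<le> j" "j \<le> n" "j \<noteq> n" "n \<noteq> j"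
      using ij 3 by auto
    have "coprod B [E n, E n, E n, E j] + coprod B [E j, E n, E n, E n]
        = (q + inverse q - 1) * (coprod B [E n, E n, E j, E n] + coprod B [E n, E j, E n, E n])"
      using S(1,2)[unfolded 3(1)]
      by (simp add: coprod_simps ks ko[of _ j n] ip power_int_minus r)
        (simp add: algebra_simps power2_eq_square qr)
    moreover have "coprod B [F n, F n, F n, F j] + coprod B [F j, F n, F n, F n]
        = (q + inverse q - 1) * (coprod B [F n, F n, F j, F n] + coprod B [F n, F j, F n, F n])"
      using S(3,4)[unfolded 3(1)]
      by (simp add: coprod_simps ks ko[of _ j n] ip power_int_minus r)
        (simp add: algebra_simps power2_eq_square qr)
    ultimately show ?thesis
      using 3 by (simp add: serre_def)
  qed
  then show "serre n q E i j (coprod B)" "serre n q F i j (coprod B)" by auto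
qed

lemma resp_coprod: "biresp B \<Longrightarrow> resp n q (coprod B)"
  by (rule resp_coprodI[OF relations_coprod])

end

section \<open>Compatibility of the antipode with the coproduct\<close>

context quantum_osp
begin

text \<open>The functional \<open>B \<circ> (S \<otimes> S) \<circ> \<tau>\<close> with the signed flip \<open>\<tau>\<close>.\<close>

definition anti_flip :: "(gen list \<Rightarrow> gen list \<Rightarrow> complex) \<Rightarrow> gen list \<Rightarrow> gen list \<Rightarrow> complex" where
  "anti_flip B a b = sgn2 (word_parity n a) (word_parity n b) * anti (\<lambda>u. anti (\<lambda>v. B u v) a) b"

lemma anti_add: "anti (\<lambda>w. f w + g w) w = anti f w + anti g w"
  by (simp add: anti_def ev_fun_add)

lemma anti_uminus: "anti (\<lambda>w. - f w) w = - anti f w"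
  by (simp add: anti_def ev_fun_uminus)

lemma anti_flip_cong:
  assumes "okw n c" "okw n d"
    and "\<And>a b. okw n a \<Longrightarrow> okw n b \<Longrightarrow> word_parity n b = word_parity n c \<Longrightarrow> B a b = C a b"
  shows "anti_flip B c d = anti_flip C c d"
  unfolding anti_flip_def using assms
  by (intro arg_cong2[where f = "(*)"] refl anti_cong) auto

lemma biresp_right:
  assumes B: "biresp B" and ok: "okw n z"
  shows "biresp (\<lambda>a b. coprod (\<lambda>c d. sgn2 (word_parity n b) (word_parity n c) * B (a @ c) (b @ d)) z)"
  using biresp_context[OF B okw_Nil okw_Nil ok] by simp

lemma biresp_ev:
  assumes "\<And>x. x \<in> Poly_Mapping.keys z \<Longrightarrow> biresp (B x)"
  shows "biresp (\<lambda>a b. ev (\<lambda>x. B x a b) z)"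
  using assms unfolding biresp_def by (auto intro!: resp_ev)

text \<open>The antipode reverses the coproduct:
  \<open>\<Delta> o S = (S \<otimes> S) o \<tau> o \<Delta>\<close>. This holds only after
  cancelling \<open>K i\<close> with \<open>Kinv i\<close>, which is why \<open>B\<close> has to
  respect the relations. It is the source of the product rule for \<open>f o S\<close> in
  \<open>Tq\<close>.\<close>

lemma anti_coprod:
  assumes "biresp B" "okw n w"
  shows "anti (coprod B) w = coprod (anti_flip B) w"
  using assms
proof (induction w arbitrary: B)
  case Nil
  then show ?case by (simp add: anti_simps coprod_simps anti_flip_def)
next
  case (Cons g w)
  let ?p = "word_parity n"
  have g: "gen_index g \<in> {1..n}" and w: "okw n w" using Cons.prems by auto
  \<comment> \<open>\<open>B'\<close> absorbs the coproduct of \<open>S(g)\<close> on the right, so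
    that the induction hypothesis applies to the shorter word.\<close>
  define B' where "B' a b = ev (\<lambda>z. coprod (\<lambda>c d. sgn2 (?p b) (?p c) * B (a @ c) (b @ d)) z)
    (antipode_gen g)" for a b
  have "biresp B'"
    unfolding B'_def using antipode_gen_closed[OF g] Cons.prems(1)
    by (intro biresp_ev biresp_right) (auto simp: carrier_free_alg)
  have "(\<lambda>u. ev (\<lambda>z. coprod B (u @ z)) (antipode_gen g)) = coprod B'"
    unfolding coprod_append[of B] B'_def
    by (rule HOL.ext, unfold coprod_def case_prod_unfold, rule ev_swap)
  then have "anti (coprod B) (g # w) = sgn2 (gen_parity n g) (?p w) * anti (coprod B') w"
    by (simp add: anti_def[of _ "g # w"] ev_mult) (simp add: anti_def)
  also have "\<dots> = coprod (\<lambda>c d. sgn2 (gen_parity n g) (?p w) * anti_flip B' c d) w"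
    using Cons.IH[OF \<open>biresp B'\<close> w] by (simp add: coprod_scale)
  also have "\<dots> = coprod (anti_flip B) (g # w)"
  proof -
    have k1: "k_closed (\<lambda>a. B a b)" if "okw n b" for b
      using Cons.prems(1) that resp_k_closed by (simp add: biresp_def)
    have k2: "k_closed (B a)" if "okw n a" for a
      using Cons.prems(1) that resp_k_closed by (simp add: biresp_def)
    show ?thesis
    proof (cases g)
      case (K i)
      have "B' = (\<lambda>a b. B (a @ [Kinv i]) (b @ [Kinv i]))"
        by (simp add: B'_def K coprod_simps fun_eq_iff)
      then show ?thesis using K by (simp add: coprod_simps anti_flip_def[abs_def] anti_simps)
    next
      case (Kinv i)
      have "B' = (\<lambda>a b. B (a @ [K i]) (b @ [K i]))"
        by (simp add: B'_def Kinv coprod_simps fun_eq_iff)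
      then show ?thesis using Kinv by (simp add: coprod_simps anti_flip_def[abs_def] anti_simps)
    next
      case (E i)
      have i: "i \<in> {1..n}" using g E by simp
      let ?e = "of_bool (i = n)"
      have B': "B' a b = - (sgn2 (?p b) ?e * B (a @ [E i, Kinv i]) (b @ [K i, Kinv i])
          + B (a @ [Kinv i]) (b @ [E i, Kinv i]))" for a b
        by (simp add: B'_def E coprod_simps mon_mult)
      have "sgn2 ?e (?p w) * anti_flip B' c d = anti_flip B (E i # c) (K i # d)
          + sgn2 ?e (?p c) * anti_flip B c (E i # d)"
        if cd: "okw n c" "okw n d" "?p c + ?p d = ?p w" for c d
      proof -
        \<comment> \<open>The second argument of \<open>B'\<close> runs over words with the parity
          of \<open>c\<close>, which makes the sign constant; the pair \<open>K i\<close>,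
          \<open>Kinv i\<close> cancels in that argument.\<close>
        have *: "anti_flip B' c d = anti_flip (\<lambda>a b. - (sgn2 (?p c) ?e * B (a @ [E i, Kinv i]) b
            + B (a @ [Kinv i]) (b @ [E i, Kinv i]))) c d"
          using cd i k_cancel(1)[OF k2, of _ i _ "[]"] by (intro anti_flip_cong) (auto simp: B')
        show ?thesis
          unfolding * cd(3)[symmetric]
          unfolding anti_flip_def anti_uminus anti_add anti_scale
          by (simp add: anti_simps anti_uminus anti_scale sgn2_add_left sgn2_add_right
            sgn2_commute[of _ ?e] algebra_simps)
      qed
      then show ?thesis
        unfolding E coprod_simps gen_parity.simps by (intro coprod_cong[OF w])
    next
      case (F i)
      have i: "i \<in> {1..n}" using g F by simp
      let ?e = "of_bool (i = n)"
      have B': "B' a b = - (sgn2 (?p b) ?e * B (a @ [K i, F i]) (b @ [K i])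
          + B (a @ [K i, Kinv i]) (b @ [K i, F i]))" for a b
        by (simp add: B'_def F coprod_simps mon_mult)
      have "sgn2 ?e (?p w) * anti_flip B' c d = anti_flip B (F i # c) d
          + sgn2 ?e (?p c) * anti_flip B (Kinv i # c) (F i # d)"
        if cd: "okw n c" "okw n d" "?p c + ?p d = ?p w" for c d
      proof -
        have *: "anti_flip B' c d = anti_flip (\<lambda>a b. - (sgn2 (?p c) ?e * B (a @ [K i, F i]) (b @ [K i])
            + B a (b @ [K i, F i]))) c d"
          using cd i k_cancel(1)[OF k1, of _ i _ "[]"] by (intro anti_flip_cong) (auto simp: B')
        show ?thesis
          unfolding * cd(3)[symmetric]
          unfolding anti_flip_def anti_uminus anti_add anti_scale
          by (simp add: anti_simps anti_uminus anti_scale sgn2_add_left sgn2_add_right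
            sgn2_commute[of _ ?e] algebra_simps)
      qed
      then show ?thesis
        unfolding F coprod_simps gen_parity.simps by (intro coprod_cong[OF w])
    qed
  qed
  finally show ?case .
qed

end

section \<open>Modules over the quantum superalgebra\<close>

locale uq_module = quantum_osp n q for n q +
  fixes M :: "('m::ab_group_add) smod"
  assumes module: "is_module n q (carrier (Uq n q)) M"
begin

sublocale V: vector_space "scl M"
  using module by (simp add: is_module_def)

lemma part_subspace: "V.subspace (part M p)"
  using module by (simp add: is_module_def)

lemma part_space: "m \<in> part M p \<Longrightarrow> m \<in> space_of M"
proof -
  assume m: "m \<in> part M p"
  have "0 \<in> part M r" for r using part_subspace by (simp add: V.subspace_0)
  then show ?thesis
    using m by (cases p) (force simp: space_of_def)+
qed

lemma space_subspace: "V.subspace (space_of M)"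
proof -
  have "space_of M = {x + y |x y. x \<in> part M 0 \<and> y \<in> part M 1}" by (simp add: space_of_def)
  then show ?thesis using V.subspace_sums[OF part_subspace part_subspace] by simp
qed

lemma act_part:
  assumes "x \<in> upart n q p" "m \<in> part M r"
  shows "act M x m \<in> part M (p + r)"
proof -
  have "x \<in> carrier (Uq n q) \<inter> upart n q p" using assms(1) upart_carrier by auto
  then show ?thesis using module assms(2) unfolding is_module_def by blast
qed

lemma act_add:
  "x \<in> carrier (Uq n q) \<Longrightarrow> m \<in> space_of M \<Longrightarrow> m' \<in> space_of M \<Longrightarrow>
    act M x (m + m') = act M x m + act M x m'"
  and act_scale:
  "x \<in> carrier (Uq n q) \<Longrightarrow> m \<in> space_of M \<Longrightarrow> act M x (scl M c m) = scl M c (act M x m)"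
  and act_plus:
  "x \<in> carrier (Uq n q) \<Longrightarrow> y \<in> carrier (Uq n q) \<Longrightarrow> m \<in> space_of M \<Longrightarrow>
    act M (x \<oplus>\<^bsub>Uq n q\<^esub> y) m = act M x m + act M y m"
  and act_uscale:
  "x \<in> carrier (Uq n q) \<Longrightarrow> m \<in> space_of M \<Longrightarrow> act M (uscale n q c x) m = scl M c (act M x m)"
  and act_mult:
  "x \<in> carrier (Uq n q) \<Longrightarrow> y \<in> carrier (Uq n q) \<Longrightarrow> m \<in> space_of M \<Longrightarrow>
    act M (x \<otimes>\<^bsub>Uq n q\<^esub> y) m = act M x (act M y m)"
  and act_one: "m \<in> space_of M \<Longrightarrow> act M \<one>\<^bsub>Uq n q\<^esub> m = m"
  using module unfolding is_module_def by blast+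

lemma act_zero: "x \<in> carrier (Uq n q) \<Longrightarrow> act M x 0 = 0"
  using act_scale[of x 0 0] V.subspace_0[OF space_subspace] by simp

text \<open>The module axioms place \<open>act M x m\<close> only for homogeneous \<open>x\<close>
  and \<open>m\<close>; the general case follows by splitting both.\<close>

lemma act_closed:
  assumes "x \<in> carrier (Uq n q)" "m \<in> space_of M"
  shows "act M x m \<in> space_of M"
proof -
  have hom: "act M y m' \<in> space_of M" if "y \<in> upart n q p" "m' \<in> part M r" for y m' p r
    using act_part[OF that] part_space by blast
  obtain m0 m1 where m: "m = m0 + m1" "m0 \<in> part M 0" "m1 \<in> part M 1"
    using assms(2) by (auto simp: space_of_def)
  note c = ucomps[OF assms(1)]
  have "act M x m = act M (ucomps n q x 0) m + act M (ucomps n q x 1) m"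
    using act_plus[OF _ _ assms(2)] c upart_carrier by metis
  moreover have "act M (ucomps n q x p) m = act M (ucomps n q x p) m0 + act M (ucomps n q x p) m1" for p
    unfolding m(1) using m(2,3) part_space upart_carrier[OF c(1)] by (intro act_add) auto
  ultimately show ?thesis
    using hom[OF c(1) m(2)] hom[OF c(1) m(3)] V.subspace_add[OF space_subspace] by simp
qed

abbreviation act_word :: "gen list \<Rightarrow> 'm \<Rightarrow> 'm" where
  "act_word w \<equiv> act M (cls n q (mon w))"

lemma act_word_append:
  assumes "okw n u" "okw n v" "m \<in> space_of M"
  shows "act_word (u @ v) m = act_word u (act_word v m)"
  using act_mult[of "cls n q (mon u)" "cls n q (mon v)" m] assms
  by (simp add: mon_closed cls_closed flip: cls_mult mon_mult)

lemma act_word_Nil: "m \<in> space_of M \<Longrightarrow> act_word [] m = m"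
  using act_one by (simp add: cls_one flip: one_falg)

lemma act_word_Cons:
  "gen_index g \<in> {1..n} \<Longrightarrow> okw n v \<Longrightarrow> m \<in> space_of M \<Longrightarrow>
    act_word (g # v) m = act_word [g] (act_word v m)"
  using act_word_append[of "[g]" v m] by simp

lemma word_closed: "okw n w \<Longrightarrow> cls n q (mon w) \<in> carrier (Uq n q)"
  by (intro cls_closed mon_closed)

lemma act_word_closed: "okw n w \<Longrightarrow> m \<in> space_of M \<Longrightarrow> act_word w m \<in> space_of M"
  by (intro act_closed word_closed)

lemma act_word_part: "okw n w \<Longrightarrow> m \<in> part M r \<Longrightarrow> act_word w m \<in> part M (word_parity n w + r)"
  by (intro act_part upart_mon)

lemma act_cls:
  assumes "a \<in> carrier (free_alg n)" "m \<in> space_of M"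
  shows "act M (cls n q a) m
    = (\<Sum>w\<in>Poly_Mapping.keys a. scl M (Poly_Mapping.lookup a w) (act_word w m))"
proof -
  have "(\<Sum>w\<in>A. Poly_Mapping.single w (Poly_Mapping.lookup a w)) \<in> carrier (free_alg n) \<and>
      act M (cls n q (\<Sum>w\<in>A. Poly_Mapping.single w (Poly_Mapping.lookup a w))) m
    = (\<Sum>w\<in>A. scl M (Poly_Mapping.lookup a w) (act_word w m))"
    if "finite A" "A \<subseteq> Poly_Mapping.keys a" for A
    using that
  proof (induction A)
    case empty
    have "pm_scale 0 1 = (0 :: falg)" by (rule pm_eqI_ev) simp
    then have "cls n q 0 = uscale n q 0 (cls n q 1)"
      using uscale_cls[OF zero_one_closed(2), of n q 0] by simp
    then show ?case
      using act_uscale[OF cls_closed[OF zero_one_closed(2)] assms(2), of 0] by (simp add: zero_one_closed)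
  next
    case (insert w A)
    have w: "okw n w" using insert.prems assms(1) by (auto simp: carrier_free_alg)
    have single: "Poly_Mapping.single w c = pm_scale c (mon w)" for c
      by (rule pm_eqI_ev) simp
    have "act M (cls n q (Poly_Mapping.single w c)) m = scl M c (act_word w m)" for c
      using w assms(2) by (simp add: single act_uscale cls_closed mon_closed flip: uscale_cls)
    moreover have "Poly_Mapping.single w c \<in> carrier (free_alg n)" for c
      using w by (simp add: single scale_closed mon_closed)
    ultimately show ?case
      using insert assms(2) by (simp add: cls_add cls_closed act_plus free_alg_plus_closed)
  qed
  from this[OF finite_keys subset_refl] show ?thesis by (simp flip: pm_expand)
qed

text \<open>Identities verified on all respectful functionals hold in \<open>Uq\<close> and so in
  every module; this carries the word calculus over to modules.\<close>

lemma act_word_eq: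
  assumes "okw n u" "okw n v" "m \<in> space_of M"
    and "\<And>f. resp n q f \<Longrightarrow> f u = c * f v"
  shows "act_word u m = scl M c (act_word v m)"
proof -
  have "cls n q (mon u) = cls n q (pm_scale c (mon v))"
    using assms by (subst cls_eq_iff) (auto simp: mon_closed scale_closed)
  then show ?thesis
    using assms by (simp add: act_uscale cls_closed mon_closed flip: uscale_cls)
qed

lemma act_K_Kinv:
  assumes "i \<in> {1..n}" "m \<in> space_of M"
  shows "act_word [K i] (act_word [Kinv i] m) = m" "act_word [Kinv i] (act_word [K i] m) = m"
proof -
  have "act_word [K i, Kinv i] m = scl M 1 (act_word [] m)" "act_word [Kinv i, K i] m = scl M 1 (act_word [] m)"
    using assms k_cancel[OF resp_k_closed, of _ i "[]" "[]"] by (intro act_word_eq; simp)+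
  then show "act_word [K i] (act_word [Kinv i] m) = m" "act_word [Kinv i] (act_word [K i] m) = m"
    using assms by (simp_all add: act_word_Cons[of _ "[_]"] act_word_Nil)
qed

lemma act_K_gen:
  assumes "i \<in> {1..n}" "gen_index g \<in> {1..n}" "m \<in> space_of M"
  shows "act_word [K i] (act_word [g] m) = scl M (q powi gen_wt n i g) (act_word [g] (act_word [K i] m))"
proof -
  have "act_word [K i, g] m = scl M (q powi gen_wt n i g) (act_word [g, K i] m)"
    using assms k_swap[OF resp_k_closed, of _ i g "[]" "[]"] by (intro act_word_eq) auto
  then show ?thesis
    using assms by (simp add: act_word_Cons[of _ "[_]"])
qed

lemma act_E_F:
  assumes "i \<in> {1..n}" "j \<in> {1..n}" "m \<in> space_of M"
  shows "act_word [E i] (act_word [F j] m)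
    = scl M (sgn2 (of_bool (i = n)) (of_bool (j = n))) (act_word [F j] (act_word [E i] m))
      + (if i = j then scl M (1 / (q - inverse q)) (act_word [K i] m - act_word [Kinv i] m) else 0)"
proof -
  let ?s = "sgn2 (of_bool (i = n)) (of_bool (j = n))"
  let ?d = "if i = j then 1 / (q - inverse q) else 0"
  let ?b = "pm_scale ?s (mon [F j, E i]) + (pm_scale ?d (mon [K i]) + pm_scale (- ?d) (mon [Kinv i]))"
  have cl: "pm_scale c (mon w) \<in> carrier (free_alg n)" if "okw n w" for c w
    using that by (intro scale_closed mon_closed)
  have ev: "ev f (mon [E i, F j]) = ev f ?b" if "resp n q f" for f
    using resp_relations[OF that, of "[]" "[]"] assms
    by (cases "i = j") (simp_all add: relations_def ef_relation_def diff_eq_eq diff_divide_distrib)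
  have "cls n q (mon [E i, F j]) = cls n q ?b"
  proof -
    have "mon [E i, F j] \<in> carrier (free_alg n)" "?b \<in> carrier (free_alg n)"
      using assms(1,2) by (intro free_alg_plus_closed cl mon_closed; simp)+
    then show ?thesis using ev cls_eq_iff by blast
  qed
  also have "\<dots> = uscale n q ?s (cls n q (mon [F j, E i])) \<oplus>\<^bsub>Uq n q\<^esub>
      (uscale n q ?d (cls n q (mon [K i])) \<oplus>\<^bsub>Uq n q\<^esub> uscale n q (- ?d) (cls n q (mon [Kinv i])))"
  proof -
    have sum: "cls n q (pm_scale s (mon u) + (pm_scale d (mon v) + pm_scale e (mon w)))
      = uscale n q s (cls n q (mon u)) \<oplus>\<^bsub>Uq n q\<^esub>
        (uscale n q d (cls n q (mon v)) \<oplus>\<^bsub>Uq n q\<^esub> uscale n q e (cls n q (mon w)))"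
      if "okw n u" "okw n v" "okw n w" for s d e u v w
      using that by (simp add: cls_add cl free_alg_plus_closed uscale_cls mon_closed)
    show ?thesis by (rule sum) (use assms(1,2) in auto)
  qed
  finally have "act_word [E i, F j] m = scl M ?s (act_word [F j, E i] m)
      + (scl M ?d (act_word [K i] m) + scl M (- ?d) (act_word [Kinv i] m))"
  proof -
    interpret ring "Uq n q" by (rule ring_Uq)
    assume *: "cls n q (mon [E i, F j]) = uscale n q ?s (cls n q (mon [F j, E i])) \<oplus>\<^bsub>Uq n q\<^esub>
      (uscale n q ?d (cls n q (mon [K i])) \<oplus>\<^bsub>Uq n q\<^esub> uscale n q (- ?d) (cls n q (mon [Kinv i])))"
    have w: "cls n q (mon [F j, E i]) \<in> carrier (Uq n q)" "cls n q (mon [K i]) \<in> carrier (Uq n q)"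
        "cls n q (mon [Kinv i]) \<in> carrier (Uq n q)"
      using assms by (auto intro!: word_closed)
    show ?thesis
      unfolding * using w assms(3) by (simp only: act_plus act_uscale uscale_closed add.m_closed)
  qed
  then show ?thesis
    using assms by (simp add: act_word_Cons[of _ "[_]"] V.scale_right_diff_distrib)
qed

lemma act_word_generated:
  assumes gen: "\<And>g p m. gen_index g \<in> {1..n} \<Longrightarrow> m \<in> N p \<Longrightarrow> act_word [g] m \<in> N (gen_parity n g + p)"
    and sub: "\<And>p. N p \<subseteq> part M p" and w: "okw n w" and m: "m \<in> N p"
  shows "act_word w m \<in> N (word_parity n w + p)"
  using w
proof (induction w)
  case Nil
  then show ?case using m sub[of p] part_space by (auto simp: act_word_Nil)
next
  case (Cons g w)
  then show ?case
    using gen[of g "act_word w m" "word_parity n w + p"] m sub[of p] part_space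
    by (auto simp: act_word_Cons add.assoc)
qed

text \<open>The words span \<open>Uq\<close>, so stability has to be tested on single letters
  only.\<close>

lemma is_submodule:
  assumes N: "\<And>p. V.subspace (N p)" "\<And>p. N p \<subseteq> part M p"
    and gen: "\<And>g p m. gen_index g \<in> {1..n} \<Longrightarrow> m \<in> N p \<Longrightarrow> act_word [g] m \<in> N (gen_parity n g + p)"
  shows "is_module n q (carrier (Uq n q)) (M\<lparr>part := N\<rparr>)"
proof -
  have sub: "space_of (M\<lparr>part := N\<rparr>) \<subseteq> space_of M"
    using N(2) by (fastforce simp: space_of_def)
  have "act M x m \<in> N (p + r)" if x: "x \<in> upart n q p" and m: "m \<in> N r" for x m p r
  proof -
    obtain a where a: "a \<in> carrier (free_alg n)" "\<And>w. w \<in> Poly_Mapping.keys a \<Longrightarrow> word_parity n w = p"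
        "x = cls n q a"
      using x by (elim upartE) blast
    have "m \<in> space_of M" using m N(2) part_space by blast
    moreover have "act_word w m \<in> N (p + r)" if "w \<in> Poly_Mapping.keys a" for w
      using act_word_generated[OF gen N(2), of w m r] m that a(1,2) by (auto simp: carrier_free_alg)
    ultimately show ?thesis
      using N(1) by (auto simp: a(3) act_cls[OF a(1)] intro!: V.subspace_sum V.subspace_scale)
  qed
  moreover have "N 0 \<inter> N 1 = {0}"
  proof -
    have "part M 0 \<inter> part M 1 = {0}" using module by (simp add: is_module_def)
    then show ?thesis using N V.subspace_0[OF N(1)] by blast
  qed
  ultimately show ?thesis
    using N(1) sub module V.vector_space_axioms unfolding is_module_def
    by (auto dest!: subsetD[OF sub])
qed

end

section \<open>The vector representation\<close>

context uq_module
begin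

text \<open>Repeated application of \<open>T - \<nu>\<close> to separate the eigenvectors of \<open>T = act M x\<close>.\<close>

primrec sep :: "uq \<Rightarrow> complex list \<Rightarrow> 'm \<Rightarrow> 'm" where
  "sep x [] m = m"
| "sep x (c # cs) m = sep x cs (act M x m - scl M c m)"

context
  fixes x assumes x: "x \<in> carrier (Uq n q)"
begin

lemma sep_step_closed: "m \<in> space_of M \<Longrightarrow> act M x m - scl M c m \<in> space_of M"
  using x by (intro V.subspace_diff[OF space_subspace] V.subspace_scale[OF space_subspace] act_closed)

lemma sep_add: "m \<in> space_of M \<Longrightarrow> m' \<in> space_of M \<Longrightarrow> sep x cs (m + m') = sep x cs m + sep x cs m'"
proof (induction cs arbitrary: m m')
  case (Cons c cs)
  then show ?case
    using Cons.IH[OF sep_step_closed sep_step_closed, OF Cons.prems, of c c]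
    by (simp add: act_add x V.scale_right_distrib algebra_simps)
qed simp

lemma sep_scale: "m \<in> space_of M \<Longrightarrow> sep x cs (scl M d m) = scl M d (sep x cs m)"
proof (induction cs arbitrary: m)
  case (Cons c cs)
  then show ?case
    using Cons.IH[OF sep_step_closed, OF Cons.prems, of c]
    by (simp add: act_scale x V.scale_right_diff_distrib mult.commute)
qed simp

lemma sep_append: "sep x (cs @ ds) m = sep x ds (sep x cs m)"
  by (induction cs arbitrary: m) auto

lemma sep_act: "m \<in> space_of M \<Longrightarrow> sep x cs (act M x m) = act M x (sep x cs m)"
proof (induction cs arbitrary: m)
  case (Cons c cs)
  have "act M x (act M x m) - scl M c (act M x m) = act M x (act M x m - scl M c m)"
    using act_add[OF x, of "act M x m" "- scl M c m"] act_scale[OF x, of "scl M c m" "- 1"] act_scale[OF x Cons.prems, of c]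
      Cons.prems act_closed[OF x] V.subspace_scale[OF space_subspace] V.subspace_neg[OF space_subspace]
    by simp
  then show ?case using Cons.IH[OF sep_step_closed, OF Cons.prems, of c] by simp
qed simp

lemma sep_zero: "sep x cs 0 = 0"
  by (induction cs) (simp_all add: act_zero x)

lemma sep_commute: "m \<in> space_of M \<Longrightarrow> sep x cs (sep x ds m) = sep x ds (sep x cs m)"
proof (induction ds arbitrary: m)
  case (Cons d ds)
  have "sep x cs (act M x m - scl M d m) = act M x (sep x cs m) - scl M d (sep x cs m)"
    using sep_add[of "act M x m" "scl M (- d) m" cs] sep_act[of m cs] sep_scale[of m cs "- d"] Cons.prems
      act_closed[OF x] V.subspace_scale[OF space_subspace] V.subspace_neg[OF space_subspace] by simp
  then show ?case using Cons.IH[OF sep_step_closed, OF Cons.prems, of d] by simp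
qed simp

lemma sep_eigenvector:
  assumes "m \<in> space_of M" "act M x m = scl M d m"
  shows "sep x cs m = scl M (prod_list (map (\<lambda>c. d - c) cs)) m"
proof (induction cs)
  case (Cons c cs)
  then show ?case
    using assms sep_scale[OF assms(1)] by (simp flip: V.scale_left_diff_distrib)
qed simp

text \<open>An element of the span is killed by a product of factors \<open>T - c\<close> with all
  \<open>c \<noteq> d\<close>, whereas such a product multiplies \<open>m\<close> by a nonzero
  scalar.\<close>

lemma eigenvector_not_in_span:
  assumes "m \<in> space_of M" "act M x m = scl M d m"
    and S: "\<And>s. s \<in> S \<Longrightarrow> s \<in> space_of M \<and> (\<exists>c. c \<noteq> d \<and> act M x s = scl M c s)"
    and "m \<in> V.span S"
  shows "m = 0"
proof -
  have "s \<in> space_of M \<and> (\<exists>cs. d \<notin> set cs \<and> sep x cs s = 0)" if "s \<in> V.span S" for s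
    using that
  proof (induction rule: V.span_induct_alt)
    case base
    then show ?case using V.subspace_0[OF space_subspace] by (auto intro!: exI[of _ "[]"])
  next
    case (step c s y)
    obtain e where e: "e \<noteq> d" "act M x s = scl M e s" and s: "s \<in> space_of M" using S step.hyps by blast
    obtain cs where cs: "d \<notin> set cs" "sep x cs y = 0" and y: "y \<in> space_of M" using step.IH by blast
    have sy: "scl M c s \<in> space_of M" using s V.subspace_scale[OF space_subspace] by blast
    \<comment> \<open>The factors commute: the new one kills \<open>s\<close>, the old ones kill
      \<open>y\<close>.\<close>
    have "sep x (e # cs) (scl M c s + y) = sep x cs (sep x [e] (scl M c s)) + sep x [e] (sep x cs y)"
      using sep_add[OF sy y, of "e # cs"] sep_append[of "[e]" cs] sep_commute[OF y, of "[e]" cs] by simp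
    also have "\<dots> = 0"
      using e s cs sep_zero by (simp add: act_scale x mult.commute act_zero)
    finally show ?case
      using sy y cs e V.subspace_add[OF space_subspace] by (auto intro!: exI[of _ "e # cs"])
  qed
  then obtain cs where "d \<notin> set cs" "sep x cs m = 0" using assms(4) by blast
  then show ?thesis
    using sep_eigenvector[OF assms(1,2), of cs] by (auto simp: prod_list_zero_iff)
qed

end

text \<open>Weights are recorded by their pairings \<open>\<kappa> i\<close> with the simple roots,
  so that \<open>gen_wt\<close> is simply added to them.\<close>

definition weight_vector :: "(nat \<Rightarrow> int) \<Rightarrow> 'm \<Rightarrow> bool" where
  "weight_vector \<kappa> m \<longleftrightarrow> m \<in> space_of M \<and> (\<forall>i\<in>{1..n}. act_word [K i] m = scl M (q powi \<kappa> i) m)"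

lemma weight_vector_gen:
  assumes "weight_vector \<kappa> m" "gen_index g \<in> {1..n}"
  shows "weight_vector (\<lambda>i. \<kappa> i + gen_wt n i g) (act_word [g] m)"
  using assms
  by (simp add: weight_vector_def act_word_closed act_K_gen act_scale word_closed power_int_add q_nonzero mult.commute)

lemma weight_vector_Kinv:
  assumes "weight_vector \<kappa> m" "i \<in> {1..n}"
  shows "act_word [Kinv i] m = scl M (q powi - \<kappa> i) m"
proof -
  have m: "m \<in> space_of M" "act_word [K i] m = scl M (q powi \<kappa> i) m"
    using assms by (auto simp: weight_vector_def)
  have "scl M (q powi - \<kappa> i) m = scl M (q powi - \<kappa> i) (act_word [Kinv i] (act_word [K i] m))"
    using act_K_Kinv[OF assms(2) m(1)] by simp
  also have "\<dots> = act_word [Kinv i] m"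
    using assms(2) m by (simp add: act_scale word_closed power_int_minus q_nonzero)
  finally show ?thesis by simp
qed

definition qint :: "int \<Rightarrow> complex" where
  "qint k = (q powi k - q powi - k) / (q - inverse q)"

lemma act_E_F_weight:
  assumes "weight_vector \<kappa> m" "i \<in> {1..n}" "j \<in> {1..n}"
  shows "act_word [E i] (act_word [F j] m)
    = scl M (sgn2 (of_bool (i = n)) (of_bool (j = n))) (act_word [F j] (act_word [E i] m))
      + (if i = j then scl M (qint (\<kappa> i)) m else 0)"
proof -
  have m: "m \<in> space_of M" "act_word [K i] m = scl M (q powi \<kappa> i) m"
    using assms by (auto simp: weight_vector_def)
  show ?thesis
    unfolding act_E_F[OF assms(2,3) m(1)] weight_vector_Kinv[OF assms(1,2)] m(2)
    by (simp add: qint_def flip: V.scale_left_diff_distrib)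
qed

end

section \<open>Heights, and the weights of the vector representation\<close>

text \<open>The coefficients of \<open>\<lambda> = \<Sum>\<^sub>i (n + 1 - i) \<epsilon>\<^sub>i\<close> with respect to the simple roots;
  \<open>(\<lambda>, \<alpha>\<^sub>i) = 1\<close> for all \<open>i\<close>.\<close>

fun height_coeff :: "nat \<Rightarrow> nat \<Rightarrow> int" where
  "height_coeff n 0 = 0"
| "height_coeff n (Suc j) = height_coeff n j + int n - int j"

definition height :: "nat \<Rightarrow> (nat \<Rightarrow> int) \<Rightarrow> int" where
  "height n \<kappa> = (\<Sum>j=1..n. height_coeff n j * \<kappa> j)"

lemma height_coeff_nonneg: "j \<le> n \<Longrightarrow> height_coeff n j \<ge> 0"
  by (induction j) auto

text \<open>All simple roots have height 1, so each \<open>F i\<close> lowers the height by exactly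
  one, and one integer locates a weight within the chain below.\<close>

lemma height_simple_root:
  assumes "i \<in> {1..n}"
  shows "height n (\<lambda>j. ip n (simple_root n j) (simple_root n i)) = 1"
proof -
  have "height n (\<lambda>j. ip n (simple_root n j) (simple_root n i))
    = (\<Sum>j=1..n. (if j = i then height_coeff n i * (if i < n then 2 else 1) else 0)
       - (if j = i - 1 then height_coeff n (i - 1) else 0) - (if j = i + 1 then height_coeff n (i + 1) else 0))"
    unfolding height_def using assms by (intro sum.cong refl) (auto simp: ip_simple_root)
  also have "\<dots> = height_coeff n i * (if i < n then 2 else 1) - height_coeff n (i - 1)
      - (if i < n then height_coeff n (i + 1) else 0)"
    using assms by (cases "i = 1") (auto simp: sum_subtractf)
  also have "\<dots> = 1"
    using assms by (cases i) auto
  finally show ?thesis .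
qed

lemma height_add: "height n (\<lambda>j. \<kappa> j + \<mu> j) = height n \<kappa> + height n \<mu>"
  by (simp add: height_def distrib_left sum.distrib)

lemma height_uminus: "height n (\<lambda>j. - \<kappa> j) = - height n \<kappa>"
  by (simp add: height_def sum_negf)


text \<open>The chain of simple roots 1, 2, ..., n, n, ..., 2, 1, counted from 0: subtracting the
  root number \<open>a\<close> leads from the weight number \<open>a\<close> of the vector
  representation to the next one.\<close>

definition vector_index :: "nat \<Rightarrow> nat \<Rightarrow> nat" where
  "vector_index n a = (if a < n then Suc a else 2 * n - a)"

text \<open>The weights \<open>\<epsilon>\<^sub>1, \<dots>, \<epsilon>\<^sub>n, 0, -\<epsilon>\<^sub>n, \<dots>, -\<epsilon>\<^sub>1\<close> paired with \<open>\<alpha>\<^sub>i\<close>, for \<open>a = 0, \<dots>, 2n\<close>.\<close>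

definition vector_weight :: "nat \<Rightarrow> nat \<Rightarrow> nat \<Rightarrow> int" where
  "vector_weight n a i = of_bool (i = a + 1) + of_bool (i + a = 2 * n)
     - of_bool (i = a) - of_bool (i + a = 2 * n + 1)"

lemma vector_index_range: "a < 2 * n \<Longrightarrow> vector_index n a \<in> {1..n}"
  unfolding vector_index_def atLeastAtMost_iff by presburger

lemma vector_weight_Suc:
  assumes "a < 2 * n" "i \<in> {1..n}"
  shows "vector_weight n (Suc a) i
    = vector_weight n a i - ip n (simple_root n i) (simple_root n (vector_index n a))"
  unfolding ip_simple_root[OF assms(2) vector_index_range[OF assms(1)]]
proof (cases "a < n")
  case True
  have "i + a \<noteq> 2 * n" "i + a \<noteq> 2 * n + 1" "i + Suc a = 2 * n \<longleftrightarrow> i = n \<and> Suc a = n" "i + Suc a \<noteq> 2 * n + 1"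
    using True assms(2) by auto
  moreover have "vector_index n a = Suc a" using True by (simp add: vector_index_def)
  ultimately show "vector_weight n (Suc a) i = vector_weight n a i
      - (if i = vector_index n a then if i < n then 2 else 1
         else if vector_index n a = i + 1 \<or> i = vector_index n a + 1 then - 1 else 0)"
    unfolding vector_weight_def using True assms(2) by (simp only: of_bool_def) auto
next
  case False
  obtain k where k: "a + k = 2 * n" "1 \<le> k" "k \<le> n"
    using assms(1) False by (intro that[of "2 * n - a"]) auto
  have a: "i \<noteq> a + 1" "i \<noteq> Suc a + 1" "i \<noteq> Suc a" "i = a \<longleftrightarrow> i = n \<and> k = n"
      "i + a = 2 * n \<longleftrightarrow> i = k" "i + a = 2 * n + 1 \<longleftrightarrow> i = k + 1"
      "i + Suc a = 2 * n \<longleftrightarrow> k = i + 1" "i + Suc a = 2 * n + 1 \<longleftrightarrow> i = k"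
    using k assms(2) False by auto
  have vi: "vector_index n a = k" using False k by (simp add: vector_index_def)
  show "vector_weight n (Suc a) i = vector_weight n a i
      - (if i = vector_index n a then if i < n then 2 else 1
         else if vector_index n a = i + 1 \<or> i = vector_index n a + 1 then - 1 else 0)"
    unfolding vi vector_weight_def a using k(2,3) assms(2) a(1-3) by (simp only: of_bool_def) auto
qed

lemma height_vector_weight: "n \<ge> 1 \<Longrightarrow> a \<le> 2 * n \<Longrightarrow> height n (vector_weight n a) = int n - int a"
proof (induction a)
  case 0
  have "height n (vector_weight n 0) = (\<Sum>j=1..n. if j = 1 then height_coeff n 1 else 0)"
    unfolding height_def using 0 by (intro sum.cong refl) (auto simp: vector_weight_def)
  then show ?case using 0 by simp
next
  case (Suc a)
  have "height n (vector_weight n (Suc a)) = height n (\<lambda>i. vector_weight n a i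
      + - ip n (simple_root n i) (simple_root n (vector_index n a)))"
    unfolding height_def using Suc.prems by (intro sum.cong refl) (auto simp: vector_weight_Suc)
  then show ?case
    unfolding height_add height_uminus using Suc by (subst (asm) height_simple_root) (auto simp: vector_index_def)
qed

text \<open>The dimension is left out on purpose: irreducibility and the highest weight already
  produce a spanning chain of \<open>2 * n + 1\<close> vectors. The dimension serves later to make
  the chain independent.\<close>

locale highest_weight_module = uq_module n q M for n q and M :: "('m::ab_group_add) smod" +
  fixes v :: 'm
  assumes n: "n \<ge> 1" and generic: "\<forall>m>0. q ^ m \<noteq> 1"
    and irreducible: "irreducible_module n q M"
    and v: "v \<in> part M 0" "v \<noteq> 0"
    and Ev: "\<And>i. i \<in> {1..n} \<Longrightarrow> act_word [E i] v = 0"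
    and Kv: "\<And>i. i \<in> {1..n} \<Longrightarrow> act_word [K i] v = scl M (q powi vector_weight n 0 i) v"
begin

text \<open>Genericity of \<open>q\<close> enters here: distinct integral weights have distinct
  eigenvalues.\<close>

lemma powi_inj: "q powi a = q powi b \<longleftrightarrow> a = b"
proof -
  have "q powi a \<noteq> q powi b" if "a < b" for a b
  proof
    assume "q powi a = q powi b"
    then have "q powi (b - a) = 1" using q_nonzero by (simp add: power_int_diff)
    then have "q ^ nat (b - a) = 1" using that by (simp add: power_int_def)
    then show False using generic that by simp
  qed
  then show ?thesis by (metis linorder_neqE)
qed

text \<open>The weights of the vector representation pair with the simple roots to 0, 1 or -1, so
  these are the quantum integers that occur.\<close>

lemma qint_values [simp]: "qint 0 = 0" "qint 1 = 1" "qint (- 1) = - 1"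
proof -
  have "q powi 1 \<noteq> q powi (- 1)" by (subst powi_inj) simp
  then have "q - inverse q \<noteq> 0" by simp
  then show "qint 0 = 0" "qint 1 = 1" "qint (- 1) = - 1"
    by (simp_all add: qint_def divide_simps)
qed

text \<open>The word is the product of the \<open>K j\<close> to the powers
  \<open>height_coeff n j\<close>, which are nonnegative; it turns the height into the eigenvalue of
  a single element of \<open>Uq\<close>.\<close>

lemma height_word:
  obtains u where "okw n u"
    "\<And>\<kappa> m. weight_vector \<kappa> m \<Longrightarrow> act_word u m = scl M (q powi height n \<kappa>) m"
proof -
  let ?w = "\<lambda>k. concat (map (\<lambda>j. replicate (nat (height_coeff n j)) (K j)) [1..<Suc k])"
  have "okw n (?w k) \<and> (\<forall>\<kappa> m. weight_vector \<kappa> m \<longrightarrow>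
      act_word (?w k) m = scl M (q powi (\<Sum>j=1..k. height_coeff n j * \<kappa> j)) m)" if "k \<le> n" for k
    using that
  proof (induction k)
    case 0
    then show ?case by (auto simp: weight_vector_def act_word_Nil)
  next
    case (Suc k)
    have ok: "okw n (replicate r (K (Suc k)))" for r
      using Suc.prems by (simp add: okw_def)
    have rep: "act_word (replicate r (K (Suc k))) m = scl M (q powi (int r * \<kappa> (Suc k))) m"
      if "weight_vector \<kappa> m" for \<kappa> m r
    proof (induction r)
      case 0
      then show ?case using that by (simp add: weight_vector_def act_word_Nil)
    next
      case (Suc r)
      have "act_word (replicate (Suc r) (K (Suc k))) m
          = act_word [K (Suc k)] (act_word (replicate r (K (Suc k))) m)"
        using that ok[of r] \<open>Suc k \<le> n\<close> act_word_Cons[of "K (Suc k)" "replicate r (K (Suc k))" m]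
        by (simp add: weight_vector_def)
      also have "\<dots> = scl M (q powi (int r * \<kappa> (Suc k)) * q powi \<kappa> (Suc k)) m"
        using that \<open>Suc k \<le> n\<close> unfolding Suc.IH weight_vector_def
        by (simp add: act_scale word_closed)
      finally show ?case
        by (simp add: q_nonzero algebra_simps flip: power_int_add)
    qed
    have "act_word (?w (Suc k)) m = scl M (q powi (\<Sum>j=1..Suc k. height_coeff n j * \<kappa> j)) m"
      if m: "weight_vector \<kappa> m" for \<kappa> m
    proof -
      have c: "int (nat (height_coeff n (Suc k))) = height_coeff n (Suc k)"
        using height_coeff_nonneg[OF Suc.prems] by simp
      have ms: "m \<in> space_of M" using m by (simp add: weight_vector_def)
      have w: "?w (Suc k) = ?w k @ replicate (nat (height_coeff n (Suc k))) (K (Suc k))" by simp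
      have "act_word (?w (Suc k)) m = act_word (?w k)
          (scl M (q powi (height_coeff n (Suc k) * \<kappa> (Suc k))) m)"
        unfolding w using Suc ms rep[OF m] c by (simp only: act_word_append ok)
      then show ?thesis
        using Suc m ms
        by (simp add: act_scale word_closed power_int_add q_nonzero mult.commute)
    qed
    then show ?case using Suc ok by simp
  qed
  from this[OF order_refl] show ?thesis using that unfolding height_def by blast
qed

lemma irreducible_submodule:
  assumes "\<And>p. V.subspace (N p)" "\<And>p. N p \<subseteq> part M p"
    and "\<And>g p m. gen_index g \<in> {1..n} \<Longrightarrow> m \<in> N p \<Longrightarrow> act_word [g] m \<in> N (gen_parity n g + p)"
    and "m \<in> N p" "m \<noteq> 0"
  shows "N = part M"
  using is_submodule[OF assms(1-3)] irreducible assms(2,4,5)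
  unfolding irreducible_module_def by blast

end

context uq_module
begin

lemma act_span:
  assumes x: "x \<in> carrier (Uq n q)" and m: "m \<in> V.span S" and T: "V.subspace T"
    and S: "\<And>s. s \<in> S \<Longrightarrow> s \<in> space_of M \<and> act M x s \<in> T"
  shows "act M x m \<in> T"
proof -
  have "m \<in> space_of M \<and> act M x m \<in> T"
    using m
  proof (induction rule: V.span_induct_alt)
    case base
    then show ?case using x T by (simp add: act_zero V.subspace_0 space_subspace)
  next
    case (step c s y)
    then show ?case
      using x S[of s] T space_subspace
      by (simp add: act_add act_scale V.subspace_add V.subspace_scale)
  qed
  then show ?thesis ..
qed

end

context highest_weight_module
begin

text \<open>Such a vector would generate a proper submodule, since all weights of the latter are lower
  than the weight of \<open>v\<close>.\<close>

lemma primitive_vector_zero: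
  assumes u: "u \<in> part M r" "weight_vector \<kappa> u" and E: "\<And>i. i \<in> {1..n} \<Longrightarrow> act_word [E i] u = 0"
    and h: "height n \<kappa> < int n"
  shows "u = 0"
proof (rule ccontr)
  assume "u \<noteq> 0"
  have us: "u \<in> space_of M" using u(1) part_space by blast
  define fw where "fw w \<longleftrightarrow> okw n w \<and> (\<forall>g\<in>set w. \<exists>i. g = F i)" for w
  define S where "S p = {act_word w u | w. fw w \<and> word_parity n w + r = p}" for p
  define N where "N p = V.span (S p)" for p
  have fw_Cons: "fw (g # w) \<longleftrightarrow> (\<exists>i\<in>{1..n}. g = F i) \<and> fw w" for g w
    by (auto simp: fw_def)
  have wt: "\<exists>\<kappa>'. weight_vector \<kappa>' (act_word w u) \<and> height n \<kappa>' \<le> height n \<kappa>" if "fw w" for w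
    using that
  proof (induction w)
    case Nil
    then show ?case using u us by (auto simp: act_word_Nil)
  next
    case (Cons g w)
    obtain i where i: "i \<in> {1..n}" "g = F i" "fw w" using Cons.prems fw_Cons by auto
    obtain \<kappa>' where \<kappa>': "weight_vector \<kappa>' (act_word w u)" "height n \<kappa>' \<le> height n \<kappa>"
      using Cons.IH[OF i(3)] by auto
    have "okw n w" using i(3) by (simp add: fw_def)
    then have "weight_vector (\<lambda>j. \<kappa>' j + - ip n (simple_root n j) (simple_root n i)) (act_word (g # w) u)"
      using weight_vector_gen[OF \<kappa>'(1), of g] i us by (simp add: act_word_Cons)
    moreover have "height n (\<lambda>j. \<kappa>' j + - ip n (simple_root n j) (simple_root n i)) = height n \<kappa>' - 1"
      unfolding height_add height_uminus height_simple_root[OF i(1)] by simp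
    ultimately show ?case
      using \<kappa>'(2) by (intro exI[of _ "\<lambda>j. \<kappa>' j + - ip n (simple_root n j) (simple_root n i)"]) simp
  qed
  have S_part: "S p \<subseteq> part M p" for p
    using u(1) by (auto simp: S_def fw_def intro: act_word_part)
  have N_part: "N p \<subseteq> part M p" for p
    unfolding N_def using S_part by (intro V.span_minimal part_subspace)
  have "N = part M"
  proof (rule irreducible_submodule)
    show "V.subspace (N p)" for p by (simp add: N_def)
    show "N p \<subseteq> part M p" for p by (rule N_part)
    show "u \<in> N r"
      unfolding N_def S_def using us by (intro V.span_base) (auto intro!: exI[of _ "[]"] simp: fw_def act_word_Nil)
    show "u \<noteq> 0" by fact
    have gen_S: "act_word [g] (act_word w u) \<in> N (gen_parity n g + (word_parity n w + r))"
      if g: "gen_index g \<in> {1..n}" and w: "fw w" for g w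
    proof -
      have base: "act_word w u \<in> N (word_parity n w + r)" if "fw w" for w
        using that unfolding N_def S_def by (intro V.span_base) blast
      have sc: "scl M c m \<in> N p" if "m \<in> N p" for c m p
        using that unfolding N_def by (rule V.span_scale)
      have ad: "m + m' \<in> N p" if "m \<in> N p" "m' \<in> N p" for m m' p
        using that unfolding N_def by (rule V.span_add)
      have zero: "0 \<in> N p" for p unfolding N_def by (rule V.span_zero)
      have Fstep: "act_word [F i] m \<in> N (gen_parity n (F i) + p)" if i: "i \<in> {1..n}" and m: "m \<in> N p" for i m p
        using i m unfolding N_def
      proof (intro act_span[where S = "S p"])
        fix x
        assume "x \<in> S p"
        then obtain w where w: "x = act_word w u" "fw w" "word_parity n w + r = p" by (auto simp: S_def)
        have "act_word (F i # w) u \<in> S (gen_parity n (F i) + p)"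
          unfolding S_def using w i fw_Cons by (auto intro!: exI[of _ "F i # w"] simp: add.assoc)
        then show "x \<in> space_of M \<and> act_word [F i] x \<in> V.span (S (gen_parity n (F i) + p))"
          using w i us by (simp add: act_word_Cons fw_def act_word_closed V.span_base)
      qed (auto intro: word_closed)
      \<comment> \<open>Moving \<open>E i\<close> past the first letter \<open>F j\<close> costs at
        most a scalar multiple of the shorter word; in the end \<open>E i\<close> reaches
        \<open>u\<close> and kills it.\<close>
      have Estep: "act_word [E i] (act_word w u) \<in> N (gen_parity n (E i) + (word_parity n w + r))"
        if i: "i \<in> {1..n}" and w: "fw w" for i w
        using w
      proof (induction w)
        case Nil
        then show ?case using E[OF i] us zero by (simp add: act_word_Nil)
      next
        case (Cons g w)
        obtain j where j: "j \<in> {1..n}" "g = F j" "fw w" using Cons.prems fw_Cons by auto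
        have ok: "okw n w" using j(3) by (simp add: fw_def)
        obtain \<kappa>' where \<kappa>': "weight_vector \<kappa>' (act_word w u)" using wt[OF j(3)] by blast
        have 1: "act_word [F j] (act_word [E i] (act_word w u))
            \<in> N (gen_parity n (E i) + (word_parity n (g # w) + r))"
          using Fstep[OF j(1) Cons.IH[OF j(3)]] j(2) by (simp add: ac_simps)
        have 2: "act_word w u \<in> N (gen_parity n (E i) + (word_parity n (g # w) + r))" if "i = j"
          using base[OF j(3)] j(2) that by (simp add: ac_simps)
        have eq: "act_word [E i] (act_word (g # w) u) = act_word [E i] (act_word [F j] (act_word w u))"
          using j ok us by (simp add: act_word_Cons)
        show ?case
        proof (cases "i = j")
          case True
          show ?thesis
            unfolding eq act_E_F_weight[OF \<kappa>' i j(1)] if_P[OF True] by (intro ad sc 1 2 True)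
        next
          case False
          show ?thesis
            unfolding eq act_E_F_weight[OF \<kappa>' i j(1)] if_not_P[OF False] by (intro ad sc 1 zero)
        qed
      qed
      obtain \<kappa>' where \<kappa>': "weight_vector \<kappa>' (act_word w u)" using wt[OF w] by blast
      show ?thesis
      proof (cases g)
        case (K i)
        then show ?thesis using g \<kappa>' sc[OF base[OF w]] by (simp add: weight_vector_def)
      next
        case (Kinv i)
        then show ?thesis using g weight_vector_Kinv[OF \<kappa>', of i] sc[OF base[OF w]] by simp
      next
        case (E i)
        then show ?thesis using g Estep[of i w] w by simp
      next
        case (F i)
        then show ?thesis using g Fstep[OF _ base[OF w], of i] by simp
      qed
    qed
    show "act_word [g] m \<in> N (gen_parity n g + p)" if g: "gen_index g \<in> {1..n}" and m: "m \<in> N p" for g p m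
      using g m unfolding N_def
    proof (intro act_span[where S = "S p"])
      fix x
      assume x: "x \<in> S p"
      then obtain w where w: "x = act_word w u" "fw w" "word_parity n w + r = p" by (auto simp: S_def)
      show "x \<in> space_of M \<and> act_word [g] x \<in> V.span (S (gen_parity n g + p))"
        using gen_S[OF g w(2)] w x S_part part_space unfolding N_def by blast
    qed (auto intro: word_closed)
  qed
  \<comment> \<open>Now \<open>v\<close> is a combination of vectors whose heights are below its own
    height \<open>n\<close>, against the independence of eigenvectors of the operator that measures
    the height.\<close>
  then have "v \<in> V.span (S 0)" using v(1) by (simp add: N_def fun_eq_iff)
  obtain z where z: "okw n z" "\<And>\<kappa> m. weight_vector \<kappa> m \<Longrightarrow> act_word z m = scl M (q powi height n \<kappa>) m"
    using height_word by blast
  have vs: "v \<in> space_of M" using v part_space by blast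
  have "weight_vector (vector_weight n 0) v" using vs Kv by (simp add: weight_vector_def)
  then have "act_word z v = scl M (q powi int n) v"
    using z(2) height_vector_weight[OF n, of 0] by simp
  moreover have "s \<in> space_of M \<and> (\<exists>c. c \<noteq> q powi int n \<and> act_word z s = scl M c s)" if s: "s \<in> S 0" for s
  proof -
    obtain w where w: "fw w" "s = act_word w u" using s by (auto simp: S_def)
    obtain \<kappa>' where "weight_vector \<kappa>' s" "height n \<kappa>' \<le> height n \<kappa>" using wt[OF w(1)] w(2) by blast
    then show ?thesis
      using z(2)[of \<kappa>' s] h powi_inj[of "height n \<kappa>'" "int n"] by (auto simp: weight_vector_def)
  qed
  ultimately have "v = 0"
    using eigenvector_not_in_span[OF word_closed[OF z(1)] vs] \<open>v \<in> V.span (S 0)\<close> by blast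
  then show False using v by simp
qed

lemma vector_weight_zero:
  assumes "i \<in> {1..n}" "i \<noteq> vector_index n a" "a \<le> 2 * n" "\<not> (a \<ge> 1 \<and> i = vector_index n (a - 1))"
  shows "vector_weight n a i = 0"
  using assms by (auto simp: vector_index_def vector_weight_def split: if_splits)

lemma vector_weight_minus_one:
  assumes "i \<in> {1..n}" "i \<noteq> vector_index n a" "a \<le> 2 * n" "a \<ge> 1" "i = vector_index n (a - 1)"
  shows "sgn2 (of_bool (i = n)) (of_bool (i = n)) * (if a = n + 1 then - 1 else 1) = 1"
    and "vector_weight n a i = - 1"
  using assms by (auto simp: vector_index_def vector_weight_def split: if_splits)

lemma vector_weight_one:
  assumes "a < 2 * n"
  shows "vector_weight n a (vector_index n a) = (if a = n then 0 else 1)"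
  using assms by (auto simp: vector_index_def vector_weight_def split: if_splits)

lemma vector_index_eq:
  assumes "a < 2 * n" "a \<ge> 1"
  shows "vector_index n a = vector_index n (a - 1) \<longleftrightarrow> a = n"
  using assms by (auto simp: vector_index_def split: if_splits)

text \<open>Only \<open>basis n\<close> will be odd: the odd root \<open>n\<close> is used exactly
  twice, on the step into \<open>basis n\<close> and on the step out of it.\<close>

primrec basis :: "nat \<Rightarrow> 'm" where
  "basis 0 = v"
| "basis (Suc a) = act_word [F (vector_index n a)] (basis a)"

text \<open>At weight zero the odd relation reads \<open>E F + F E = 0\<close>, and
  \<open>E n\<close> maps \<open>basis n\<close> to \<open>basis (n - 1)\<close>; therefore
  \<open>E n\<close> maps \<open>basis (n + 1)\<close> to minus \<open>basis n\<close>. Everywhere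
  else the normalisation by \<open>F\<close> gives the coefficient 1.\<close>

definition basis_ok :: "nat \<Rightarrow> bool" where
  "basis_ok a \<longleftrightarrow> basis a \<in> part M (of_bool (a = n)) \<and> weight_vector (vector_weight n a) (basis a) \<and>
    (\<forall>i\<in>{1..n}. act_word [E i] (basis a) = (if a \<ge> 1 \<and> i = vector_index n (a - 1)
       then scl M (if a = n + 1 then - 1 else 1) (basis (a - 1)) else 0))"

lemma basis_step:
  assumes a: "a < 2 * n" and ok: "basis_ok a"
    and F: "\<And>i. i \<in> {1..n} \<Longrightarrow> a \<ge> 1 \<Longrightarrow> i \<noteq> vector_index n (a - 1) \<Longrightarrow> act_word [F i] (basis (a - 1)) = 0"
      "a \<ge> 1 \<Longrightarrow> basis (a - 1) \<in> space_of M"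
  shows "basis_ok (Suc a)"
proof -
  define k where "k = vector_index n a"
  have k: "k \<in> {1..n}" unfolding k_def by (rule vector_index_range[OF a])
  have b: "basis (Suc a) = act_word [F k] (basis a)" by (simp add: k_def)
  have w: "weight_vector (vector_weight n a) (basis a)" using ok by (simp add: basis_ok_def)
  have kn: "k = n \<longleftrightarrow> a = n \<or> Suc a = n" using a k by (auto simp: k_def vector_index_def split: if_splits)
  have "basis (Suc a) \<in> part M (of_bool (Suc a = n))"
  proof -
    have "basis (Suc a) \<in> part M (word_parity n [F k] + of_bool (a = n))"
      unfolding b using ok k by (intro act_word_part) (auto simp: basis_ok_def)
    moreover have "word_parity n [F k] + of_bool (a = n) = of_bool (Suc a = n)"
      using kn by auto
    ultimately show ?thesis by simp
  qed
  moreover have "weight_vector (vector_weight n (Suc a)) (basis (Suc a))"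
  proof -
    have "weight_vector (\<lambda>j. vector_weight n a j + gen_wt n j (F k)) (basis (Suc a))"
      unfolding b using k by (intro weight_vector_gen[OF w]) simp
    then show ?thesis
      using vector_weight_Suc[OF a] by (simp add: weight_vector_def k_def)
  qed
  moreover have "act_word [E i] (basis (Suc a)) = (if i = k then scl M (if Suc a = n + 1 then - 1 else 1) (basis a) else 0)"
    if i: "i \<in> {1..n}" for i
  proof -
    have E: "act_word [E i] (basis a) = (if a \<ge> 1 \<and> i = vector_index n (a - 1)
       then scl M (if a = n + 1 then - 1 else 1) (basis (a - 1)) else 0)"
      using ok i by (simp add: basis_ok_def)
    \<comment> \<open>\<open>F k\<close> after \<open>E i\<close> returns to \<open>basis a\<close>
      only if the roots before and after \<open>basis a\<close> in the chain coincide, which happens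
      at \<open>a = n\<close> alone.\<close>
    have FE: "act_word [F k] (act_word [E i] (basis a)) = (if i = k \<and> a = n then basis a else 0)"
    proof (cases "a \<ge> 1 \<and> i = vector_index n (a - 1)")
      case True
      have "act_word [F k] (basis (a - 1)) = (if a = n then basis a else 0)"
      proof (cases "a = n")
        case True
        then have "k = vector_index n (a - 1)" using vector_index_eq[OF a] n by (simp add: k_def)
        then show ?thesis using True n basis.simps(2)[of "a - 1"] by simp
      next
        case False
        then show ?thesis using F(1)[OF k] True vector_index_eq[OF a] by (auto simp: k_def)
      qed
      moreover have "i = k" if "a = n" using True that vector_index_eq[OF a] by (simp add: k_def)
      ultimately show ?thesis
        unfolding E using True F(2) k by (auto simp: act_scale word_closed)
    next
      case False
      moreover have "\<not> (i = k \<and> a = n)" using False vector_index_eq[OF a] n by (auto simp: k_def)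
      ultimately show ?thesis unfolding E if_not_P[OF False] using k by (auto simp: act_zero word_closed)
    qed
    show ?thesis
      unfolding b act_E_F_weight[OF w i k] FE using vector_weight_one[OF a] kn
      by (auto simp: k_def[symmetric])
  qed
  ultimately show ?thesis by (simp add: basis_ok_def k_def)
qed

lemma basis_ok_0: "basis_ok 0"
  using v Ev Kv n part_space by (auto simp: basis_ok_def weight_vector_def)

text \<open>For \<open>i\<close> other than the next root of the chain, \<open>F i\<close> applied
  to \<open>basis a\<close> is annihilated by every \<open>E j\<close> and has height below
  \<open>n\<close>, hence vanishes by \<open>primitive_vector_zero\<close>. The next basis vector
  depends on this vanishing, so both claims are proved together.\<close>

lemma basis_properties:
  assumes "a \<le> 2 * n"
  shows "basis_ok a \<and> (\<forall>i\<in>{1..n}. i \<noteq> vector_index n a \<longrightarrow> act_word [F i] (basis a) = 0)"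
  using assms
proof (induction a rule: less_induct)
  case (less a)
  have ok: "basis_ok a"
  proof (cases a)
    case 0
    then show ?thesis using basis_ok_0 by simp
  next
    case (Suc c)
    have "basis (c - 1) \<in> space_of M" if "c \<ge> 1"
      using less.IH[of "c - 1"] less.prems Suc that part_space unfolding basis_ok_def by fastforce
    then have "basis_ok (Suc c)"
      using less.IH[of c] less.IH[of "c - 1"] less.prems Suc by (intro basis_step) auto
    then show ?thesis using Suc by simp
  qed
  then have 123: "basis a \<in> part M (of_bool (a = n))" "weight_vector (vector_weight n a) (basis a)"
    "\<And>i. i \<in> {1..n} \<Longrightarrow> act_word [E i] (basis a) = (if a \<ge> 1 \<and> i = vector_index n (a - 1)
       then scl M (if a = n + 1 then - 1 else 1) (basis (a - 1)) else 0)"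
    unfolding basis_ok_def by blast+
  have a: "basis a \<in> space_of M" using 123(1) part_space by blast
  have prev: "act_word [F i] (basis (a - 1)) = (if i = vector_index n (a - 1) then basis a else 0)"
    if "a \<ge> 1" "i \<in> {1..n}" for i
    using less.IH[of "a - 1"] less.prems that by (cases a) auto
  have 4: "act_word [F i] (basis a) = 0" if i: "i \<in> {1..n}" "i \<noteq> vector_index n a" for i
  proof (rule primitive_vector_zero)
    let ?\<kappa> = "\<lambda>j. vector_weight n a j + - ip n (simple_root n j) (simple_root n i)"
    show "act_word [F i] (basis a) \<in> part M (word_parity n [F i] + of_bool (a = n))"
      using i 123(1) by (intro act_word_part) auto
    show "weight_vector ?\<kappa> (act_word [F i] (basis a))"
      using weight_vector_gen[OF 123(2), of "F i"] i by simp
    show "height n ?\<kappa> < int n"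
      unfolding height_add height_uminus height_simple_root[OF i(1)] using height_vector_weight[OF n less.prems] by simp
    show "act_word [E j] (act_word [F i] (basis a)) = 0" if j: "j \<in> {1..n}" for j
    proof (cases "a \<ge> 1 \<and> j = vector_index n (a - 1)")
      case False
      have "vector_weight n a i = 0" if "i = j"
        using vector_weight_zero[OF i less.prems] False that by auto
      moreover have "act_word [E j] (basis a) = 0"
        using 123(3)[OF j] False by (simp only: if_False)
      ultimately show ?thesis
        unfolding act_E_F_weight[OF 123(2) j i(1)] using i(1) by (auto simp: act_zero word_closed)
    next
      case True
      then have a1: "a \<ge> 1" and jv: "j = vector_index n (a - 1)" by auto
      let ?c = "if a = n + 1 then - 1 else 1 :: complex"
      have E: "act_word [E j] (basis a) = scl M ?c (basis (a - 1))"
        using 123(3)[OF j] True by (simp del: One_nat_def)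
      have b: "basis (a - 1) \<in> space_of M"
        using less.IH[of "a - 1"] a1 less.prems part_space unfolding basis_ok_def by fastforce
      have FE: "act_word [F i] (act_word [E j] (basis a)) = (if i = j then scl M ?c (basis a) else 0)"
        unfolding E using prev[OF a1 i(1)] jv i(1) b by (simp add: act_scale word_closed del: One_nat_def)
      \<comment> \<open>For \<open>i = j\<close> the term with \<open>F i\<close> after
        \<open>E i\<close> and the scalar \<open>qint (- 1)\<close> cancel.\<close>
      have "sgn2 (of_bool (i = n)) (of_bool (i = n)) * ?c = 1" "vector_weight n a i = - 1" if "i = j"
        using vector_weight_minus_one[OF i less.prems a1] that jv by auto
      then show ?thesis
        unfolding act_E_F_weight[OF 123(2) j i(1)] FE by auto
    qed
  qed
  show ?case using ok 4 by blast
qed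

end

lemma vector_weight_pred:
  assumes "c \<ge> 1" "c \<le> 2 * n"
  shows "vector_weight n c (vector_index n (c - 1)) = (if c = n then 0 else - 1)"
  using assms by (auto simp: vector_index_def vector_weight_def split: if_splits)

lemma vector_weight_reflect:
  assumes "a \<le> 2 * n" "i \<in> {1..n}"
  shows "vector_weight n (2 * n - a) i = - vector_weight n a i"
proof -
  obtain b where b: "a + b = 2 * n" using assms(1) le_iff_add by metis
  have "i = b + 1 \<longleftrightarrow> i + a = 2 * n + 1" "i + b = 2 * n \<longleftrightarrow> i = a" "i = b \<longleftrightarrow> i + a = 2 * n"
      "i + b = 2 * n + 1 \<longleftrightarrow> i = a + 1"
    using b by auto
  moreover have "2 * n - a = b" using b by simp
  ultimately show ?thesis by (simp add: vector_weight_def)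
qed

lemma vector_index_reflect:
  assumes "a < 2 * n"
  shows "vector_index n (2 * n - Suc a) = vector_index n a"
  using assms by (auto simp: vector_index_def)

context highest_weight_module
begin

lemma
  assumes "a \<le> 2 * n"
  shows basis_part: "basis a \<in> part M (of_bool (a = n))"
    and basis_space: "basis a \<in> space_of M"
    and basis_K: "i \<in> {1..n} \<Longrightarrow> act_word [K i] (basis a) = scl M (q powi vector_weight n a i) (basis a)"
    and basis_Kinv: "i \<in> {1..n} \<Longrightarrow> act_word [Kinv i] (basis a) = scl M (q powi - vector_weight n a i) (basis a)"
    and basis_E: "i \<in> {1..n} \<Longrightarrow> act_word [E i] (basis a) = (if a \<ge> 1 \<and> i = vector_index n (a - 1)
       then scl M (if a = n + 1 then - 1 else 1) (basis (a - 1)) else 0)"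
    and basis_F: "i \<in> {1..n} \<Longrightarrow> act_word [F i] (basis a) = (if i = vector_index n a then basis (Suc a) else 0)"
  using basis_properties[OF assms] part_space weight_vector_Kinv[of "vector_weight n a" "basis a" i]
  unfolding basis_ok_def weight_vector_def by auto

text \<open>The span of the chain is stable under all generators and contains \<open>v\<close>;
  irreducibility makes it the whole module.\<close>

lemma part_basis: "part M p = V.span {basis a | a. a \<le> 2 * n \<and> of_bool (a = n) = p}"
proof -
  define B where "B p = {basis a | a. a \<le> 2 * n \<and> of_bool (a = n) = p}" for p :: bit
  have B: "B p \<subseteq> part M p" for p
    unfolding B_def using basis_part by blast
  have base: "basis a \<in> V.span (B p)" if "a \<le> 2 * n" "p = of_bool (a = n)" for a p
    using that by (intro V.span_base) (auto simp: B_def)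
  have "(\<lambda>p. V.span (B p)) = part M"
  proof (rule irreducible_submodule)
    show "V.span (B p) \<subseteq> part M p" for p
      using B by (intro V.span_minimal part_subspace)
    show "basis 0 \<in> V.span (B 0)" using n by (intro base) auto
    show "basis 0 \<noteq> 0" using v by simp
    show "act_word [g] m \<in> V.span (B (gen_parity n g + p))"
      if g: "gen_index g \<in> {1..n}" and m: "m \<in> V.span (B p)" for g p m
    proof (rule act_span[OF word_closed m])
      show "okw n [g]" using g by simp
      show "V.subspace (V.span (B (gen_parity n g + p)))" by simp
      fix s
      assume "s \<in> B p"
      then obtain a where a: "s = basis a" "a \<le> 2 * n" "p = of_bool (a = n)" by (auto simp: B_def)
      have "act_word [g] (basis a) \<in> V.span (B (gen_parity n g + of_bool (a = n)))"
      proof (cases g)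
        case (K i)
        then show ?thesis using g a by (simp add: basis_K base V.span_scale)
      next
        case (Kinv i)
        then show ?thesis using g a by (simp add: basis_Kinv base V.span_scale)
      next
        case (E i)
        then have i: "i \<in> {1..n}" using g by simp
        show ?thesis
        proof (cases "a \<ge> 1 \<and> i = vector_index n (a - 1)")
          case True
          have "gen_parity n (E i) + of_bool (a = n) = of_bool (a - 1 = n)"
            using True a(2) by (auto simp: vector_index_def split: if_splits)
          then have "basis (a - 1) \<in> V.span (B (gen_parity n g + of_bool (a = n)))"
            using a(2) E by (intro base) auto
          then show ?thesis
            unfolding E basis_E[OF a(2) i] if_P[OF True] by (rule V.span_scale)
        next
          case False
          show ?thesis
            unfolding E basis_E[OF a(2) i] if_not_P[OF False] by (rule V.span_zero)
        qed
      next
        case (F i)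
        show ?thesis
        proof (cases "i = vector_index n a")
          case True
          then have a2: "Suc a \<le> 2 * n" using g a(2) F by (auto simp: vector_index_def split: if_splits)
          have "gen_parity n (F i) + of_bool (a = n) = of_bool (Suc a = n)"
            using True a2 by (auto simp: vector_index_def split: if_splits)
          then have "basis (Suc a) \<in> V.span (B (gen_parity n g + of_bool (a = n)))"
            using a2 F by (intro base) auto
          then show ?thesis using basis_F[OF a(2), of i] True g F by simp
        next
          case False
          then show ?thesis
            using basis_F[OF a(2), of i] g F by (simp add: V.span_zero)
        qed
      qed
      then show "s \<in> space_of M \<and> act M (cls n q (mon [g])) s \<in> V.span (B (gen_parity n g + p))"
        using a basis_space by simp
    qed
  qed auto
  then show ?thesis unfolding B_def by (simp add: fun_eq_iff)
qed

lemma space_basis: "space_of M = V.span (basis ` {..2 * n})"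
proof
  have "part M p \<subseteq> V.span (basis ` {..2 * n})" for p
    unfolding part_basis by (intro V.span_mono) auto
  then show "space_of M \<subseteq> V.span (basis ` {..2 * n})"
    by (auto simp: space_of_def intro!: V.span_add)
  show "V.span (basis ` {..2 * n}) \<subseteq> space_of M"
    using basis_space by (intro V.span_minimal space_subspace) auto
qed

end

section \<open>Matrix elements in the explicit basis, and self-duality\<close>

locale vector_representation = highest_weight_module n q M v for n q and M :: "('m::ab_group_add) smod" and v +
  assumes dim: "V.dim (space_of M) = 2 * n + 1"
begin

text \<open>A spanning family of \<open>2 * n + 1\<close> vectors in dimension
  \<open>2 * n + 1\<close> has no repetition and no redundant member.\<close>

lemma basis_independent: "V.independent (basis ` {..2 * n})" "inj_on basis {..2 * n}"
proof -
  let ?B = "basis ` {..2 * n}"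
  have "V.dim (space_of M) \<le> card ?B"
    by (rule V.dim_le_card) (simp_all add: space_basis)
  moreover have "card ?B \<le> 2 * n + 1"
    using card_image_le[of "{..2 * n}" basis] by simp
  ultimately have card: "card ?B = 2 * n + 1" using dim by simp
  then show "inj_on basis {..2 * n}" by (intro eq_card_imp_inj_on) auto
  show "V.independent ?B"
  proof
    assume "V.dependent ?B"
    then obtain b where b: "b \<in> ?B" "b \<in> V.span (?B - {b})" by (auto simp: V.dependent_def)
    then have "V.span (?B - {b}) = V.span ?B"
      using V.span_redundant[of b "?B - {b}"] by (simp add: insert_absorb)
    then have "V.dim (space_of M) \<le> card (?B - {b})"
      by (intro V.dim_le_card) (simp_all add: space_basis)
    then show False using card b(1) dim by simp
  qed
qed

text \<open>A functional on the whole ambient type, as \<open>matrix_elements\<close> demands;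
  outside the module its values are an arbitrary linear choice.\<close>

definition coord :: "nat \<Rightarrow> 'm \<Rightarrow> complex" where
  "coord a = (SOME l. module_hom (scl M) (*) l \<and> (\<forall>c\<le>2 * n. l (basis c) = of_bool (a = c)))"

lemma coord:
  shows coord_hom: "module_hom (scl M) (*) (coord a)"
    and coord_basis: "c \<le> 2 * n \<Longrightarrow> coord a (basis c) = of_bool (a = c)"
proof -
  interpret vector_space_pair "scl M" "(*) :: complex \<Rightarrow> complex \<Rightarrow> complex"
    by (intro vector_space_pair.intro V.vector_space_axioms, standard) (auto simp: algebra_simps)
  obtain g where g: "module_hom (scl M) (*) g"
      "\<forall>x\<in>basis ` {..2 * n}. g x = of_bool (a = inv_into {..2 * n} basis x)"
    using linear_independent_extend[OF basis_independent(1), of "\<lambda>x. of_bool (a = inv_into {..2 * n} basis x)"]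
    by (auto simp: module_hom_iff_linear)
  have "module_hom (scl M) (*) g \<and> (\<forall>c\<le>2 * n. g (basis c) = of_bool (a = c))"
    using g basis_independent(2) by (auto simp: inv_into_f_f)
  then have "module_hom (scl M) (*) (coord a) \<and> (\<forall>c\<le>2 * n. coord a (basis c) = of_bool (a = c))"
    unfolding coord_def
    by (rule someI[where P = "\<lambda>l. module_hom (scl M) (*) l \<and> (\<forall>c\<le>2 * n. l (basis c) = of_bool (a = c))"])
  then show "module_hom (scl M) (*) (coord a)" "c \<le> 2 * n \<Longrightarrow> coord a (basis c) = of_bool (a = c)" by auto
qed

lemma coord_add: "coord a (m + m') = coord a m + coord a m'"
  and coord_scale: "coord a (scl M c m) = c * coord a m"
  and coord_zero: "coord a 0 = 0"
  using module_hom.add[OF coord_hom] module_hom.scale[OF coord_hom] module_hom.zero[OF coord_hom] by auto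

lemma basis_expansion:
  assumes "m \<in> space_of M"
  shows "m = (\<Sum>a\<le>2 * n. scl M (coord a m) (basis a))"
  using assms unfolding space_basis
proof (induction rule: V.span_induct_alt)
  case base
  then show ?case by (simp add: coord_zero)
next
  case (step c x y)
  then obtain b where b: "x = basis b" "b \<le> 2 * n" by auto
  have "(\<Sum>a\<le>2 * n. scl M (coord a x) (basis a)) = (\<Sum>a\<le>2 * n. if a = b then basis a else 0)"
    using b by (intro sum.cong) (auto simp: coord_basis)
  then have "(\<Sum>a\<le>2 * n. scl M (coord a x) (basis a)) = x" using b by simp
  then have "(\<Sum>a\<le>2 * n. scl M (coord a (scl M c x + y)) (basis a)) = scl M c x
      + (\<Sum>a\<le>2 * n. scl M (coord a y) (basis a))"
    by (simp add: coord_add coord_scale V.scale_left_distrib sum.distrib flip: V.scale_sum_right V.scale_scale)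
  then show ?case using step.IH by simp
qed

definition mat :: "nat \<Rightarrow> nat \<Rightarrow> gen list \<Rightarrow> complex" where
  "mat a c w = coord a (act_word w (basis c))"

lemma mat_append:
  assumes "okw n u" "okw n w" "c \<le> 2 * n"
  shows "mat a c (u @ w) = (\<Sum>b\<le>2 * n. mat a b u * mat b c w)"
proof -
  have s: "act_word w (basis c) \<in> space_of M"
    using assms basis_space by (intro act_word_closed) auto
  have sum: "act_word u (\<Sum>b\<in>A. scl M (d b) (basis b)) = (\<Sum>b\<in>A. scl M (d b) (act_word u (basis b)))"
    if "A \<subseteq> {..2 * n}" for A d
  proof -
    have "finite A" using that finite_subset by blast
    then have "act_word u (\<Sum>b\<in>A. scl M (d b) (basis b)) = (\<Sum>b\<in>A. scl M (d b) (act_word u (basis b)))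
        \<and> (\<Sum>b\<in>A. scl M (d b) (basis b)) \<in> space_of M"
      using that
    proof (induction A)
      case empty
      then show ?case using assms by (simp add: act_zero word_closed V.subspace_0 space_subspace)
    next
      case (insert b A)
      have "scl M (d b) (basis b) \<in> space_of M" "basis b \<in> space_of M"
        using insert.prems basis_space V.subspace_scale[OF space_subspace] by auto
      then show ?case
        using insert assms V.subspace_add[OF space_subspace]
        by (simp add: act_add act_scale word_closed)
    qed
    then show ?thesis ..
  qed
  have "act_word (u @ w) (basis c) = act_word u (\<Sum>b\<le>2 * n. scl M (mat b c w) (basis b))"
    using assms basis_space act_word_append[OF assms(1,2)] basis_expansion[OF s] by (simp add: mat_def)
  also have "\<dots> = (\<Sum>b\<le>2 * n. scl M (mat b c w) (act_word u (basis b)))"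
    by (rule sum) simp
  finally show ?thesis
    by (simp add: mat_def[of _ _ "_ @ _"] module_hom.sum[OF coord_hom] coord_scale mult.commute)
      (simp add: mat_def mult.commute)
qed

lemma mat_parity:
  assumes "okw n w" "a \<le> 2 * n" "c \<le> 2 * n" "mat a c w \<noteq> 0"
  shows "word_parity n w = of_bool (a = n) + of_bool (c = n)"
proof (rule ccontr)
  assume *: "\<not> ?thesis"
  have "act_word w (basis c) \<in> part M (word_parity n w + of_bool (c = n))"
    using assms basis_part by (intro act_word_part) auto
  then have m: "act_word w (basis c) \<in> V.span {basis b | b. b \<le> 2 * n \<and> of_bool (b = n) = word_parity n w + of_bool (c = n)}"
    by (simp only: part_basis)
  have "of_bool (a = n) \<noteq> word_parity n w + of_bool (c = n)"
    using * by (metis bit_add_self(2) add.commute)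
  then have "coord a b = 0" if "b \<in> {basis b | b. b \<le> 2 * n \<and> of_bool (b = n) = word_parity n w + of_bool (c = n)}" for b
    using that coord_basis by auto
  then have "coord a (act_word w (basis c)) = 0"
    using module_hom.eq_0_on_span[OF coord_hom _ m] by blast
  then show False using assms(4) by (simp add: mat_def)
qed

lemma mat_gen:
  assumes "c \<le> 2 * n" "i \<in> {1..n}"
  shows "mat a c [K i] = of_bool (a = c) * q powi vector_weight n c i"
    and "mat a c [Kinv i] = of_bool (a = c) * q powi - vector_weight n c i"
    and "mat a c [E i] = (if c \<ge> 1 \<and> i = vector_index n (c - 1) \<and> a = c - 1 then if c = n + 1 then - 1 else 1 else 0)"
    and "mat a c [F i] = (if i = vector_index n c \<and> a = Suc c then 1 else 0)"
proof -
  show "mat a c [K i] = of_bool (a = c) * q powi vector_weight n c i"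
    and "mat a c [Kinv i] = of_bool (a = c) * q powi - vector_weight n c i"
    using assms by (auto simp: mat_def basis_K basis_Kinv coord_scale coord_basis)
  show "mat a c [E i] = (if c \<ge> 1 \<and> i = vector_index n (c - 1) \<and> a = c - 1 then if c = n + 1 then - 1 else 1 else 0)"
    using assms coord_basis[of "c - 1" a] unfolding mat_def basis_E[OF assms]
    by (auto simp: coord_scale coord_zero)
  have "Suc c \<le> 2 * n" if "i = vector_index n c"
    using that assms by (auto simp: vector_index_def split: if_splits)
  then show "mat a c [F i] = (if i = vector_index n c \<and> a = Suc c then 1 else 0)"
    using coord_basis[of "Suc c" a] unfolding mat_def basis_F[OF assms] by (auto simp: coord_zero)
qed

text \<open>Rescaling factors for the dual basis. The ratio of neighbours is read off by comparing
  the entry of \<open>S(E i)\<close> in row \<open>a\<close> and column \<open>Suc a\<close> with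
  the reflected entry of \<open>E i\<close>: it carries the weight factor \<open>q\<close>, except
  at \<open>Suc a = n\<close>, where the column has weight 0.\<close>

primrec theta :: "nat \<Rightarrow> complex" where
  "theta 0 = 1"
| "theta (Suc a) = theta a * (if Suc a = n then 1 else - q)"

lemma theta_nonzero: "theta a \<noteq> 0"
  by (induction a) (auto simp: q_nonzero)

text \<open>The isomorphism of \<open>M\<close> with its dual, in coordinates.\<close>

definition eta :: "nat \<Rightarrow> nat \<Rightarrow> complex" where
  "eta a c = (if a = n \<and> c \<noteq> n then - 1 else 1) * theta c / theta a"

text \<open>The sign in \<open>eta\<close> is chosen so that \<open>eta\<close> is multiplicative up
  to the sign of a graded reversal, the parities being those of the matrix entries at
  \<open>(b, c)\<close> and \<open>(a, b)\<close>.\<close>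

lemma eta_mult:
  "sgn2 (of_bool (b = n) + of_bool (c = n)) (of_bool (a = n) + of_bool (b = n)) * (eta a b * eta b c) = eta a c"
  using theta_nonzero by (auto simp: eta_def)

text \<open>The reflection \<open>a \<mapsto> 2 * n - a\<close> negates the weights and reverses the
  chain, whose step labels form a palindrome. So \<open>S\<close> acts on entries as transposition
  along the antidiagonal, up to the scalars \<open>eta\<close>.\<close>

lemma mat_antipode_gen:
  assumes "a \<le> 2 * n" "c \<le> 2 * n" "gen_index g \<in> {1..n}"
  shows "ev (mat a c) (antipode_gen g) = eta a c * mat (2 * n - c) (2 * n - a) [g]"
proof (cases g)
  case (K i)
  have "2 * n - c = 2 * n - a \<longleftrightarrow> a = c" using assms by auto
  then show ?thesis
    using K assms vector_weight_reflect[OF assms(1), of i] theta_nonzero by (auto simp: mat_gen eta_def)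
next
  case (Kinv i)
  have "2 * n - c = 2 * n - a \<longleftrightarrow> a = c" using assms by auto
  then show ?thesis
    using Kinv assms vector_weight_reflect[OF assms(1), of i] theta_nonzero by (auto simp: mat_gen eta_def)
next
  case (E i)
  then have i: "i \<in> {1..n}" using assms(3) by simp
  have "mat a c ([E i] @ [Kinv i]) = (\<Sum>b\<le>2 * n. mat a b [E i] * mat b c [Kinv i])"
    using i assms by (intro mat_append) auto
  also have "\<dots> = (\<Sum>b\<le>2 * n. if b = c then mat a c [E i] * q powi - vector_weight n c i else 0)"
    using i assms(2) by (intro sum.cong) (auto simp: mat_gen(2))
  finally have 1: "ev (mat a c) (antipode_gen g) = - (mat a c [E i] * q powi - vector_weight n c i)"
    using assms(2) by (simp add: E mon_mult)
  have iff: "2 * n - a \<ge> 1 \<and> i = vector_index n (2 * n - a - 1) \<and> 2 * n - c = 2 * n - a - 1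
      \<longleftrightarrow> c \<ge> 1 \<and> i = vector_index n (c - 1) \<and> a = c - 1"
  proof (cases "c \<ge> 1 \<and> a = c - 1")
    case True
    then have "a < 2 * n" using assms by auto
    then show ?thesis using vector_index_reflect[of a] True by auto
  next
    case False
    then show ?thesis using assms by auto
  qed
  have 2: "mat (2 * n - c) (2 * n - a) [E i]
      = (if c \<ge> 1 \<and> i = vector_index n (c - 1) \<and> a = c - 1 then if c = n then - 1 else 1 else 0)"
  proof -
    have "2 * n - a = n + 1 \<longleftrightarrow> c = n" if "c \<ge> 1" "a = c - 1" using that assms n by auto
    then show ?thesis
      using mat_gen(3)[of "2 * n - a" i "2 * n - c"] i unfolding iff by auto
  qed
  show ?thesis
  proof (cases "c \<ge> 1 \<and> i = vector_index n (c - 1) \<and> a = c - 1")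
    case True
    then have vw: "vector_weight n c i = (if c = n then 0 else - 1)" and c: "c = Suc a"
      using vector_weight_pred[of c n] assms by auto
    show ?thesis
      unfolding 1 unfolding E 2 mat_gen(3)[OF assms(2) i] if_P[OF True] vw
      using theta_nonzero[of a] by (simp add: eta_def c)
  next
    case False
    show ?thesis unfolding 1 unfolding E 2 mat_gen(3)[OF assms(2) i] if_not_P[OF False] by simp
  qed
next
  case (F i)
  then have i: "i \<in> {1..n}" using assms(3) by simp
  have "mat a c ([K i] @ [F i]) = (\<Sum>b\<le>2 * n. mat a b [K i] * mat b c [F i])"
    using i assms by (intro mat_append) auto
  also have "\<dots> = (\<Sum>b\<le>2 * n. if b = a then q powi vector_weight n a i * mat a c [F i] else 0)"
    using i by (intro sum.cong) (auto simp: mat_gen(1))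
  finally have 1: "ev (mat a c) (antipode_gen g) = - (q powi vector_weight n a i * mat a c [F i])"
    using assms(1) by (simp add: F mon_mult)
  have iff: "i = vector_index n (2 * n - a) \<and> 2 * n - c = Suc (2 * n - a) \<longleftrightarrow> i = vector_index n c \<and> a = Suc c"
  proof (cases "a = Suc c")
    case True
    then have "c < 2 * n" using assms by auto
    then show ?thesis using vector_index_reflect[of c] True by auto
  next
    case False
    then show ?thesis using assms by auto
  qed
  have 2: "mat (2 * n - c) (2 * n - a) [F i] = (if i = vector_index n c \<and> a = Suc c then 1 else 0)"
    using mat_gen(4)[of "2 * n - a" i "2 * n - c"] i unfolding iff by auto
  show ?thesis
  proof (cases "i = vector_index n c \<and> a = Suc c")
    case True
    then have vw: "vector_weight n a i = (if a = n then 0 else - 1)" and a: "a = Suc c"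
      using vector_weight_pred[of a n] assms by auto
    show ?thesis
      unfolding 1 unfolding F 2 mat_gen(4)[OF assms(2) i] if_P[OF True] vw
      using theta_nonzero[of c] q_nonzero by (simp add: eta_def a field_simps)
  next
    case False
    show ?thesis unfolding 1 unfolding F 2 mat_gen(4)[OF assms(2) i] if_not_P[OF False] by simp
  qed
qed

text \<open>Self-duality of the vector representation. Letters are combined by matrix
  multiplication, whose order \<open>S\<close> reverses, and \<open>eta_mult\<close> accounts for
  the signs.\<close>

lemma anti_mat:
  assumes "okw n w" "a \<le> 2 * n" "c \<le> 2 * n"
  shows "anti (mat a c) w = eta a c * mat (2 * n - c) (2 * n - a) w"
  using assms
proof (induction w arbitrary: c)
  case Nil
  have "2 * n - c = 2 * n - a \<longleftrightarrow> a = c" using Nil by auto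
  then show ?case
    using Nil basis_space theta_nonzero[of a]
    by (auto simp: anti_simps mat_def act_word_Nil coord_basis eta_def)
next
  case (Cons g w)
  have g: "gen_index g \<in> {1..n}" and w: "okw n w" using Cons.prems by auto
  let ?r = "\<lambda>b. 2 * n - b"
  have "anti (mat a c) (g # w) = sgn2 (gen_parity n g) (word_parity n w)
      * anti (\<lambda>u. ev (\<lambda>v. mat a c (u @ v)) (antipode_gen g)) w"
    by (simp add: anti_def ev_mult)
  also have "anti (\<lambda>u. ev (\<lambda>v. mat a c (u @ v)) (antipode_gen g)) w
      = anti (\<lambda>u. \<Sum>b\<le>2 * n. ev (mat b c) (antipode_gen g) * mat a b u) w"
  proof (rule anti_cong[OF w])
    fix u
    assume u: "okw n u"
    have "ev (\<lambda>v. mat a c (u @ v)) (antipode_gen g)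
        = ev (\<lambda>v. \<Sum>b\<le>2 * n. mat a b u * mat b c v) (antipode_gen g)"
      using u Cons.prems by (intro ev_cong[OF antipode_gen_closed[OF g]] mat_append) auto
    then show "ev (\<lambda>v. mat a c (u @ v)) (antipode_gen g) = (\<Sum>b\<le>2 * n. ev (mat b c) (antipode_gen g) * mat a b u)"
      by (simp add: ev_fun_sum ev_fun_scale) (simp add: mult.commute)
  qed
  also have "\<dots> = (\<Sum>b\<le>2 * n. ev (mat b c) (antipode_gen g) * anti (mat a b) w)"
    by (simp add: anti_def ev_fun_sum ev_fun_scale)
  also have "\<dots> = (\<Sum>b\<le>2 * n. (eta b c * mat (?r c) (?r b) [g]) * (eta a b * mat (?r b) (?r a) w))"
    using Cons mat_antipode_gen[OF _ _ g] by (intro sum.cong refl arg_cong2[where f = "(*)"]) auto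
  also have "sgn2 (gen_parity n g) (word_parity n w) * \<dots>
      = (\<Sum>b\<le>2 * n. eta a c * (mat (?r c) (?r b) [g] * mat (?r b) (?r a) w))"
    unfolding sum_distrib_left
  proof (intro sum.cong refl)
    fix b
    assume b: "b \<in> {..2 * n}"
    show "sgn2 (gen_parity n g) (word_parity n w)
        * (eta b c * mat (?r c) (?r b) [g] * (eta a b * mat (?r b) (?r a) w))
      = eta a c * (mat (?r c) (?r b) [g] * mat (?r b) (?r a) w)"
    proof (cases "mat (?r c) (?r b) [g] = 0 \<or> mat (?r b) (?r a) w = 0")
      case True
      then show ?thesis by auto
    next
      case False
      have r: "2 * n - d = n \<longleftrightarrow> d = n" if "d \<le> 2 * n" for d using that by auto
      \<comment> \<open>The sign depends on the parities of \<open>g\<close> and \<open>w\<close>;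
        where both entries are nonzero, \<open>mat_parity\<close> expresses these through the
        indices.\<close>
      have pg: "gen_parity n g = of_bool (b = n) + of_bool (c = n)"
        using mat_parity[of "[g]" "?r c" "?r b"] False g b Cons.prems(3) r by (simp add: add.commute)
      have pw: "word_parity n w = of_bool (a = n) + of_bool (b = n)"
        using mat_parity[of w "?r b" "?r a"] False w b Cons.prems(2) r by (simp add: add.commute)
      show ?thesis
        unfolding pg pw eta_mult[of b c a, symmetric] by (simp only: mult_ac)
    qed
  qed
  also have "\<dots> = eta a c * (\<Sum>b\<le>2 * n. mat (?r c) (?r b) [g] * mat (?r b) (?r a) w)"
    by (simp add: sum_distrib_left)
  also have "(\<Sum>b\<le>2 * n. mat (?r c) (?r b) [g] * mat (?r b) (?r a) w)
      = (\<Sum>b\<le>2 * n. mat (?r c) b [g] * mat b (?r a) w)"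
    by (rule sum.reindex_bij_witness[of _ ?r ?r]) auto
  also have "\<dots> = mat (?r c) (?r a) ([g] @ w)"
    using g w by (intro mat_append[symmetric]) auto
  finally show ?case by simp
qed

end

section \<open>Functions on the quantum supergroup\<close>

lemma ext_cong:
  assumes "\<And>w. okw n w \<Longrightarrow> f w = g w"
  shows "ext n q f = ext n q g"
  using assms by (auto simp: ext_def on_Uq_def fun_eq_iff intro!: ev_cong[OF rep_closed])

lemma ext_add: "ext n q (\<lambda>w. f w + g w) = ext n q f + ext n q g"
  by (auto simp: ext_def on_Uq_def fun_eq_iff ev_fun_add)

lemma ext_scale: "ext n q (\<lambda>w. c * f w) = (\<lambda>x. c * ext n q f x)"
  by (auto simp: ext_def on_Uq_def fun_eq_iff ev_fun_scale)

lemma fmult_eq: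
  "fmult n q f g = ext n q (quantum_osp.coprod n (\<lambda>u v.
     sgn2 (word_parity n v) (word_parity n u) * wf n q f u * wf n q g v))" if "q \<noteq> 0"
proof -
  interpret quantum_osp n q using that by unfold_locales
  have "ev (\<lambda>w. coprod B w) a = ev (\<lambda>(u, v). B u v) (free_coproduct n a)" for B a
    by (simp add: free_coproduct_def ev_lin_ext coprod_def)
  then show ?thesis
    by (simp add: fmult_def ext_def) (simp add: ev_def wf_def case_prod_unfold mult_ac on_Uq_def fun_eq_iff)
qed

lemma (in vector_representation) matrix_element_word:
  assumes w: "okw n w" and m: "m \<in> space_of M" and l: "module_hom (scl M) (*) l"
  shows "l (act_word w m) = (\<Sum>a\<le>2 * n. \<Sum>c\<le>2 * n. (l (basis a) * coord c m) * mat a c w)"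
proof -
  interpret l: module_hom "scl M" "(*)" l by fact
  have sub: "(\<Sum>c\<in>A. scl M (coord c m) (basis c)) \<in> space_of M \<and>
      act_word w (\<Sum>c\<in>A. scl M (coord c m) (basis c)) = (\<Sum>c\<in>A. scl M (coord c m) (act_word w (basis c)))"
    if "finite A" "A \<subseteq> {..2 * n}" for A
    using that
  proof (induction A)
    case empty
    then show ?case using w by (simp add: act_zero word_closed V.subspace_0 space_subspace)
  next
    case (insert c A)
    then have "basis c \<in> space_of M" using basis_space by auto
    then show ?case
      using insert w V.subspace_scale[OF space_subspace] V.subspace_add[OF space_subspace]
      by (simp add: act_add act_scale word_closed)
  qed
  have "act_word w m = (\<Sum>c\<le>2 * n. scl M (coord c m) (act_word w (basis c)))"
    using sub[of "{..2 * n}"] basis_expansion[OF m] by simp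
  also have "\<dots> = (\<Sum>c\<le>2 * n. scl M (coord c m) (\<Sum>a\<le>2 * n. scl M (mat a c w) (basis a)))"
    using basis_expansion[OF act_word_closed[OF w basis_space]] by (intro sum.cong) (auto simp: mat_def)
  finally have "l (act_word w m) = (\<Sum>c\<le>2 * n. coord c m * (\<Sum>a\<le>2 * n. mat a c w * l (basis a)))"
    by (simp only: l.sum l.scale)
  also have "\<dots> = (\<Sum>c\<le>2 * n. \<Sum>a\<le>2 * n. (l (basis a) * coord c m) * mat a c w)"
    by (simp only: sum_distrib_left mult_ac)
  also have "\<dots> = (\<Sum>a\<le>2 * n. \<Sum>c\<le>2 * n. (l (basis a) * coord c m) * mat a c w)"
    by (rule sum.swap)
  finally show ?thesis .
qed

section \<open>Stability of \<open>Tq\<close> under the parity twist and the antipode\<close>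

locale generic_osp = quantum_osp +
  assumes n_pos: "n \<ge> 1" and generic: "\<forall>m>0. q ^ m \<noteq> 1"
begin

lemma vector_repE:
  assumes "vector_rep n q M"
  obtains v where "vector_representation n q M v"
proof -
  obtain v where v: "v \<in> part M 0" "v \<noteq> 0"
      "\<And>i. i \<in> {1..n} \<Longrightarrow> act M (cls n q (gen (E i))) v = 0"
      "\<And>i. i \<in> {1..n} \<Longrightarrow> act M (cls n q (gen (K i))) v = scl M (q powi ip n (eps 1) (simple_root n i)) v"
    using assms unfolding vector_rep_def by blast
  have irr: "irreducible_module n q M" and dim: "vector_space.dim (scl M) (space_of M) = 2 * n + 1"
    using assms by (auto simp: vector_rep_def)
  have "is_module n q (carrier (Uq n q)) M" using irr by (simp add: irreducible_module_def)
  then interpret uq_module n q M by unfold_locales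
  have "ip n (eps 1) (simple_root n i) = vector_weight n 0 i" if "i \<in> {1..n}" for i
    using that n_pos by (subst ip_eps_simple_root) (auto simp: vector_weight_def)
  then have "vector_representation n q M v"
    using v irr dim n_pos generic by unfold_locales auto
  then show ?thesis by (rule that)
qed

lemma resp_counit: "resp n q (\<lambda>w. prod_list (map counit_gen w))"
proof -
  let ?f = "\<lambda>w. prod_list (map counit_gen w)"
  have "relations n q ?f"
    by (simp add: relations_def k_relations_def ef_relation_def serre_def)
  then have "relations n q (\<lambda>w. (?f u * ?f v) * ?f w)" for u v by (rule relations_scale)
  then show ?thesis by (simp add: resp_iff mult_ac)
qed

lemma counit_eq_ext: "counit n q = ext n q (\<lambda>w. prod_list (map counit_gen w))"
  by (simp add: counit_def ext_def free_counit_def ev_def)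

lemma biresp_product:
  assumes "resp n q f" "resp n q g"
  shows "biresp (\<lambda>u v. sgn2 (word_parity n v) (word_parity n u) * f u * g v)"
proof -
  have "resp n q (\<lambda>v. f a * (sgn2 (word_parity n a) (word_parity n v) * g v))"
    "resp n q (\<lambda>u. g b * (sgn2 (word_parity n b) (word_parity n u) * f u))" for a b
    using assms by (auto intro!: resp_scale resp_twist)
  then show ?thesis
    by (simp add: biresp_def mult_ac sgn2_commute[of "word_parity n (_ :: gen list)" "word_parity n _"])
qed

text \<open>Elements of \<open>Tq\<close> are a priori arbitrary functions on cosets. For products,
  linearity rests on \<open>resp_coprod\<close>, that is, on the coproduct descending to the
  quotient.\<close>

lemma Tq_linear_zero:
  assumes "f \<in> Tq n q"
  shows "linear_on_Uq n q f \<and> (\<forall>x. x \<notin> carrier (Uq n q) \<longrightarrow> f x = 0)"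
  using assms
proof induction
  case unit
  then show ?case
    unfolding counit_eq_ext by (intro conjI linear_ext[OF resp_counit]) (simp add: ext_def on_Uq_def)
next
  case (matrix M f)
  obtain v where "vector_representation n q M v" using vector_repE matrix by blast
  then interpret vector_representation n q M v .
  obtain l m where l: "m \<in> space_of M" "module_hom (scl M) (*) l" "f = on_Uq n q (\<lambda>x. l (act M x m))"
    using matrix by (auto simp: matrix_elements_def)
  interpret l: module_hom "scl M" "(*)" l by fact
  interpret ring "Uq n q" by (rule ring_Uq)
  show ?case
    using l(1) by (auto simp: l(3) linear_on_Uq_def on_Uq_def act_plus act_uscale l.add l.scale uscale_closed)
next
  case (scale f c)
  then show ?case by (auto simp: linear_on_Uq_def algebra_simps)
next
  case (add f g)
  then show ?case by (auto simp: linear_on_Uq_def algebra_simps)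
next
  case (mult f g)
  have "resp n q (coprod (\<lambda>u v. sgn2 (word_parity n v) (word_parity n u) * wf n q f u * wf n q g v))"
    using mult.IH by (intro resp_coprod biresp_product resp_wf) auto
  then show ?case
    unfolding fmult_eq[OF q_nonzero] by (intro conjI linear_ext) (simp_all add: ext_def on_Uq_def)
qed

lemma Tq_linear: "f \<in> Tq n q \<Longrightarrow> linear_on_Uq n q f"
  and Tq_outside: "f \<in> Tq n q \<Longrightarrow> x \<notin> carrier (Uq n q) \<Longrightarrow> f x = 0"
  using Tq_linear_zero by auto

lemma ext_wf_Tq: "f \<in> Tq n q \<Longrightarrow> ext n q (wf n q f) = f"
  using ext_wf[OF Tq_linear] Tq_outside by blast

lemma resp_wf_Tq: "f \<in> Tq n q \<Longrightarrow> resp n q (wf n q f)"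
  using resp_wf[OF Tq_linear] .

text \<open>\<open>Tq\<close> seen on words. Closure properties are proved here because the twist
  and the antipode are given as transposes of maps on words.\<close>

definition T_word :: "(gen list \<Rightarrow> complex) \<Rightarrow> bool" where
  "T_word f \<longleftrightarrow> resp n q f \<and> ext n q f \<in> Tq n q"

lemma T_word_wf: "f \<in> Tq n q \<Longrightarrow> T_word (wf n q f)"
  by (simp add: T_word_def resp_wf_Tq ext_wf_Tq)

lemma T_word_cong: "(\<And>w. okw n w \<Longrightarrow> f w = g w) \<Longrightarrow> T_word g \<Longrightarrow> T_word f"
  using ext_cong[of n f g q] resp_cong[of f g] by (simp add: T_word_def)

lemma T_word_add: "T_word f \<Longrightarrow> T_word g \<Longrightarrow> T_word (\<lambda>w. f w + g w)"
  by (simp add: T_word_def resp_add ext_add Tq.add)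

lemma T_word_scale: "T_word f \<Longrightarrow> T_word (\<lambda>w. c * f w)"
  by (simp add: T_word_def resp_scale ext_scale Tq.scale)

lemma T_word_zero: "T_word (\<lambda>w. 0)"
  using T_word_scale[OF T_word_wf[OF Tq.unit], of 0] by simp

lemma T_word_sum: "(\<And>i. i \<in> A \<Longrightarrow> T_word (f i)) \<Longrightarrow> T_word (\<lambda>w. \<Sum>i\<in>A. f i w)"
  by (induction A rule: infinite_finite_induct) (auto intro: T_word_zero T_word_add)

lemma T_word_mult:
  assumes "T_word f" "T_word g"
  shows "T_word (coprod (\<lambda>u v. sgn2 (word_parity n v) (word_parity n u) * f u * g v))"
proof -
  have "resp n q (coprod (\<lambda>u v. sgn2 (word_parity n v) (word_parity n u) * f u * g v))"
    using assms by (intro resp_coprod biresp_product) (auto simp: T_word_def)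
  moreover have "ext n q (coprod (\<lambda>u v. sgn2 (word_parity n v) (word_parity n u) * f u * g v))
      = fmult n q (ext n q f) (ext n q g)"
    unfolding fmult_eq[OF q_nonzero] using assms
    by (intro ext_cong coprod_cong) (auto simp: T_word_def wf_ext)
  ultimately show ?thesis
    using assms Tq.mult by (simp add: T_word_def)
qed

text \<open>Reduces an arbitrary generator of \<open>Tq\<close> to entries of explicit matrices,
  which themselves belong to \<open>Tq\<close>. The highest weight vector \<open>v\<close> depends
  on the module \<open>M\<close>, hence the existential quantifier.\<close>

lemma matrix_element_expansion:
  assumes "vector_rep n q M" "f \<in> matrix_elements n q M"
  shows "\<exists>v d. vector_representation n q M v \<and>
    (\<forall>w. okw n w \<longrightarrow> wf n q f w = (\<Sum>a\<le>2 * n. \<Sum>c\<le>2 * n. d a c * vector_representation.mat n q M v a c w)) \<and>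
    (\<forall>a c. a \<le> 2 * n \<longrightarrow> c \<le> 2 * n \<longrightarrow> T_word (vector_representation.mat n q M v a c))"
proof -
  obtain v where vr: "vector_representation n q M v" using vector_repE assms by blast
  then interpret vector_representation n q M v .
  obtain l m where l: "m \<in> space_of M" "module_hom (scl M) (*) l" "f = on_Uq n q (\<lambda>x. l (act M x m))"
    using assms(2) by (auto simp: matrix_elements_def)
  have "wf n q f w = (\<Sum>a\<le>2 * n. \<Sum>c\<le>2 * n. (l (basis a) * coord c m) * mat a c w)" if w: "okw n w" for w
    using matrix_element_word[OF w l(1,2)] w by (simp add: wf_def l(3) on_Uq_def word_closed)
  moreover have "T_word (mat a c)" if "a \<le> 2 * n" "c \<le> 2 * n" for a c
  proof -
    have "on_Uq n q (\<lambda>x. coord a (act M x (basis c))) \<in> matrix_elements n q M"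
      using that basis_space coord_hom by (auto simp: matrix_elements_def)
    then have "on_Uq n q (\<lambda>x. coord a (act M x (basis c))) \<in> Tq n q"
      using assms(1) by (intro Tq.matrix)
    then have "T_word (wf n q (on_Uq n q (\<lambda>x. coord a (act M x (basis c)))))" by (rule T_word_wf)
    then show ?thesis
      by (rule T_word_cong[rotated]) (simp add: wf_def on_Uq_def mat_def word_closed)
  qed
  ultimately show ?thesis using vr by (intro exI[of _ v] exI[of _ "\<lambda>a c. l (basis a) * coord c m"]) auto
qed

text \<open>Matrix entries are homogeneous by \<open>mat_parity\<close>, and the coproduct is even,
  so the parity automorphism preserves \<open>Tq\<close>. This yields the grading of
  \<open>Tq\<close>.\<close>

lemma T_word_twist_Tq:
  assumes "f \<in> Tq n q"
  shows "T_word (\<lambda>w. sgn2 1 (word_parity n w) * wf n q f w)"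
  using assms
proof induction
  case unit
  have eps: "sgn2 1 (word_parity n w) * prod_list (map counit_gen w) = prod_list (map counit_gen w)" for w
  proof (induction w)
    case (Cons g w)
    then show ?case by (cases g) auto
  qed simp
  have "wf n q (counit n q) w = prod_list (map counit_gen w)" if "okw n w" for w
    using wf_ext[OF resp_counit that] by (simp add: counit_eq_ext)
  then show ?case
    by (intro T_word_cong[OF _ T_word_wf[OF Tq.unit]]) (simp add: eps)
next
  case (matrix M f)
  then obtain v d where v: "vector_representation n q M v"
    and f: "\<And>w. okw n w \<Longrightarrow> wf n q f w = (\<Sum>a\<le>2 * n. \<Sum>c\<le>2 * n. d a c * vector_representation.mat n q M v a c w)"
    and T: "\<And>a c. a \<le> 2 * n \<Longrightarrow> c \<le> 2 * n \<Longrightarrow> T_word (vector_representation.mat n q M v a c)"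
    using matrix_element_expansion by blast
  interpret vector_representation n q M v by (rule v)
  have "T_word (\<lambda>w. \<Sum>a\<le>2 * n. \<Sum>c\<le>2 * n. (d a c * sgn2 1 (of_bool (a = n) + of_bool (c = n))) * mat a c w)"
    using T by (intro T_word_sum T_word_scale) auto
  moreover have "sgn2 1 (word_parity n w) * wf n q f w =
      (\<Sum>a\<le>2 * n. \<Sum>c\<le>2 * n. (d a c * sgn2 1 (of_bool (a = n) + of_bool (c = n))) * mat a c w)"
    if w: "okw n w" for w
    unfolding f[OF w] sum_distrib_left
  proof (intro sum.cong refl)
    fix a c
    assume "a \<in> {..2 * n}" "c \<in> {..2 * n}"
    then show "sgn2 1 (word_parity n w) * (d a c * mat a c w)
        = d a c * sgn2 1 (of_bool (a = n) + of_bool (c = n)) * mat a c w"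
      using mat_parity[OF w, of a c] by (cases "mat a c w = 0") auto
  qed
  ultimately show ?case by (rule T_word_cong[rotated]) auto
next
  case (scale f c)
  have "(\<lambda>w. sgn2 1 (word_parity n w) * wf n q (\<lambda>x. c * f x) w)
      = (\<lambda>w. c * (sgn2 1 (word_parity n w) * wf n q f w))"
    by (simp add: wf_def mult_ac)
  then show ?case using T_word_scale[OF scale.IH] by simp
next
  case (add f g)
  have *: "(\<lambda>w. sgn2 1 (word_parity n w) * wf n q (f + g) w)
      = (\<lambda>w. sgn2 1 (word_parity n w) * wf n q f w + sgn2 1 (word_parity n w) * wf n q g w)"
    by (simp add: wf_def algebra_simps)
  show ?case unfolding * by (rule T_word_add[OF add.IH])
next
  case (mult f g)
  let ?s = "\<lambda>w. sgn2 1 (word_parity n w)"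
  let ?B = "\<lambda>u v. sgn2 (word_parity n v) (word_parity n u) * wf n q f u * wf n q g v"
  have B: "resp n q (coprod ?B)"
    using mult.hyps by (intro resp_coprod biresp_product resp_wf_Tq)
  show ?case
  proof (rule T_word_cong[OF _ T_word_mult[OF mult.IH]])
    fix w
    assume w: "okw n w"
    have "?s w * wf n q (fmult n q f g) w = ?s w * coprod ?B w"
      using w wf_ext[OF B w] by (simp add: fmult_eq[OF q_nonzero])
    also have "\<dots> = coprod (\<lambda>u v. ?s w * ?B u v) w" by (simp only: coprod_scale)
    also have "\<dots> = coprod (\<lambda>u v. sgn2 (word_parity n v) (word_parity n u) * (?s u * wf n q f u) * (?s v * wf n q g v)) w"
    proof (intro coprod_cong[OF w])
      fix a b
      assume "word_parity n a + word_parity n b = word_parity n w"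
      then have "?s w = ?s a * ?s b" by (metis sgn2_add_right)
      then show "?s w * ?B a b = sgn2 (word_parity n b) (word_parity n a) * (?s a * wf n q f a) * (?s b * wf n q g b)"
        by simp
    qed
    finally show "?s w * wf n q (fmult n q f g) w = \<dots>" .
  qed
qed

lemma T_word_twist:
  assumes "T_word f"
  shows "T_word (\<lambda>w. sgn2 p (word_parity n w) * f w)"
proof -
  have "T_word (\<lambda>w. sgn2 1 (word_parity n w) * f w)"
    using assms by (intro T_word_cong[OF _ T_word_twist_Tq[of "ext n q f"]]) (simp_all add: T_word_def wf_ext)
  then show ?thesis using assms by (cases p) auto
qed

lemma T_word_part:
  assumes "T_word f"
  shows "T_word (\<lambda>w. if word_parity n w = p then f w else 0)"
proof (rule T_word_cong)
  \<comment> \<open>The projection to parity \<open>p\<close> is half of the identity plus or minus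
    the parity twist.\<close>
  show "T_word (\<lambda>w. (1 / 2) * (f w + sgn2 1 p * (sgn2 1 (word_parity n w) * f w)))"
    by (intro T_word_scale T_word_add T_word_twist assms)
  fix w
  show "(if word_parity n w = p then f w else 0) = (1 / 2) * (f w + sgn2 1 p * (sgn2 1 (word_parity n w) * f w))"
    by (cases "word_parity n w"; cases p) auto
qed

text \<open>On generators this is the self-duality of the vector representation. On a product the
  antipode reverses the factors, by \<open>anti_coprod\<close>, with a sign that depends on
  parities.\<close>

lemma T_word_anti_Tq:
  assumes "f \<in> Tq n q"
  shows "T_word (anti (wf n q f))"
  using assms
proof induction
  case unit
  have eps: "anti (\<lambda>w. prod_list (map counit_gen w)) w = prod_list (map counit_gen w)" for w
  proof (induction w)
    case (Cons g w)
    have "anti (\<lambda>u. 0) w = 0" by (simp add: anti_def)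
    then show ?case using Cons by (cases g) (simp_all add: anti_simps)
  qed (simp add: anti_simps)
  have wf: "wf n q (counit n q) w = prod_list (map counit_gen w)" if "okw n w" for w
    using wf_ext[OF resp_counit that] by (simp add: counit_eq_ext)
  have "anti (wf n q (counit n q)) w = wf n q (counit n q) w" if "okw n w" for w
    using anti_cong[OF that, of "wf n q (counit n q)" "\<lambda>w. prod_list (map counit_gen w)"] wf that eps by simp
  then show ?case
    using T_word_wf[OF Tq.unit] by (rule T_word_cong)
next
  case (matrix M f)
  then obtain v d where v: "vector_representation n q M v"
    and f: "\<And>w. okw n w \<Longrightarrow> wf n q f w = (\<Sum>a\<le>2 * n. \<Sum>c\<le>2 * n. d a c * vector_representation.mat n q M v a c w)"
    and T: "\<And>a c. a \<le> 2 * n \<Longrightarrow> c \<le> 2 * n \<Longrightarrow> T_word (vector_representation.mat n q M v a c)"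
    using matrix_element_expansion by blast
  interpret vector_representation n q M v by (rule v)
  have "T_word (\<lambda>w. \<Sum>a\<le>2 * n. \<Sum>c\<le>2 * n. (d a c * eta a c) * mat (2 * n - c) (2 * n - a) w)"
    using T by (intro T_word_sum T_word_scale) auto
  moreover have "anti (wf n q f) w = (\<Sum>a\<le>2 * n. \<Sum>c\<le>2 * n. (d a c * eta a c) * mat (2 * n - c) (2 * n - a) w)"
    if w: "okw n w" for w
  proof -
    have "anti (wf n q f) w = anti (\<lambda>w. \<Sum>a\<le>2 * n. \<Sum>c\<le>2 * n. d a c * mat a c w) w"
      using f by (intro anti_cong[OF w])
    also have "\<dots> = (\<Sum>a\<le>2 * n. \<Sum>c\<le>2 * n. d a c * anti (mat a c) w)"
      by (simp add: anti_def ev_fun_sum ev_fun_scale)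
    finally show ?thesis using anti_mat[OF w] by (simp add: mult.assoc)
  qed
  ultimately show ?case by (rule T_word_cong[rotated]) auto
next
  case (scale f c)
  have "anti (wf n q (\<lambda>x. c * f x)) = (\<lambda>w. c * anti (wf n q f) w)"
    by (simp add: wf_def[abs_def] anti_scale fun_eq_iff)
  then show ?case using T_word_scale[OF scale.IH] by simp
next
  case (add f g)
  have *: "anti (wf n q (f + g)) = (\<lambda>w. anti (wf n q f) w + anti (wf n q g) w)"
    by (simp add: wf_def[abs_def] anti_add fun_eq_iff)
  show ?case unfolding * by (rule T_word_add[OF add.IH])
next
  case (mult f g)
  let ?p = "word_parity n"
  let ?B = "\<lambda>u v. sgn2 (?p v) (?p u) * wf n q f u * wf n q g v"
  define f' where "f' p w = (if ?p w = p then anti (wf n q f) w else 0)" for p w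
  define g' where "g' p w = (if ?p w = p then anti (wf n q g) w else 0)" for p w
  have fg': "T_word (f' p)" "T_word (g' p)" for p
    unfolding f'_def g'_def using mult.IH by (auto intro: T_word_part)
  have B: "biresp ?B"
    using mult.hyps by (intro biresp_product resp_wf_Tq)
  show ?case
  proof (rule T_word_cong)
    \<comment> \<open>On homogeneous parts the sign in the product of functionals is a constant,
      which the factor \<open>sgn2 r p\<close> undoes.\<close>
    show "T_word (\<lambda>w. \<Sum>p\<in>{0, 1}. \<Sum>r\<in>{0, 1}. sgn2 r p *
        coprod (\<lambda>u v. sgn2 (?p v) (?p u) * g' p u * f' r v) w)"
      by (intro T_word_sum T_word_scale T_word_mult fg')
    fix w
    assume w: "okw n w"
    have "anti (wf n q (fmult n q f g)) w = anti (coprod ?B) w"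
      using wf_ext[OF resp_coprod[OF B]] by (intro anti_cong[OF w]) (simp add: fmult_eq[OF q_nonzero])
    also have "\<dots> = coprod (anti_flip ?B) w" by (rule anti_coprod[OF B w])
    also have "\<dots> = coprod (\<lambda>a b. \<Sum>p\<in>{0, 1}. \<Sum>r\<in>{0, 1}. sgn2 r p * (sgn2 (?p b) (?p a) * g' p a * f' r b)) w"
    proof (intro coprod_cong[OF w])
      fix a b
      assume ab: "okw n a" "okw n b"
      have inner: "anti (\<lambda>v. ?B u v) a = anti (wf n q g) a * (sgn2 (?p a) (?p u) * wf n q f u)" for u
      proof -
        have "anti (\<lambda>v. ?B u v) a = anti (\<lambda>v. (sgn2 (?p a) (?p u) * wf n q f u) * wf n q g v) a"
          by (intro anti_cong[OF ab(1)]) simp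
        also have "\<dots> = (sgn2 (?p a) (?p u) * wf n q f u) * anti (wf n q g) a" by (rule anti_scale)
        finally show ?thesis by (simp only: mult.commute)
      qed
      have "anti (\<lambda>u. anti (\<lambda>v. ?B u v) a) b
          = anti (\<lambda>u. anti (wf n q g) a * (sgn2 (?p a) (?p u) * wf n q f u)) b"
        by (simp only: inner)
      also have "\<dots> = anti (\<lambda>u. anti (wf n q g) a * (sgn2 (?p a) (?p b) * wf n q f u)) b"
        by (intro anti_cong[OF ab(2)]) simp
      finally have "anti_flip ?B a b = anti (wf n q g) a * anti (wf n q f) b"
        by (simp add: anti_flip_def anti_scale)
      also have "\<dots> = (\<Sum>p\<in>{0, 1}. \<Sum>r\<in>{0, 1}. sgn2 r p * (sgn2 (?p b) (?p a) * g' p a * f' r b))"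
        by (cases "?p a"; cases "?p b") (simp_all add: f'_def g'_def)
      finally show "anti_flip ?B a b = \<dots>" .
    qed
    also have "\<dots> = (\<Sum>p\<in>{0, 1}. \<Sum>r\<in>{0, 1}. sgn2 r p * coprod (\<lambda>u v. sgn2 (?p v) (?p u) * g' p u * f' r v) w)"
    proof -
      have diff: "coprod (\<lambda>a b. B a b - C a b) w = coprod B w - coprod C w" for B C
        by (simp add: coprod_def case_prod_unfold ev_fun_diff)
      show ?thesis by (simp add: coprod_add coprod_scale diff)
    qed
    finally show "anti (wf n q (fmult n q f g)) w = \<dots>" .
  qed
qed

end

section \<open>Twisted antipodes and homogeneous parts of elements of \<open>Tq\<close>\<close>

context generic_osp
begin

text \<open>The functional that appears in the inverse of the canonical map: \<open>s\<close> is the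
  parity of the argument, and \<open>r\<close> will be one more than the parity of the
  vector.\<close>

lemma Tq_antipode_twist:
  assumes "f \<in> Tq n q"
  shows "on_Uq n q (\<lambda>y. \<Sum>s\<in>{0, 1}. sgn2 s r * f (antipode n q (ucomps n q y s))) \<in> Tq n q"
proof -
  let ?h = "anti (wf n q f)" and ?g = "\<lambda>w. sgn2 r (word_parity n w) * anti (wf n q f) w"
  have h: "T_word ?h" by (rule T_word_anti_Tq[OF assms])
  have g: "T_word ?g" by (rule T_word_twist[OF h])
  have "on_Uq n q (\<lambda>y. \<Sum>s\<in>{0, 1}. sgn2 s r * f (antipode n q (ucomps n q y s))) = ext n q ?g"
  proof
    fix y
    show "on_Uq n q (\<lambda>y. \<Sum>s\<in>{0, 1}. sgn2 s r * f (antipode n q (ucomps n q y s))) y = ext n q ?g y"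
    proof (cases "y \<in> carrier (Uq n q)")
      case True
      note c = ucomps[OF True] and cc = upart_carrier[OF ucomps(1)[OF True]]
      have "ext n q ?g y = ext n q ?g (ucomps n q y 0 \<oplus>\<^bsub>Uq n q\<^esub> ucomps n q y 1)" using c(2) by simp
      also have "\<dots> = ext n q ?g (ucomps n q y 0) + ext n q ?g (ucomps n q y 1)"
        using linear_ext[of n q ?g] g cc by (simp add: T_word_def linear_on_Uq_def)
      also have "\<dots> = (\<Sum>s\<in>{0, 1}. sgn2 s r * ext n q ?h (ucomps n q y s))"
      proof -
        have "ext n q ?g (ucomps n q y s) = sgn2 s r * ext n q ?h (ucomps n q y s)" for s
          using ext_twist[of ?h "ucomps n q y s" s r] h c(1) by (simp only: T_word_def sgn2_commute[of s r])
        then show ?thesis by simp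
      qed
      also have "\<dots> = (\<Sum>s\<in>{0, 1}. sgn2 s r * f (antipode n q (ucomps n q y s)))"
        using ext_antipode[OF resp_wf_Tq[OF assms] cc] ext_wf_Tq[OF assms] by simp
      finally show ?thesis using True by (simp add: on_Uq_def)
    next
      case False
      then show ?thesis by (simp add: on_Uq_def ext_def)
    qed
  qed
  then show ?thesis using g by (simp add: T_word_def)
qed

lemma Tq_parts:
  assumes "f \<in> Tq n q"
  obtains f0 f1 where "f0 \<in> Tq n q \<inter> fpart n q 0" "f1 \<in> Tq n q \<inter> fpart n q 1" "f = f0 + f1"
proof
  define g where "g p w = (if word_parity n w = p then wf n q f w else 0)" for p w
  have g: "T_word (g p)" for p
    unfolding g_def by (rule T_word_part[OF T_word_wf[OF assms]])
  have "ext n q (g p) x = 0" if x: "x \<in> upart n q (p + 1)" for p x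
  proof -
    obtain a where a: "a \<in> carrier (free_alg n)" "\<And>w. w \<in> Poly_Mapping.keys a \<Longrightarrow> word_parity n w = p + 1"
        "x = cls n q a"
      using x by (elim upartE) blast
    have "p + 1 \<noteq> p" by (metis bit_add_self(2) add.commute add_0_right zero_neq_one)
    then have "ev (g p) a = ev (\<lambda>w. 0) a"
      using a(2) by (intro ev_keys_cong) (simp add: g_def)
    then show ?thesis using a g by (simp add: ext_cls T_word_def)
  qed
  then show "ext n q (g 0) \<in> Tq n q \<inter> fpart n q 0" "ext n q (g 1) \<in> Tq n q \<inter> fpart n q 1"
    using g by (auto simp: T_word_def fpart_def)
  have "ext n q (wf n q f) = ext n q (\<lambda>w. g 0 w + g 1 w)"
    by (rule ext_cong) (simp add: g_def)
  then show "f = ext n q (g 0) + ext n q (g 1)"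
    by (simp only: ext_wf_Tq[OF assms] ext_add)
qed

section \<open>The reductive subalgebra\<close>

lemma uscale_simps:
  assumes "x \<in> carrier (Uq n q)"
  shows "uscale n q c (uscale n q d x) = uscale n q (c * d) x"
    and "uscale n q 1 x = x" and "uscale n q 0 x = \<zero>\<^bsub>Uq n q\<^esub>"
proof -
  obtain a where a: "a \<in> carrier (free_alg n)" "x = cls n q a" using assms by (auto simp: cls_surj)
  have *: "pm_scale c (pm_scale d a) = pm_scale (c * d) a" "pm_scale 1 a = a" "pm_scale 0 a = 0"
    by (rule pm_eqI_ev; simp)+
  show "uscale n q c (uscale n q d x) = uscale n q (c * d) x" "uscale n q 1 x = x"
    using a * by (simp_all add: uscale_cls scale_closed)
  have "cls n q 0 = \<zero>\<^bsub>Uq n q\<^esub>"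
    using ring_hom_zero[OF cls_ring_hom ring_free_alg ring_Uq] by simp
  then show "uscale n q 0 x = \<zero>\<^bsub>Uq n q\<^esub>"
    using a * by (simp add: uscale_cls)
qed

lemma uscale_mult:
  assumes "x \<in> carrier (Uq n q)" "y \<in> carrier (Uq n q)"
  shows "uscale n q c x \<otimes>\<^bsub>Uq n q\<^esub> y = uscale n q c (x \<otimes>\<^bsub>Uq n q\<^esub> y)"
    and "x \<otimes>\<^bsub>Uq n q\<^esub> uscale n q c y = uscale n q c (x \<otimes>\<^bsub>Uq n q\<^esub> y)"
proof -
  obtain a b where a: "a \<in> carrier (free_alg n)" "b \<in> carrier (free_alg n)" "x = cls n q a" "y = cls n q b"
    using assms by (auto simp: cls_surj)
  have *: "pm_scale c a * b = pm_scale c (a * b)" "a * pm_scale c b = pm_scale c (a * b)"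
    by (rule pm_eqI_ev; simp add: ev_mult ev_fun_scale)+
  show "uscale n q c x \<otimes>\<^bsub>Uq n q\<^esub> y = uscale n q c (x \<otimes>\<^bsub>Uq n q\<^esub> y)"
    "x \<otimes>\<^bsub>Uq n q\<^esub> uscale n q c y = uscale n q c (x \<otimes>\<^bsub>Uq n q\<^esub> y)"
    using a * by (simp_all add: uscale_cls scale_closed free_alg_times_closed flip: cls_mult)
qed

context
  fixes \<Theta> :: "nat set"
  assumes \<Theta>: "\<Theta> \<subseteq> {1..n}"
begin

text \<open>An induction principle for \<open>Uk\<close>. Since \<open>S\<close> reverses products
  only up to parity signs, a claim is proved for homogeneous elements, collected in
  \<open>H\<close>, and every element of \<open>Uk\<close> is then a sum of two of them.\<close>

lemma Uk_decomposition:
  fixes H :: "bit \<Rightarrow> uq set"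
  assumes x: "x \<in> Uk n q \<Theta>"
    and H: "\<And>p. H p \<subseteq> carrier (Uq n q)" "\<And>p. \<zero>\<^bsub>Uq n q\<^esub> \<in> H p" "\<one>\<^bsub>Uq n q\<^esub> \<in> H 0"
      "\<And>p y z. y \<in> H p \<Longrightarrow> z \<in> H p \<Longrightarrow> y \<oplus>\<^bsub>Uq n q\<^esub> z \<in> H p"
      "\<And>p c y. y \<in> H p \<Longrightarrow> uscale n q c y \<in> H p"
      "\<And>p r y z. y \<in> H p \<Longrightarrow> z \<in> H r \<Longrightarrow> y \<otimes>\<^bsub>Uq n q\<^esub> z \<in> H (p + r)"
    and gens: "\<And>i. i \<in> {1..n} \<Longrightarrow> cls n q (gen (K i)) \<in> H 0" "\<And>i. i \<in> {1..n} \<Longrightarrow> cls n q (gen (Kinv i)) \<in> H 0"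
      "\<And>i. i \<in> \<Theta> \<Longrightarrow> cls n q (gen (E i)) \<in> H (of_bool (i = n))"
      "\<And>i. i \<in> \<Theta> \<Longrightarrow> cls n q (gen (F i)) \<in> H (of_bool (i = n))"
  shows "\<exists>x0\<in>H 0. \<exists>x1\<in>H 1. x = x0 \<oplus>\<^bsub>Uq n q\<^esub> x1"
proof -
  interpret ring "Uq n q" by (rule ring_Uq)
  have carr: "y \<in> carrier (Uq n q)" if "y \<in> H p" for y p using H(1) that by blast
  have single: "\<exists>x0\<in>H 0. \<exists>x1\<in>H 1. y = x0 \<oplus>\<^bsub>Uq n q\<^esub> x1" if "y \<in> H p" for y p
  proof -
    have y: "y \<in> carrier (Uq n q)" by (rule carr[OF that])
    show ?thesis
    proof (cases p)
      case zero
      then show ?thesis using that H(2)[of 1] y by (intro bexI[of _ y] bexI[of _ "\<zero>\<^bsub>Uq n q\<^esub>"]) auto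
    next
      case one
      then show ?thesis using that H(2)[of 0] y by (intro bexI[of _ y] bexI[of _ "\<zero>\<^bsub>Uq n q\<^esub>"]) auto
    qed
  qed
  show ?thesis
    using x
  proof induction
    case (scale x c)
    then obtain x0 x1 where *: "x0 \<in> H 0" "x1 \<in> H 1" "x = x0 \<oplus>\<^bsub>Uq n q\<^esub> x1" by blast
    have "uscale n q c x = uscale n q c x0 \<oplus>\<^bsub>Uq n q\<^esub> uscale n q c x1"
      using carr *(1,2) cls_closed[OF const_closed] unfolding *(3) uscale_def by (simp add: r_distr)
    then show ?case using * H(5) by blast
  next
    case (add x y)
    then obtain x0 x1 y0 y1 where *: "x0 \<in> H 0" "x1 \<in> H 1" "x = x0 \<oplus>\<^bsub>Uq n q\<^esub> x1"
        "y0 \<in> H 0" "y1 \<in> H 1" "y = y0 \<oplus>\<^bsub>Uq n q\<^esub> y1" by blast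
    have "x \<oplus>\<^bsub>Uq n q\<^esub> y = (x0 \<oplus>\<^bsub>Uq n q\<^esub> y0) \<oplus>\<^bsub>Uq n q\<^esub> (x1 \<oplus>\<^bsub>Uq n q\<^esub> y1)"
      using carr * by (simp add: a_ac)
    then show ?case using * H(4) by blast
  next
    case (mult x y)
    then obtain x0 x1 y0 y1 where *: "x0 \<in> H 0" "x1 \<in> H 1" "x = x0 \<oplus>\<^bsub>Uq n q\<^esub> x1"
        "y0 \<in> H 0" "y1 \<in> H 1" "y = y0 \<oplus>\<^bsub>Uq n q\<^esub> y1" by blast
    have "x \<otimes>\<^bsub>Uq n q\<^esub> y = (x0 \<otimes>\<^bsub>Uq n q\<^esub> y0 \<oplus>\<^bsub>Uq n q\<^esub> x1 \<otimes>\<^bsub>Uq n q\<^esub> y1)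
        \<oplus>\<^bsub>Uq n q\<^esub> (x0 \<otimes>\<^bsub>Uq n q\<^esub> y1 \<oplus>\<^bsub>Uq n q\<^esub> x1 \<otimes>\<^bsub>Uq n q\<^esub> y0)"
      using carr * by (simp add: l_distr r_distr a_ac)
    moreover have "x0 \<otimes>\<^bsub>Uq n q\<^esub> y0 \<oplus>\<^bsub>Uq n q\<^esub> x1 \<otimes>\<^bsub>Uq n q\<^esub> y1 \<in> H 0"
      "x0 \<otimes>\<^bsub>Uq n q\<^esub> y1 \<oplus>\<^bsub>Uq n q\<^esub> x1 \<otimes>\<^bsub>Uq n q\<^esub> y0 \<in> H 1"
      using H(6)[OF *(1,4)] H(6)[OF *(2,5)] H(6)[OF *(1,5)] H(6)[OF *(2,4)] by (auto intro!: H(4))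
    ultimately show ?case by blast
  qed (use H(3) gens single in blast)+
qed

lemma Uk_carrier:
  assumes "x \<in> Uk n q \<Theta>"
  shows "x \<in> carrier (Uq n q)"
  using assms
proof induction
  case (add x y)
  interpret ring "Uq n q" by (rule ring_Uq)
  show ?case using add by simp
next
  case (mult x y)
  interpret ring "Uq n q" by (rule ring_Uq)
  show ?case using mult by simp
next
  case one
  interpret ring "Uq n q" by (rule ring_Uq)
  show ?case by simp
qed (use \<Theta> in \<open>auto intro!: cls_closed gen_closed uscale_closed\<close>)

lemma Uk_zero: "\<zero>\<^bsub>Uq n q\<^esub> \<in> Uk n q \<Theta>"
proof -
  have "uscale n q 0 \<one>\<^bsub>Uq n q\<^esub> \<in> Uk n q \<Theta>" by (intro Uk.scale Uk.one)
  then show ?thesis using uscale_simps(3)[OF Uk_carrier[OF Uk.one]] by simp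
qed

lemma generators_in_part:
  "i \<in> \<Theta> \<Longrightarrow> cls n q (gen (E i)) \<in> upart n q (of_bool (i = n))"
  "i \<in> \<Theta> \<Longrightarrow> cls n q (gen (F i)) \<in> upart n q (of_bool (i = n))"
  using \<Theta> upart_generators(3,4) by blast+

text \<open>The preimages lie in the same subalgebra as the generators. This is what
  \<open>Uk_antipode_inv\<close> rests on, as bijectivity of \<open>S\<close> on \<open>Uq\<close>
  does not by itself give \<open>S(Uk) = Uk\<close>.\<close>

lemma antipode_generator_mult:
  assumes "i \<in> {1..n}"
  shows "antipode n q (uscale n q (- 1) (cls n q (gen (Kinv i)) \<otimes>\<^bsub>Uq n q\<^esub> cls n q (gen (E i)))) = cls n q (gen (E i))"
    and "antipode n q (uscale n q (- 1) (cls n q (gen (F i)) \<otimes>\<^bsub>Uq n q\<^esub> cls n q (gen (K i)))) = cls n q (gen (F i))"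
proof -
  interpret ring "Uq n q" by (rule ring_Uq)
  note g = upart_generators[OF assms, of q]
  have c: "cls n q (gen (K i)) \<in> carrier (Uq n q)" "cls n q (gen (Kinv i)) \<in> carrier (Uq n q)"
    "cls n q (gen (E i)) \<in> carrier (Uq n q)" "cls n q (gen (F i)) \<in> carrier (Uq n q)"
    using g upart_carrier by blast+
  have inv: "cls n q (gen (Kinv i)) \<otimes>\<^bsub>Uq n q\<^esub> cls n q (gen (K i)) = \<one>\<^bsub>Uq n q\<^esub>"
  proof -
    have "cls n q (mon [Kinv i, K i]) = cls n q (mon [])"
      using assms k_cancel(2)[OF resp_k_closed, of _ i "[]" "[]"]
      by (subst cls_eq_iff) (auto simp: mon_closed)
    then show ?thesis
      using assms by (simp add: mon_mult gen_closed flip: cls_mult cls_one one_falg)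
  qed
  show "antipode n q (uscale n q (- 1) (cls n q (gen (Kinv i)) \<otimes>\<^bsub>Uq n q\<^esub> cls n q (gen (E i)))) = cls n q (gen (E i))"
    "antipode n q (uscale n q (- 1) (cls n q (gen (F i)) \<otimes>\<^bsub>Uq n q\<^esub> cls n q (gen (K i)))) = cls n q (gen (F i))"
    using c inv antipode_mult[OF g(2,3)] antipode_mult[OF g(4,1)]
    by (simp_all add: antipode_uscale antipode_generators[OF assms] uscale_simps uscale_closed uscale_mult m_assoc
        flip: m_assoc[of "cls n q (gen (Kinv i))"])
qed

lemma Uk_ucomps:
  assumes "x \<in> Uk n q \<Theta>"
  shows "ucomps n q x p \<in> Uk n q \<Theta>"
proof -
  have "\<exists>x0\<in>Uk n q \<Theta> \<inter> upart n q 0. \<exists>x1\<in>Uk n q \<Theta> \<inter> upart n q 1. x = x0 \<oplus>\<^bsub>Uq n q\<^esub> x1"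
  proof (rule Uk_decomposition[OF assms, where H = "\<lambda>p. Uk n q \<Theta> \<inter> upart n q p"])
    show "cls n q (gen (E i)) \<in> Uk n q \<Theta> \<inter> upart n q (of_bool (i = n))"
      "cls n q (gen (F i)) \<in> Uk n q \<Theta> \<inter> upart n q (of_bool (i = n))" if "i \<in> \<Theta>" for i
      using that generators_in_part Uk.E Uk.F by blast+
  qed (auto intro: Uk.one Uk.K Uk.Kinv Uk.add Uk.scale Uk.mult Uk_zero upart_zero upart_one upart_add
        upart_uscale upart_mult upart_generators(1,2) upart_carrier)
  then show ?thesis using ucomps_unique by (cases p) auto
qed

lemma Uk_antipode:
  assumes "x \<in> Uk n q \<Theta>"
  shows "antipode n q x \<in> Uk n q \<Theta>"
proof -
  let ?H = "\<lambda>p. {y \<in> Uk n q \<Theta> \<inter> upart n q p. antipode n q y \<in> Uk n q \<Theta>}"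
  have "\<exists>x0\<in>?H 0. \<exists>x1\<in>?H 1. x = x0 \<oplus>\<^bsub>Uq n q\<^esub> x1"
  proof (rule Uk_decomposition[OF assms, where H = ?H])
    show "y \<oplus>\<^bsub>Uq n q\<^esub> z \<in> ?H p" if "y \<in> ?H p" "z \<in> ?H p" for p y z
      using that by (auto simp: antipode_add Uk_carrier intro: Uk.add upart_add)
    show "uscale n q c y \<in> ?H p" if "y \<in> ?H p" for p c y
      using that by (auto simp: antipode_uscale Uk_carrier intro: Uk.scale upart_uscale)
    show "y \<otimes>\<^bsub>Uq n q\<^esub> z \<in> ?H (p + r)" if "y \<in> ?H p" "z \<in> ?H r" for p r y z
      using that antipode_mult[of y p z r] by (auto intro: Uk.mult Uk.scale upart_mult)
    show "\<one>\<^bsub>Uq n q\<^esub> \<in> ?H 0"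
      using antipode_generators(1)[of 1] n_pos by (auto intro: Uk.one upart_one)
    show "cls n q (gen (K i)) \<in> ?H 0" "cls n q (gen (Kinv i)) \<in> ?H 0" if "i \<in> {1..n}" for i
      using that antipode_generators(2,3)[OF that] by (auto intro: Uk.K Uk.Kinv upart_generators)
    show "cls n q (gen (E i)) \<in> ?H (of_bool (i = n))" "cls n q (gen (F i)) \<in> ?H (of_bool (i = n))"
      if i: "i \<in> \<Theta>" for i
    proof -
      have i': "i \<in> {1..n}" using i \<Theta> by blast
      show "cls n q (gen (E i)) \<in> ?H (of_bool (i = n))" "cls n q (gen (F i)) \<in> ?H (of_bool (i = n))"
        using generators_in_part[OF i] i i' unfolding mem_Collect_eq antipode_generators(4,5)[OF i']
        by (blast intro: Uk.E Uk.F Uk.scale Uk.mult Uk.K Uk.Kinv)+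
    qed
  qed (auto simp: antipode_zero intro: Uk_zero upart_zero upart_carrier)
  then show ?thesis
    by (auto simp: antipode_add Uk_carrier intro: Uk.add)
qed

lemma Uk_antipode_inv:
  assumes "x \<in> Uk n q \<Theta>"
  shows "antipode_inv n q x \<in> Uk n q \<Theta>"
proof -
  let ?H = "\<lambda>p. antipode n q ` (Uk n q \<Theta> \<inter> upart n q p)"
  have "\<exists>x0\<in>?H 0. \<exists>x1\<in>?H 1. x = x0 \<oplus>\<^bsub>Uq n q\<^esub> x1"
  proof (rule Uk_decomposition[OF assms, where H = ?H])
    show "y \<oplus>\<^bsub>Uq n q\<^esub> z \<in> ?H p" if "y \<in> ?H p" "z \<in> ?H p" for p y z
      using that by (auto simp: Uk_carrier Uk.add upart_add simp flip: antipode_add)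
    show "uscale n q c y \<in> ?H p" if "y \<in> ?H p" for p c y
      using that by (auto simp: Uk_carrier Uk.scale upart_uscale simp flip: antipode_uscale)
    show "y \<otimes>\<^bsub>Uq n q\<^esub> z \<in> ?H (p + r)" if yz: "y \<in> ?H p" "z \<in> ?H r" for p r y z
    proof -
      interpret ring "Uq n q" by (rule ring_Uq)
      obtain y' z' where *: "y' \<in> Uk n q \<Theta>" "y' \<in> upart n q p" "z' \<in> Uk n q \<Theta>" "z' \<in> upart n q r"
          "y = antipode n q y'" "z = antipode n q z'"
        using yz by auto
      note c = Uk_carrier[OF *(1)] Uk_carrier[OF *(3)]
      have "antipode n q (uscale n q (sgn2 r p) (z' \<otimes>\<^bsub>Uq n q\<^esub> y')) = y \<otimes>\<^bsub>Uq n q\<^esub> z"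
        using c antipode_mult[OF *(4,2)]
        by (simp add: antipode_uscale uscale_simps antipode_closed *(5,6))
      moreover have "uscale n q (sgn2 r p) (z' \<otimes>\<^bsub>Uq n q\<^esub> y') \<in> Uk n q \<Theta> \<inter> upart n q (p + r)"
        using * upart_mult[OF *(4,2)] by (auto intro: Uk.scale Uk.mult upart_uscale simp: add.commute)
      ultimately show ?thesis by (metis imageI)
    qed
    show "\<one>\<^bsub>Uq n q\<^esub> \<in> ?H 0"
      using antipode_generators(1)[of 1] n_pos by (auto intro!: image_eqI[of _ _ "\<one>\<^bsub>Uq n q\<^esub>"] Uk.one upart_one)
    show "cls n q (gen (K i)) \<in> ?H 0" "cls n q (gen (Kinv i)) \<in> ?H 0" if "i \<in> {1..n}" for i
      using that antipode_generators(2,3)[OF that]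
      by (auto intro!: image_eqI[of _ _ "cls n q (gen (Kinv i))"] image_eqI[of "cls n q (gen (Kinv i))" _ "cls n q (gen (K i))"]
          intro: Uk.K Uk.Kinv upart_generators)
    show "cls n q (gen (E i)) \<in> ?H (of_bool (i = n))" if i: "i \<in> \<Theta>" for i
    proof (rule image_eqI)
      show "cls n q (gen (E i)) = antipode n q (uscale n q (- 1) (cls n q (gen (Kinv i)) \<otimes>\<^bsub>Uq n q\<^esub> cls n q (gen (E i))))"
        using antipode_generator_mult(1)[of i] i \<Theta> by auto
      show "uscale n q (- 1) (cls n q (gen (Kinv i)) \<otimes>\<^bsub>Uq n q\<^esub> cls n q (gen (E i))) \<in> Uk n q \<Theta> \<inter> upart n q (of_bool (i = n))"
        using i \<Theta> upart_mult[OF upart_generators(2) generators_in_part(1), of i i]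
        by (auto intro!: Uk.scale Uk.mult Uk.Kinv Uk.E upart_uscale)
    qed
    show "cls n q (gen (F i)) \<in> ?H (of_bool (i = n))" if i: "i \<in> \<Theta>" for i
    proof (rule image_eqI)
      show "cls n q (gen (F i)) = antipode n q (uscale n q (- 1) (cls n q (gen (F i)) \<otimes>\<^bsub>Uq n q\<^esub> cls n q (gen (K i))))"
        using antipode_generator_mult(2)[of i] i \<Theta> by auto
      show "uscale n q (- 1) (cls n q (gen (F i)) \<otimes>\<^bsub>Uq n q\<^esub> cls n q (gen (K i))) \<in> Uk n q \<Theta> \<inter> upart n q (of_bool (i = n))"
        using i \<Theta> upart_mult[OF generators_in_part(2) upart_generators(1), of i i]
        by (auto intro!: Uk.scale Uk.mult Uk.K Uk.F upart_uscale)
    qed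
    show "\<zero>\<^bsub>Uq n q\<^esub> \<in> ?H p" for p
      using antipode_zero by (auto intro!: image_eqI[of _ _ "\<zero>\<^bsub>Uq n q\<^esub>"] Uk_zero upart_zero)
    show "?H p \<subseteq> carrier (Uq n q)" for p
      using antipode_closed Uk_carrier by auto
  qed
  then obtain y0 y1 where *: "y0 \<in> Uk n q \<Theta>" "y1 \<in> Uk n q \<Theta>"
      "x = antipode n q y0 \<oplus>\<^bsub>Uq n q\<^esub> antipode n q y1"
    by auto
  interpret ring "Uq n q" by (rule ring_Uq)
  have "x = antipode n q (y0 \<oplus>\<^bsub>Uq n q\<^esub> y1)" using * Uk_carrier by (simp add: antipode_add)
  then show ?thesis
    using * Uk_carrier antipode_inv(3)[of "y0 \<oplus>\<^bsub>Uq n q\<^esub> y1"] by (simp add: Uk.add)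
qed

end

end

section \<open>Tensor products with graded spaces\<close>

locale graded_space =
  fixes V :: "('v::ab_group_add) smod"
  assumes scl_space: "vector_space (scl V)"
    and subspace_part: "module.subspace (scl V) (part V p)"
    and part_disjoint: "part V 0 \<inter> part V 1 = {0}"
begin

sublocale G: vector_space "scl V"
  by (rule scl_space)

lemma part_scale: "v \<in> part V r \<Longrightarrow> scl V c v \<in> part V r"
  and part_add: "v \<in> part V r \<Longrightarrow> v' \<in> part V r \<Longrightarrow> v + v' \<in> part V r"
  and part_diff: "v \<in> part V r \<Longrightarrow> v' \<in> part V r \<Longrightarrow> v - v' \<in> part V r"
  and part_0: "0 \<in> part V r"
  using subspace_part G.subspace_scale G.subspace_add G.subspace_diff G.subspace_0 by blast+

lemma part_disjointD: "v \<in> part V r \<Longrightarrow> v \<in> part V (r + 1) \<Longrightarrow> v = 0"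
  using part_disjoint by (cases r) auto

lemma space_part: "v \<in> part V r \<Longrightarrow> v \<in> space_of V"
  unfolding space_of_def using part_0
  by (cases r) (auto intro: exI[of _ 0] exI[of _ v])

lemma subspace_space: "G.subspace (space_of V)"
  using G.subspace_sums[OF subspace_part subspace_part, of 0 1] by (simp add: space_of_def)

lemma space_scale: "v \<in> space_of V \<Longrightarrow> scl V c v \<in> space_of V"
  and space_add: "v \<in> space_of V \<Longrightarrow> v' \<in> space_of V \<Longrightarrow> v + v' \<in> space_of V"
  and space_0: "0 \<in> space_of V"
  using subspace_space G.subspace_scale G.subspace_add G.subspace_0 by blast+

lemma spaceE:
  assumes "v \<in> space_of V"
  obtains v0 v1 where "v0 \<in> part V 0" "v1 \<in> part V 1" "v = v0 + v1"
  using assms by (auto simp: space_of_def)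

lemma vcomp_sum:
  assumes "u \<in> part V r" "u' \<in> part V (r + 1)"
  shows "vcomp V r (u + u') = u"
  unfolding vcomp_def
proof (rule the_equality)
  show "u \<in> part V r \<and> (\<exists>z\<in>part V (r + 1). u + u' = u + z)" using assms by blast
next
  fix y
  assume y: "y \<in> part V r \<and> (\<exists>z\<in>part V (r + 1). u + u' = y + z)"
  then obtain z where z: "z \<in> part V (r + 1)" "u + u' = y + z" by blast
  then have "u - y = z - u'" by (simp add: algebra_simps)
  moreover have "u - y \<in> part V r" "z - u' \<in> part V (r + 1)"
    using part_diff assms y z(1) by blast+
  ultimately have "u - y = 0" by (intro part_disjointD[of _ r]) auto
  then show "y = u" by simp
qed

lemma vcomp_part:
  assumes "v \<in> part V r"
  shows "vcomp V r' v = (if r' = r then v else 0)"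
proof (cases "r' = r")
  case True
  then show ?thesis using vcomp_sum[OF assms part_0] by simp
next
  case False
  then have "r = r' + 1" by (metis bit_eq_plus_one_iff)
  then show ?thesis using vcomp_sum[OF part_0, of v r'] assms False by simp
qed

lemma vcomp_0: "vcomp V r 0 = 0"
  using vcomp_part[OF part_0, of r r] by simp

lemma vcomp_split:
  assumes "v0 \<in> part V 0" "v1 \<in> part V 1"
  shows "vcomp V 0 (v0 + v1) = v0" "vcomp V 1 (v0 + v1) = v1"
  using vcomp_sum[of v0 0 v1] vcomp_sum[of v1 1 v0] assms by (simp_all add: add.commute)

lemma vcomp_in_part:
  assumes "v \<in> space_of V"
  shows "vcomp V r v \<in> part V r"
  using assms by (elim spaceE, cases r) (auto simp: vcomp_split)

lemma vcomp_decomp: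
  assumes "v \<in> space_of V"
  shows "vcomp V 0 v + vcomp V 1 v = v"
  using assms by (elim spaceE) (auto simp: vcomp_split)

lemma vcomp_add:
  assumes "v \<in> space_of V" "v' \<in> space_of V"
  shows "vcomp V r (v + v') = vcomp V r v + vcomp V r v'"
proof -
  obtain v0 v1 where v: "v0 \<in> part V 0" "v1 \<in> part V 1" "v = v0 + v1" using assms(1) by (rule spaceE)
  obtain u0 u1 where u: "u0 \<in> part V 0" "u1 \<in> part V 1" "v' = u0 + u1" using assms(2) by (rule spaceE)
  have s: "v + v' = (v0 + u0) + (v1 + u1)" using u v by (simp add: algebra_simps)
  show ?thesis
    using vcomp_split[OF v(1,2)] vcomp_split[OF u(1,2)] vcomp_split[of "v0 + u0" "v1 + u1"] u v
    unfolding s by (cases r) (auto simp: part_add)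
qed

lemma vcomp_scale:
  assumes "v \<in> space_of V"
  shows "vcomp V r (scl V c v) = scl V c (vcomp V r v)"
proof -
  obtain v0 v1 where v: "v0 \<in> part V 0" "v1 \<in> part V 1" "v = v0 + v1" using assms(1) by (rule spaceE)
  show ?thesis
    using vcomp_split[OF v(1,2)] vcomp_split[of "scl V c v0" "scl V c v1"] v
    by (cases r) (auto simp: part_scale G.scale_right_distrib)
qed

sublocale F: vector_space "fscale V"
  by unfold_locales (auto simp: fscale_def G.scale_right_distrib G.scale_left_distrib)

lemma pure_sum:
  "pure V (v + v') f = pure V v f + pure V v' f"
  "pure V v (f + g) = pure V v f + pure V v g"
  by (auto simp: pure_def G.scale_right_distrib G.scale_left_distrib)

end

section \<open>Tensors as functions on \<open>Uq\<close> with values in \<open>V\<close>, and the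
  two actions on homogeneous ones\<close>

locale graded_tensor = generic_osp n q + graded_space V
  for n q and V :: "('v::ab_group_add) smod"
begin

text \<open>Properties shared by all tensors, seen as functions, that make them determined by their
  values on homogeneous elements.\<close>

definition tlinear :: "(uq \<Rightarrow> 'v) \<Rightarrow> bool" where
  "tlinear \<zeta> \<longleftrightarrow> (\<forall>a. \<zeta> a \<in> space_of V) \<and> (\<forall>a. a \<notin> carrier (Uq n q) \<longrightarrow> \<zeta> a = 0) \<and>
     (\<forall>a\<in>carrier (Uq n q). \<forall>b\<in>carrier (Uq n q). \<zeta> (a \<oplus>\<^bsub>Uq n q\<^esub> b) = \<zeta> a + \<zeta> b)"

definition thomog :: "bit \<Rightarrow> (uq \<Rightarrow> 'v) \<Rightarrow> bool" where
  "thomog d \<zeta> \<longleftrightarrow> (\<forall>s. \<forall>a\<in>upart n q s. \<zeta> a \<in> part V (d + s))"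

lemma tlinear_space: "tlinear \<zeta> \<Longrightarrow> \<zeta> a \<in> space_of V"
  and tlinear_outside: "tlinear \<zeta> \<Longrightarrow> a \<notin> carrier (Uq n q) \<Longrightarrow> \<zeta> a = 0"
  and tlinear_add: "tlinear \<zeta> \<Longrightarrow> a \<in> carrier (Uq n q) \<Longrightarrow> b \<in> carrier (Uq n q) \<Longrightarrow>
    \<zeta> (a \<oplus>\<^bsub>Uq n q\<^esub> b) = \<zeta> a + \<zeta> b"
  by (auto simp: tlinear_def)

lemma thomogD: "thomog d \<zeta> \<Longrightarrow> a \<in> upart n q s \<Longrightarrow> \<zeta> a \<in> part V (d + s)"
  by (auto simp: thomog_def)

lemma tlinear_zero:
  assumes "tlinear \<zeta>"
  shows "\<zeta> \<zero>\<^bsub>Uq n q\<^esub> = 0"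
proof -
  interpret ring "Uq n q" by (rule ring_Uq)
  show ?thesis using tlinear_add[OF assms zero_closed zero_closed] by simp
qed

lemma tlinear_eqI:
  assumes "tlinear \<zeta>" "tlinear \<xi>" "\<And>s a. a \<in> upart n q s \<Longrightarrow> \<zeta> a = \<xi> a"
  shows "\<zeta> = \<xi>"
proof
  fix a
  show "\<zeta> a = \<xi> a"
  proof (cases "a \<in> carrier (Uq n q)")
    case True
    note c = ucomps[OF True]
    show ?thesis
      using tlinear_add[OF assms(1) upart_carrier[OF c(1)] upart_carrier[OF c(1)], of 0 1]
        tlinear_add[OF assms(2) upart_carrier[OF c(1)] upart_carrier[OF c(1)], of 0 1]
        assms(3)[OF c(1)] c(2) by simp
  qed (simp add: assms tlinear_outside)
qed

lemma tlinear_subspace: "F.subspace {\<zeta>. tlinear \<zeta>}"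
  by (rule F.subspaceI)
    (auto simp: tlinear_def fscale_def space_0 space_add space_scale G.scale_right_distrib)

lemma thomog_subspace: "F.subspace {\<zeta>. thomog d \<zeta>}"
  by (rule F.subspaceI) (auto simp: thomog_def fscale_def part_0 part_add part_scale)

lemma tlinear_pure:
  assumes "v \<in> space_of V" "f \<in> Tq n q"
  shows "tlinear (pure V v f)"
  using assms Tq_linear[OF assms(2)] Tq_outside[OF assms(2)]
  by (auto simp: tlinear_def pure_def linear_on_Uq_def space_scale G.scale_left_distrib)

lemma tensor_T_tlinear:
  assumes "\<zeta> \<in> tensor_T n q V"
  shows "tlinear \<zeta>"
  using assms unfolding tensor_T_def
  by (rule F.span_induct) (use tlinear_subspace tlinear_pure in \<open>auto\<close>)

lemma thomog_pure:
  assumes "v \<in> part V r" "f \<in> fpart n q s"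
  shows "thomog (r + s) (pure V v f)"
  unfolding thomog_def
proof (intro allI ballI)
  fix t a
  assume a: "a \<in> upart n q t"
  show "pure V v f a \<in> part V (r + s + t)"
  proof (cases "t = s")
    case True
    then show ?thesis using assms(1) by (simp add: pure_def part_scale add.assoc)
  next
    case False
    then have "t = s + 1" by (metis bit_eq_plus_one_iff)
    then show ?thesis using assms(2) a by (simp add: pure_def fpart_def part_0)
  qed
qed

lemma tensor_T_part_thomog:
  assumes "\<zeta> \<in> tensor_T_part n q V d"
  shows "thomog d \<zeta>"
  using assms unfolding tensor_T_part_def
  by (rule F.span_induct) (use thomog_subspace thomog_pure in \<open>auto\<close>)

lemma tensor_T_part_tensor_T: "tensor_T_part n q V d \<subseteq> tensor_T n q V"
  unfolding tensor_T_part_def tensor_T_def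
  by (rule F.span_mono) (use space_part in blast)

lemma tensor_T_subspace: "F.subspace (tensor_T n q V)"
  and tensor_T_part_subspace: "F.subspace (tensor_T_part n q V d)"
  by (simp_all add: tensor_T_def tensor_T_part_def)

lemma pure_in_part:
  "v \<in> part V r \<Longrightarrow> f \<in> Tq n q \<inter> fpart n q s \<Longrightarrow> pure V v f \<in> tensor_T_part n q V (r + s)"
  unfolding tensor_T_part_def by (rule F.span_base) blast

lemma tensor_T_decomp:
  assumes "\<zeta> \<in> tensor_T n q V"
  shows "\<exists>\<zeta>0\<in>tensor_T_part n q V 0. \<exists>\<zeta>1\<in>tensor_T_part n q V 1. \<zeta> = \<zeta>0 + \<zeta>1"
proof -
  let ?S = "{\<zeta>0 + \<zeta>1 | \<zeta>0 \<zeta>1. \<zeta>0 \<in> tensor_T_part n q V 0 \<and> \<zeta>1 \<in> tensor_T_part n q V 1}"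
  have "\<zeta> \<in> ?S"
    using assms unfolding tensor_T_def
  proof (rule F.span_induct)
    show "F.subspace {\<zeta>. \<zeta> \<in> ?S}"
      using F.subspace_sums[OF tensor_T_part_subspace tensor_T_part_subspace, of 0 1] by simp
    fix \<xi>
    assume "\<xi> \<in> {pure V v f | v f. v \<in> space_of V \<and> f \<in> Tq n q}"
    then obtain v f where \<xi>: "\<xi> = pure V v f" "v \<in> space_of V" "f \<in> Tq n q" by blast
    obtain v0 v1 where v: "v0 \<in> part V 0" "v1 \<in> part V 1" "v = v0 + v1" using \<xi>(2) by (rule spaceE)
    obtain f0 f1 where f: "f0 \<in> Tq n q \<inter> fpart n q 0" "f1 \<in> Tq n q \<inter> fpart n q 1" "f = f0 + f1"
      using \<xi>(3) by (rule Tq_parts)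
    have "pure V v0 f0 + pure V v1 f1 \<in> tensor_T_part n q V 0"
      using pure_in_part[OF v(1) f(1)] pure_in_part[OF v(2) f(2)]
      by (intro F.subspace_add[OF tensor_T_part_subspace]) simp_all
    moreover have "pure V v0 f1 + pure V v1 f0 \<in> tensor_T_part n q V 1"
      using pure_in_part[OF v(1) f(2)] pure_in_part[OF v(2) f(1)]
      by (intro F.subspace_add[OF tensor_T_part_subspace]) simp_all
    moreover have "\<xi> = (pure V v0 f0 + pure V v1 f1) + (pure V v0 f1 + pure V v1 f0)"
      unfolding \<xi>(1) v(3) f(3) pure_sum by (simp only: add_ac)
    ultimately show "\<xi> \<in> ?S" by blast
  qed
  then show ?thesis by blast
qed

text \<open>A tensor splits into parts of both degrees. On homogeneous arguments the part of the
  wrong degree takes values that are even and odd at once, so it vanishes. The degree of a tensor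
  can thus be tested on values.\<close>

lemma thomog_tensor_T_part:
  assumes "\<zeta> \<in> tensor_T n q V" "thomog d \<zeta>"
  shows "\<zeta> \<in> tensor_T_part n q V d"
proof -
  obtain \<xi> \<eta> where *: "\<xi> \<in> tensor_T_part n q V d" "\<eta> \<in> tensor_T_part n q V (d + 1)" "\<zeta> = \<xi> + \<eta>"
  proof (cases d)
    case zero
    then show ?thesis using tensor_T_decomp[OF assms(1)] that by auto
  next
    case one
    from tensor_T_decomp[OF assms(1)] obtain \<zeta>0 \<zeta>1 where
      "\<zeta>0 \<in> tensor_T_part n q V 0" "\<zeta>1 \<in> tensor_T_part n q V 1" "\<zeta> = \<zeta>0 + \<zeta>1" by blast
    then show ?thesis using that[of \<zeta>1 \<zeta>0] one by (simp add: add.commute)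
  qed
  have "\<eta> = 0"
  proof (rule tlinear_eqI)
    show "tlinear \<eta>" using *(2) tensor_T_part_tensor_T tensor_T_tlinear by blast
    show "tlinear 0" using F.subspace_0[OF tlinear_subspace] by simp
    fix s a
    assume a: "a \<in> upart n q s"
    have "\<eta> a = \<zeta> a - \<xi> a" using *(3) by simp
    then have "\<eta> a \<in> part V (d + s)"
      using thomogD[OF assms(2) a] thomogD[OF tensor_T_part_thomog[OF *(1)] a] part_diff by simp
    moreover have "\<eta> a \<in> part V (d + s + 1)"
      using thomogD[OF tensor_T_part_thomog[OF *(2)] a] by (simp add: add_ac)
    ultimately show "\<eta> a = 0 a" using part_disjointD by simp
  qed
  then show ?thesis using * by simp
qed

lemma sum_bit_delta:
  fixes h :: "bit \<Rightarrow> 'v"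
  shows "(\<Sum>r\<in>{0, 1}. if r = p then h r else 0) = h p"
  by (cases p) simp_all

lemma signed_ext_homog:
  assumes x: "x \<in> upart n q p" and op: "op \<zero>\<^bsub>Uq n q\<^esub> \<zeta> a = 0" "op x \<zeta> a \<in> part V d"
  shows "signed_ext n q V op x \<zeta> a = scl V (sgn2 p d) (op x \<zeta> a)"
proof -
  have "signed_ext n q V op x \<zeta> a
      = (\<Sum>p'\<in>{0, 1}. if p' = p then \<Sum>r\<in>{0, 1}. if r = d then scl V (sgn2 p' r) (op x \<zeta> a) else 0 else 0)"
    unfolding signed_ext_def
    by (intro sum.cong refl) (auto simp: ucomps_homogeneous[OF x] op(1) vcomp_0 vcomp_part[OF op(2)])
  then show ?thesis by (simp only: sum_bit_delta)
qed

text \<open>The sign of the extended action involves the parity of the factor in \<open>V\<close>;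
  for a homogeneous tensor it is the parity of the value at the product of \<open>a\<close> and
  \<open>x\<close>.\<close>

lemma circ_tensor_homog:
  assumes "tlinear \<zeta>" "thomog d \<zeta>" "x \<in> upart n q p" "a \<in> upart n q t"
  shows "circ_tensor n q V x \<zeta> a = scl V (sgn2 p (d + t + p)) (\<zeta> (a \<otimes>\<^bsub>Uq n q\<^esub> x))"
proof -
  interpret ring "Uq n q" by (rule ring_Uq)
  have c: "circ n q y \<zeta> a = \<zeta> (a \<otimes>\<^bsub>Uq n q\<^esub> y)" for y
    using upart_carrier[OF assms(4)] by (simp add: circ_def on_Uq_def)
  show ?thesis
    unfolding circ_tensor_def
    using signed_ext_homog[OF assms(3), of "circ n q" \<zeta> a "d + t + p"]
      thomogD[OF assms(2) upart_mult[OF assms(4,3)]]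
    unfolding c using upart_carrier[OF assms(4)] tlinear_zero[OF assms(1)] by (simp add: add.assoc)
qed

text \<open>Two signs meet, one from the action on functionals and one from passing the factor in
  \<open>V\<close>; the parity \<open>t\<close> of the argument cancels between them.\<close>

lemma dot_tensor_homog:
  assumes "tlinear \<zeta>" "thomog d \<zeta>" "x \<in> upart n q p" "a \<in> upart n q t"
  shows "dot_tensor n q V x \<zeta> a = scl V (sgn2 p (d + p)) (\<zeta> (antipode_inv n q x \<otimes>\<^bsub>Uq n q\<^esub> a))"
proof -
  interpret ring "Uq n q" by (rule ring_Uq)
  have c: "dot (scl V) n q y \<zeta> a = scl V (sgn2 r t) (\<zeta> (antipode_inv n q y \<otimes>\<^bsub>Uq n q\<^esub> a))"
    if y: "y \<in> upart n q r" for y r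
  proof -
    note y' = antipode_inv_upart[OF y]
    have "dot (scl V) n q y \<zeta> a = (\<Sum>p'\<in>{0, 1}. if p' = r then \<Sum>s\<in>{0, 1}. if s = t then
        scl V (sgn2 p' s) (\<zeta> (antipode_inv n q y \<otimes>\<^bsub>Uq n q\<^esub> a)) else 0 else 0)"
      unfolding dot_def on_Uq_def if_P[OF upart_carrier[OF assms(4)]]
      by (intro sum.cong refl)
        (auto simp: ucomps_homogeneous[OF y'] ucomps_homogeneous[OF assms(4)] tlinear_zero[OF assms(1)]
          upart_carrier[OF y'] upart_carrier[OF assms(4)])
    then show ?thesis by (simp only: sum_bit_delta)
  qed
  have "antipode_inv n q \<zero>\<^bsub>Uq n q\<^esub> = \<zero>\<^bsub>Uq n q\<^esub>"
    using antipode_inv(3)[OF zero_closed] antipode_zero by simp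
  then have "dot (scl V) n q \<zero>\<^bsub>Uq n q\<^esub> \<zeta> a = 0"
    using c[OF upart_zero, of 0] tlinear_zero[OF assms(1)] upart_carrier[OF assms(4)] by simp
  moreover have "dot (scl V) n q x \<zeta> a \<in> part V (d + (p + t))"
    unfolding c[OF assms(3)]
    by (intro part_scale thomogD[OF assms(2)] upart_mult antipode_inv_upart assms)
  ultimately have "dot_tensor n q V x \<zeta> a
      = scl V (sgn2 p (d + (p + t)) * sgn2 p t) (\<zeta> (antipode_inv n q x \<otimes>\<^bsub>Uq n q\<^esub> a))"
    unfolding dot_tensor_def by (subst signed_ext_homog[OF assms(3), where d = "d + (p + t)"]) (simp_all add: c[OF assms(3)])
  moreover have "sgn2 p (d + (p + t)) * sgn2 p t = sgn2 p (d + p)"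
    by (cases p; cases d; cases t) (simp_all add: sgn2_def)
  ultimately show ?thesis by simp
qed

lemma dot_space:
  assumes "tlinear \<zeta>"
  shows "dot (scl V) n q x \<zeta> a \<in> space_of V"
proof (cases "a \<in> carrier (Uq n q)")
  case True
  show ?thesis
    unfolding dot_def on_Uq_def if_P[OF True]
    by (intro G.subspace_sum[OF subspace_space] space_scale tlinear_space assms)
qed (simp add: dot_def on_Uq_def space_0)

lemma dot_tensor_add:
  assumes "tlinear \<zeta>" "tlinear \<xi>"
  shows "dot_tensor n q V x (\<zeta> + \<xi>) = dot_tensor n q V x \<zeta> + dot_tensor n q V x \<xi>"
proof
  fix a
  have "dot (scl V) n q y (\<zeta> + \<xi>) a = dot (scl V) n q y \<zeta> a + dot (scl V) n q y \<xi> a" for y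
    unfolding dot_def on_Uq_def by (simp add: G.scale_right_distrib algebra_simps)
  then show "dot_tensor n q V x (\<zeta> + \<xi>) a = (dot_tensor n q V x \<zeta> + dot_tensor n q V x \<xi>) a"
    unfolding dot_tensor_def signed_ext_def
    by (simp add: vcomp_add dot_space assms G.scale_right_distrib algebra_simps)
qed

end

section \<open>Reciprocity\<close>

locale reciprocity = graded_tensor n q V + W: uq_module n q W
  for n q and V :: "('v::ab_group_add) smod" and W :: "('w::ab_group_add) smod" +
  fixes \<Theta> :: "nat set"
  assumes \<Theta>: "\<Theta> \<subseteq> {1..n}"
    and V_module: "is_module n q (Uk n q \<Theta>) V"
    and comodule: "T_comodule n q W"
begin

sublocale W: graded_space W
  using W.module by unfold_locales (auto simp: is_module_def module_def vector_space_def)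

abbreviation "HomG p \<equiv> Hom_part n q (carrier (Uq n q)) W (induced n q \<Theta> V) p"
abbreviation "HomK p \<equiv> Hom_part n q (Uk n q \<Theta>) W V p"

lemma V_act:
  "x \<in> Uk n q \<Theta> \<Longrightarrow> v \<in> space_of V \<Longrightarrow> v' \<in> space_of V \<Longrightarrow> act V x (v + v') = act V x v + act V x v'"
  "x \<in> Uk n q \<Theta> \<Longrightarrow> v \<in> space_of V \<Longrightarrow> act V x (scl V c v) = scl V c (act V x v)"
  "x \<in> Uk n q \<Theta> \<Longrightarrow> y \<in> Uk n q \<Theta> \<Longrightarrow> v \<in> space_of V \<Longrightarrow>
     act V (x \<oplus>\<^bsub>Uq n q\<^esub> y) v = act V x v + act V y v"
  using V_module unfolding is_module_def by blast+

lemma V_act_0: "x \<in> Uk n q \<Theta> \<Longrightarrow> act V x 0 = 0"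
  using V_act(2)[OF _ space_0, of x 0] by simp

lemma HomK_simps:
  assumes "\<phi> \<in> HomK P"
  shows "w \<notin> space_of W \<Longrightarrow> \<phi> w = 0"
    and "w \<in> space_of W \<Longrightarrow> w' \<in> space_of W \<Longrightarrow> \<phi> (w + w') = \<phi> w + \<phi> w'"
    and "w \<in> space_of W \<Longrightarrow> \<phi> (scl W c w) = scl V c (\<phi> w)"
    and "w \<in> part W r \<Longrightarrow> \<phi> w \<in> part V (P + r)"
    and "x \<in> Uk n q \<Theta> \<Longrightarrow> x \<in> upart n q s \<Longrightarrow> w \<in> space_of W \<Longrightarrow>
      act V x (\<phi> w) = scl V (sgn2 P s) (\<phi> (act W x w))"
  using assms unfolding Hom_part_def by blast+

lemma HomG_simps:
  assumes "\<psi> \<in> HomG P"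
  shows "w \<notin> space_of W \<Longrightarrow> \<psi> w = 0"
    and "w \<in> space_of W \<Longrightarrow> w' \<in> space_of W \<Longrightarrow> \<psi> (w + w') = \<psi> w + \<psi> w'"
    and "w \<in> space_of W \<Longrightarrow> \<psi> (scl W c w) = fscale V c (\<psi> w)"
    and "w \<in> part W r \<Longrightarrow> \<psi> w \<in> Gamma n q \<Theta> V \<and> \<psi> w \<in> tensor_T_part n q V (P + r)"
    and "x \<in> upart n q s \<Longrightarrow> w \<in> space_of W \<Longrightarrow>
      dot_tensor n q V x (\<psi> w) = fscale V (sgn2 P s) (\<psi> (act W x w))"
  using assms upart_carrier unfolding Hom_part_def by (auto simp: induced_def)

lemma space_induct [consumes 1, case_names 1 2]:
  assumes "w \<in> space_of W" "\<And>r w. w \<in> part W r \<Longrightarrow> Q w"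
    and "\<And>w w'. w \<in> space_of W \<Longrightarrow> w' \<in> space_of W \<Longrightarrow> Q w \<Longrightarrow> Q w' \<Longrightarrow> Q (w + w')"
  shows "Q w"
  using assms(1) by (rule W.spaceE) (use assms(2,3) W.space_part in blast)

lemma HomK_space:
  assumes "\<phi> \<in> HomK P"
  shows "\<phi> w \<in> space_of V"
proof (cases "w \<in> space_of W")
  case True
  then show ?thesis
  proof (induction rule: space_induct)
    case (1 r w)
    then show ?case using HomK_simps(4)[OF assms] space_part by blast
  next
    case (2 w w')
    then show ?case using HomK_simps(2)[OF assms] space_add by simp
  qed
qed (simp add: HomK_simps(1)[OF assms] space_0)

lemma HomG_part:
  assumes "\<psi> \<in> HomG P" "w \<in> part W r"
  shows "tlinear (\<psi> w)" "thomog (P + r) (\<psi> w)"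
  using HomG_simps(4)[OF assms] tensor_T_part_thomog tensor_T_part_tensor_T tensor_T_tlinear by blast+

lemma HomG_tlinear:
  assumes "\<psi> \<in> HomG P"
  shows "tlinear (\<psi> w)"
proof (cases "w \<in> space_of W")
  case True
  then show ?thesis
  proof (induction rule: space_induct)
    case (1 r w)
    then show ?case using HomG_part(1)[OF assms] by blast
  next
    case (2 w w')
    then show ?case
      using F.subspace_add[OF tlinear_subspace, of "\<psi> w" "\<psi> w'"] by (simp only: HomG_simps(2)[OF assms] mem_Collect_eq)
  qed
next
  case False
  then show ?thesis using HomG_simps(1)[OF assms] F.subspace_0[OF tlinear_subspace] by simp
qed

text \<open>Equivariance under \<open>S(y)\<close>, evaluated at 1: the action moves
  \<open>S^{-1}(S(y)) = y\<close> into the argument. This shows uniqueness and dictates the inverse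
  map.\<close>

lemma HomG_eq_eval_one:
  assumes \<psi>: "\<psi> \<in> HomG P" and w: "w \<in> part W r" and y: "y \<in> upart n q s"
  shows "\<psi> w y = scl V (sgn2 s (r + 1)) (eval_one n q \<psi> (act W (antipode n q y) w))"
proof -
  interpret ring "Uq n q" by (rule ring_Uq)
  note c = upart_carrier[OF y]
  have "scl V (sgn2 s (P + r + s)) (\<psi> w y) = dot_tensor n q V (antipode n q y) (\<psi> w) \<one>\<^bsub>Uq n q\<^esub>"
    using dot_tensor_homog[OF HomG_part[OF \<psi> w] antipode_upart[OF y] upart_one] c
    by (simp add: antipode_inv(3))
  also have "\<dots> = scl V (sgn2 P s) (eval_one n q \<psi> (act W (antipode n q y) w))"
    using HomG_simps(5)[OF \<psi> antipode_upart[OF y] W.space_part[OF w]] by (simp add: fscale_def eval_one_def)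
  finally have "scl V (sgn2 s (P + r + s) * sgn2 s (P + r + s)) (\<psi> w y)
      = scl V (sgn2 s (P + r + s) * sgn2 P s) (eval_one n q \<psi> (act W (antipode n q y) w))"
    by (metis G.scale_scale)
  moreover have "sgn2 s (P + r + s) * sgn2 P s = sgn2 s (r + 1)"
    "sgn2 s (P + r + s) * sgn2 s (P + r + s) = 1"
    by (cases s; cases P; cases r; simp add: sgn2_def)+
  ultimately show ?thesis by simp
qed

text \<open>The condition that defines \<open>Gamma\<close>, taken for \<open>S^{-1}(x)\<close> and
  evaluated at 1, expresses \<open>x\<close> acting on the value at 1 as the value at
  \<open>S^{-1}(x)\<close>; by \<open>HomG_eq_eval_one\<close> the latter is the action of
  \<open>x\<close> on \<open>w\<close>.\<close>

lemma eval_one_HomK: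
  assumes \<psi>: "\<psi> \<in> HomG P"
  shows "eval_one n q \<psi> \<in> HomK P"
  unfolding Hom_part_def mem_Collect_eq
proof (intro conjI allI ballI impI)
  interpret ring "Uq n q" by (rule ring_Uq)
  let ?\<phi> = "eval_one n q \<psi>"
  show add: "?\<phi> (w + w') = ?\<phi> w + ?\<phi> w'" if "w \<in> space_of W" "w' \<in> space_of W" for w w'
    using HomG_simps(2)[OF \<psi> that] by (simp add: eval_one_def)
  show "?\<phi> w = 0" if "w \<notin> space_of W" for w
    using HomG_simps(1)[OF \<psi> that] by (simp add: eval_one_def)
  show "?\<phi> (scl W c w) = scl V c (?\<phi> w)" if "w \<in> space_of W" for w c
    using HomG_simps(3)[OF \<psi> that] by (simp add: eval_one_def fscale_def)
  show "?\<phi> w \<in> part V (P + r)" if "w \<in> part W r" for w r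
    using thomogD[OF HomG_part(2)[OF \<psi> that] upart_one] by (simp add: eval_one_def)
  fix s x w
  assume x: "x \<in> Uk n q \<Theta> \<inter> upart n q s" and w: "w \<in> space_of W"
  then have xc: "x \<in> carrier (Uq n q)" using upart_carrier by auto
  have sp: "?\<phi> w \<in> space_of V" for w
    using tlinear_space[OF HomG_tlinear[OF \<psi>]] by (simp add: eval_one_def)
  show "act V x (?\<phi> w) = scl V (sgn2 P s) (?\<phi> (act W x w))"
    using w
  proof (induction rule: space_induct)
    case (1 r w)
    define y where "y = antipode_inv n q x"
    have y: "y \<in> Uk n q \<Theta>" "y \<in> upart n q s" "antipode n q y = x"
      using Uk_antipode_inv[OF \<Theta>] antipode_inv_upart antipode_inv(2)[OF xc] x by (auto simp: y_def)
    have "act V x (?\<phi> w) = circ_tensor n q V y (\<psi> w) \<one>\<^bsub>Uq n q\<^esub>"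
      using HomG_simps(4)[OF \<psi> 1] y by (simp add: Gamma_def eval_one_def)
    also have "\<dots> = scl V (sgn2 s (P + r + s)) (\<psi> w y)"
      using circ_tensor_homog[OF HomG_part[OF \<psi> 1] y(2) upart_one] upart_carrier[OF y(2)] by simp
    also have "\<dots> = scl V (sgn2 s (P + r + s) * sgn2 s (r + 1)) (?\<phi> (act W x w))"
      using HomG_eq_eval_one[OF \<psi> 1 y(2)] y(3) by simp
    also have "sgn2 s (P + r + s) * sgn2 s (r + 1) = sgn2 P s"
      by (cases s; cases P; cases r; simp add: sgn2_def)
    finally show ?case .
  next
    case (2 w w')
    then show ?case
      using x xc sp by (simp add: add V_act W.act_add W.act_closed G.scale_right_distrib)
  qed
qed

lemma HomG_eqI:
  assumes \<psi>: "\<psi> \<in> HomG P" "\<psi>' \<in> HomG P" and eq: "eval_one n q \<psi> = eval_one n q \<psi>'"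
  shows "\<psi> = \<psi>'"
proof
  fix w
  show "\<psi> w = \<psi>' w"
  proof (cases "w \<in> space_of W")
    case True
    then show ?thesis
    proof (induction rule: space_induct)
      case (1 r w)
      show ?case
        by (rule tlinear_eqI[OF HomG_tlinear HomG_tlinear, OF \<psi>])
          (simp add: HomG_eq_eval_one[OF \<psi>(1) 1] HomG_eq_eval_one[OF \<psi>(2) 1] eq)
    next
      case (2 w w')
      then show ?case using HomG_simps(2)[OF \<psi>(1)] HomG_simps(2)[OF \<psi>(2)] by simp
    qed
  qed (simp add: HomG_simps(1)[OF \<psi>(1)] HomG_simps(1)[OF \<psi>(2)])
qed

text \<open>On a homogeneous argument the even and the odd map take values of different
  parity.\<close>

lemma HomK_sum_unique:
  assumes "\<phi>0 \<in> HomK 0" "\<phi>1 \<in> HomK 1" "\<phi>0' \<in> HomK 0" "\<phi>1' \<in> HomK 1" "\<phi>0 + \<phi>1 = \<phi>0' + \<phi>1'"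
  shows "\<phi>0 = \<phi>0' \<and> \<phi>1 = \<phi>1'"
proof -
  have "\<phi>0 w = \<phi>0' w" for w
  proof (cases "w \<in> space_of W")
    case True
    then show ?thesis
    proof (induction rule: space_induct)
      case (1 r w)
      have "\<phi>0 w + \<phi>1 w = \<phi>0' w + \<phi>1' w" using fun_cong[OF assms(5), of w] by simp
      then have "\<phi>0 w - \<phi>0' w = \<phi>1' w - \<phi>1 w" by (simp add: algebra_simps)
      moreover have "\<phi>0 w - \<phi>0' w \<in> part V r" "\<phi>1' w - \<phi>1 w \<in> part V (r + 1)"
        using HomK_simps(4)[OF assms(1) 1] HomK_simps(4)[OF assms(2) 1]
          HomK_simps(4)[OF assms(3) 1] HomK_simps(4)[OF assms(4) 1]
        by (simp_all add: part_diff add.commute)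
      ultimately have "\<phi>0 w - \<phi>0' w = 0" by (intro part_disjointD[of _ r]) auto
      then show ?case by simp
    next
      case (2 w w')
      then show ?case using HomK_simps(2)[OF assms(1)] HomK_simps(2)[OF assms(3)] by simp
    qed
  qed (simp add: HomK_simps(1)[OF assms(1)] HomK_simps(1)[OF assms(3)])
  then have "\<phi>0 = \<phi>0'" ..
  then show ?thesis using assms(5) by simp
qed

text \<open>The inverse of the canonical map on \<open>u\<close> of degree \<open>r\<close>, read off from
  \<open>HomG_eq_eval_one\<close>.\<close>

definition coind :: "('w \<Rightarrow> 'v) \<Rightarrow> bit \<Rightarrow> 'w \<Rightarrow> uq \<Rightarrow> 'v" where
  "coind \<phi> r u = on_Uq n q (\<lambda>y. \<Sum>s\<in>{0, 1}.
     scl V (sgn2 s (r + 1)) (\<phi> (act W (antipode n q (ucomps n q y s)) u)))"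

context
  fixes \<phi> :: "'w \<Rightarrow> 'v" and P :: bit
  assumes \<phi>: "\<phi> \<in> HomK P"
begin

text \<open>The comodule property makes \<open>x \<mapsto> x u\<close> a finite sum of pure tensors.
  Applying \<open>\<phi>\<close> to the vectors and the twisted antipode to the functionals sends
  pure tensors to pure tensors, by \<open>Tq_antipode_twist\<close>.\<close>

lemma coind_tensor_T:
  assumes u: "u \<in> space_of W"
  shows "coind \<phi> r u \<in> tensor_T n q V"
proof -
  \<comment> \<open>\<open>\<Phi>\<close> is defined on functions and not on decompositions, so
    nothing depends on how a tensor is written; \<open>coind \<phi> r u\<close> is its value at
    \<open>x \<mapsto> x u\<close>.\<close>
  define \<Phi> where "\<Phi> \<zeta> = on_Uq n q (\<lambda>y. \<Sum>s\<in>{0, 1}.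
     scl V (sgn2 s (r + 1)) (\<phi> (\<zeta> (antipode n q (ucomps n q y s)))))" for \<zeta> :: "uq \<Rightarrow> 'w"
  interpret WT: graded_tensor n q W ..
  let ?S = "{\<zeta>. \<zeta> \<in> tensor_T n q W \<and> \<Phi> \<zeta> \<in> tensor_T n q V}"
  have sp: "\<zeta> a \<in> space_of W" if "\<zeta> \<in> tensor_T n q W" for \<zeta> a
    using WT.tlinear_space[OF WT.tensor_T_tlinear[OF that]] .
  have \<Phi>_add: "\<Phi> (\<zeta> + \<xi>) = \<Phi> \<zeta> + \<Phi> \<xi>" if "\<zeta> \<in> tensor_T n q W" "\<xi> \<in> tensor_T n q W" for \<zeta> \<xi>
    unfolding \<Phi>_def
    by (auto simp: on_Uq_def fun_eq_iff HomK_simps(2)[OF \<phi>] sp that G.scale_right_distrib algebra_simps)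
  have \<Phi>_scale: "\<Phi> (fscale W c \<zeta>) = fscale V c (\<Phi> \<zeta>)" if "\<zeta> \<in> tensor_T n q W" for c \<zeta>
    unfolding \<Phi>_def
    by (auto simp: on_Uq_def fun_eq_iff fscale_def HomK_simps(3)[OF \<phi>] sp that
        G.scale_right_distrib mult.commute)
  have "on_Uq n q (\<lambda>x. act W x u) \<in> tensor_T n q W"
    using comodule u by (simp add: T_comodule_def)
  then have "on_Uq n q (\<lambda>x. act W x u) \<in> ?S"
    unfolding tensor_T_def[of n q W]
  proof (rule W.F.span_induct[where P = "\<lambda>\<zeta>. \<zeta> \<in> ?S", unfolded tensor_T_def[of n q W]])
    show "W.F.subspace {\<zeta>. \<zeta> \<in> {\<zeta>. \<zeta> \<in> W.F.span {pure W v f |v f. v \<in> space_of W \<and> f \<in> Tq n q} \<and> \<Phi> \<zeta> \<in> tensor_T n q V}}"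
      unfolding tensor_T_def[of n q W, symmetric]
    proof (rule W.F.subspaceI)
      have "\<Phi> 0 = 0"
        using \<Phi>_scale[OF W.F.subspace_0[OF WT.tensor_T_subspace], of 0] by simp
      then show "0 \<in> {\<zeta>. \<zeta> \<in> ?S}"
        using W.F.subspace_0[OF WT.tensor_T_subspace] F.subspace_0[OF tensor_T_subspace] by simp
    qed (auto simp: \<Phi>_add \<Phi>_scale W.F.subspace_add[OF WT.tensor_T_subspace]
        W.F.subspace_scale[OF WT.tensor_T_subspace] F.subspace_add[OF tensor_T_subspace]
        F.subspace_scale[OF tensor_T_subspace])
    fix \<zeta>
    assume \<zeta>: "\<zeta> \<in> {pure W v f |v f. v \<in> space_of W \<and> f \<in> Tq n q}"
    then obtain v f where f: "\<zeta> = pure W v f" "v \<in> space_of W" "f \<in> Tq n q" by blast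
    have "\<Phi> \<zeta> = pure V (\<phi> v)
        (on_Uq n q (\<lambda>y. \<Sum>s\<in>{0, 1}. sgn2 s (r + 1) * f (antipode n q (ucomps n q y s))))"
      unfolding \<Phi>_def f(1)
      by (auto simp: on_Uq_def fun_eq_iff pure_def HomK_simps(3)[OF \<phi> f(2)] G.scale_left_distrib)
    then have "\<Phi> \<zeta> \<in> tensor_T n q V"
      unfolding tensor_T_def using Tq_antipode_twist[OF f(3)] HomK_space[OF \<phi>]
      by (intro F.span_base) blast
    then show "\<zeta> \<in> {\<zeta>. \<zeta> \<in> W.F.span {pure W v f |v f. v \<in> space_of W \<and> f \<in> Tq n q} \<and> \<Phi> \<zeta> \<in> tensor_T n q V}"
      using W.F.span_base[OF \<zeta>] by simp
  qed
  moreover have "\<Phi> (on_Uq n q (\<lambda>x. act W x u)) = coind \<phi> r u"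
    unfolding \<Phi>_def coind_def
    by (auto simp: on_Uq_def fun_eq_iff antipode_closed upart_carrier[OF ucomps(1)])
  ultimately show ?thesis by simp
qed

lemma HomK_zero: "\<phi> 0 = 0"
  using HomK_simps(3)[OF \<phi> W.space_0, of 0] by simp

lemma coind_homog:
  assumes u: "u \<in> space_of W" and y: "y \<in> upart n q s"
  shows "coind \<phi> r u y = scl V (sgn2 s (r + 1)) (\<phi> (act W (antipode n q y) u))"
proof -
  have "act W \<zero>\<^bsub>Uq n q\<^esub> u = 0"
    using W.act_uscale[OF upart_carrier[OF y] u, of 0] upart_carrier[OF y] uscale_simps(3) by simp
  then have "coind \<phi> r u y = (\<Sum>s'\<in>{0, 1}. if s' = s then
      scl V (sgn2 s' (r + 1)) (\<phi> (act W (antipode n q y) u)) else 0)"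
    unfolding coind_def on_Uq_def if_P[OF upart_carrier[OF y]]
    by (intro sum.cong refl) (auto simp: ucomps_homogeneous[OF y] antipode_zero HomK_zero)
  then show ?thesis by (simp only: sum_bit_delta)
qed

lemma coind_add:
  assumes "u \<in> space_of W" "u' \<in> space_of W"
  shows "coind \<phi> r (u + u') = coind \<phi> r u + coind \<phi> r u'"
  unfolding coind_def
  by (auto simp: on_Uq_def fun_eq_iff W.act_add assms antipode_closed upart_carrier[OF ucomps(1)]
      HomK_simps(2)[OF \<phi>] W.act_closed G.scale_right_distrib algebra_simps)

lemma coind_scale:
  assumes "u \<in> space_of W"
  shows "coind \<phi> r (scl W c u) = fscale V c (coind \<phi> r u)"
  unfolding coind_def
  by (auto simp: on_Uq_def fun_eq_iff fscale_def W.act_scale assms antipode_closed upart_carrier[OF ucomps(1)]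
      HomK_simps(3)[OF \<phi>] W.act_closed G.scale_right_distrib mult.commute)

lemma coind_thomog:
  assumes u: "u \<in> part W r"
  shows "thomog (P + r) (coind \<phi> r u)"
  unfolding thomog_def
proof (intro allI ballI)
  fix s a
  assume a: "a \<in> upart n q s"
  have "\<phi> (act W (antipode n q a) u) \<in> part V (P + (s + r))"
    by (intro HomK_simps(4)[OF \<phi>] W.act_part antipode_upart a u)
  then show "coind \<phi> r u a \<in> part V (P + r + s)"
    unfolding coind_homog[OF W.space_part[OF u] a] by (simp add: part_scale add_ac)
qed

lemma coind_tlinear: "u \<in> space_of W \<Longrightarrow> tlinear (coind \<phi> r u)"
  by (intro tensor_T_tlinear coind_tensor_T)

lemma signed_ext_ucomps:
  assumes "x \<in> carrier (Uq n q)" "op \<zero>\<^bsub>Uq n q\<^esub> \<zeta> a = 0"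
  shows "signed_ext n q V op x \<zeta> a
    = signed_ext n q V op (ucomps n q x 0) \<zeta> a + signed_ext n q V op (ucomps n q x 1) \<zeta> a"
  using assms
  by (simp add: signed_ext_def ucomps_homogeneous[OF ucomps(1)] vcomp_0)

text \<open>\<open>S(a x)\<close> is \<open>S(x) S(a)\<close> up to sign, and \<open>S(x)\<close>
  lies in \<open>Uk\<close> again, so the equivariance of \<open>\<phi>\<close> moves it out. Signs
  are settled for homogeneous \<open>x\<close> and \<open>a\<close>; the rest is additivity.\<close>

lemma coind_Gamma:
  assumes u: "u \<in> part W r"
  shows "coind \<phi> r u \<in> Gamma n q \<Theta> V"
proof -
  interpret ring "Uq n q" by (rule ring_Uq)
  let ?\<zeta> = "coind \<phi> r u"
  note us = W.space_part[OF u]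
  note lin = coind_tlinear[OF us, of r] and hom = coind_thomog[OF u]
  have homog: "circ_tensor n q V x ?\<zeta> a = act V (antipode n q x) (?\<zeta> a)"
    if x: "x \<in> Uk n q \<Theta>" "x \<in> upart n q p" and a: "a \<in> upart n q t" for x p a t
  proof -
    let ?w = "act W (antipode n q a) u"
    note c = upart_carrier[OF x(2)] upart_carrier[OF a]
    have w: "?w \<in> space_of W" using c us by (intro W.act_closed antipode_closed)
    have "\<phi> (act W (antipode n q (a \<otimes>\<^bsub>Uq n q\<^esub> x)) u)
        = scl V (sgn2 t p) (\<phi> (act W (antipode n q x) ?w))"
      using c us by (simp add: antipode_mult[OF a x(2)] W.act_uscale W.act_mult antipode_closed
          W.act_closed HomK_simps(3)[OF \<phi>])
    then have "circ_tensor n q V x ?\<zeta> a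
        = scl V (sgn2 p (P + r + t + p) * (sgn2 (t + p) (r + 1) * sgn2 t p)) (\<phi> (act W (antipode n q x) ?w))"
      using circ_tensor_homog[OF lin hom x(2) a] coind_homog[OF us upart_mult[OF a x(2)]] by simp
    also have "sgn2 p (P + r + t + p) * (sgn2 (t + p) (r + 1) * sgn2 t p) = sgn2 t (r + 1) * sgn2 P p"
      by (cases p; cases P; cases r; cases t; simp add: sgn2_def)
    also have "scl V \<dots> (\<phi> (act W (antipode n q x) ?w)) = scl V (sgn2 t (r + 1)) (act V (antipode n q x) (\<phi> ?w))"
      using HomK_simps(5)[OF \<phi> Uk_antipode[OF \<Theta> x(1)] antipode_upart[OF x(2)] w] by simp
    also have "\<dots> = act V (antipode n q x) (?\<zeta> a)"
      using coind_homog[OF us a] V_act(2)[OF Uk_antipode[OF \<Theta> x(1)] HomK_space[OF \<phi>]] by simp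
    finally show ?thesis .
  qed
  have "circ_tensor n q V x ?\<zeta> a = act V (antipode n q x) (?\<zeta> a)" if x: "x \<in> Uk n q \<Theta>" for x a
  proof (cases "a \<in> carrier (Uq n q)")
    case True
    note xc = Uk_carrier[OF \<Theta> x] and ac = ucomps[OF True]
    note aa = upart_carrier[OF ac(1)]
    have circ_x: "circ_tensor n q V y ?\<zeta> a
        = circ_tensor n q V y ?\<zeta> (ucomps n q a 0) + circ_tensor n q V y ?\<zeta> (ucomps n q a 1)"
      if y: "y \<in> carrier (Uq n q)" for y
    proof -
      have "circ n q z ?\<zeta> a = circ n q z ?\<zeta> (ucomps n q a 0) + circ n q z ?\<zeta> (ucomps n q a 1)"
        if z: "z \<in> carrier (Uq n q)" for z
      proof -
        have "a \<otimes>\<^bsub>Uq n q\<^esub> z = ucomps n q a 0 \<otimes>\<^bsub>Uq n q\<^esub> z \<oplus>\<^bsub>Uq n q\<^esub> ucomps n q a 1 \<otimes>\<^bsub>Uq n q\<^esub> z"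
          using ac(2) aa z by (metis l_distr)
        then show ?thesis
          using tlinear_add[OF lin, of "ucomps n q a 0 \<otimes>\<^bsub>Uq n q\<^esub> z" "ucomps n q a 1 \<otimes>\<^bsub>Uq n q\<^esub> z"] True aa z
          by (simp add: circ_def on_Uq_def)
      qed
      moreover have "circ n q z ?\<zeta> b \<in> space_of V" for z b
        using tlinear_space[OF lin] space_0 by (simp add: circ_def on_Uq_def)
      ultimately show ?thesis
        unfolding circ_tensor_def signed_ext_def
        by (simp add: upart_carrier[OF ucomps(1)[OF y]] vcomp_add G.scale_right_distrib algebra_simps)
    qed
    let ?x = "ucomps n q x"
    \<comment> \<open>The components of \<open>x\<close> stay in \<open>Uk\<close>, which lets the
      homogeneous case apply to them.\<close>
    have Ux: "?x p \<in> Uk n q \<Theta>" for p by (rule Uk_ucomps[OF \<Theta> x])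
    have "circ n q \<zero>\<^bsub>Uq n q\<^esub> ?\<zeta> a = 0"
      using True tlinear_zero[OF lin] by (simp add: circ_def on_Uq_def)
    then have "circ_tensor n q V x ?\<zeta> a = circ_tensor n q V (?x 0) ?\<zeta> a + circ_tensor n q V (?x 1) ?\<zeta> a"
      unfolding circ_tensor_def by (intro signed_ext_ucomps xc)
    also have "\<dots> = act V (antipode n q (?x 0)) (?\<zeta> a) + act V (antipode n q (?x 1)) (?\<zeta> a)"
    proof -
      have "circ_tensor n q V (?x p) ?\<zeta> a = act V (antipode n q (?x p)) (?\<zeta> a)" for p
      proof -
        have "?\<zeta> a = ?\<zeta> (ucomps n q a 0) + ?\<zeta> (ucomps n q a 1)"
          using tlinear_add[OF lin aa aa, of 0 1] ac(2) by simp
        then show ?thesis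
          using homog[OF Ux ucomps(1)[OF xc] ac(1), of p] circ_x[OF upart_carrier[OF ucomps(1)[OF xc]], of p]
            V_act(1)[OF Uk_antipode[OF \<Theta> Ux] tlinear_space[OF lin] tlinear_space[OF lin]]
          by simp
      qed
      then show ?thesis by simp
    qed
    also have "\<dots> = act V (antipode n q x) (?\<zeta> a)"
    proof -
      have "antipode n q x = antipode n q (?x 0) \<oplus>\<^bsub>Uq n q\<^esub> antipode n q (?x 1)"
        using antipode_add[OF upart_carrier upart_carrier, OF ucomps(1)[OF xc, of 0] ucomps(1)[OF xc, of 1]]
          ucomps(2)[OF xc] by simp
      then show ?thesis
        using V_act(3)[OF Uk_antipode[OF \<Theta> Ux] Uk_antipode[OF \<Theta> Ux] tlinear_space[OF lin]] by simp
    qed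
    finally show ?thesis .
  next
    case False
    then show ?thesis
      using V_act_0[OF Uk_antipode[OF \<Theta> x]] tlinear_outside[OF lin False]
      by (simp add: circ_tensor_def signed_ext_def circ_def on_Uq_def vcomp_0)
  qed
  then show ?thesis using coind_tensor_T[OF us] by (auto simp: Gamma_def)
qed

text \<open>The antipode undoes the inverse antipode in the action: \<open>S(S^{-1}(x) a)\<close> is
  \<open>S(a) x\<close> up to sign. The degree index of \<open>coind\<close> changes to
  \<open>s + r\<close> because \<open>x u\<close> has that parity.\<close>

lemma dot_tensor_coind:
  assumes u: "u \<in> part W r" and x: "x \<in> upart n q s"
  shows "dot_tensor n q V x (coind \<phi> r u) = fscale V (sgn2 P s) (coind \<phi> (s + r) (act W x u))"
proof
  interpret ring "Uq n q" by (rule ring_Uq)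
  let ?\<zeta> = "coind \<phi> r u" and ?\<xi> = "coind \<phi> (s + r) (act W x u)"
  note us = W.space_part[OF u] and xc = upart_carrier[OF x]
  note lin = coind_tlinear[OF us, of r] and hom = coind_thomog[OF u]
  have xu: "act W x u \<in> space_of W" by (rule W.act_closed[OF xc us])
  have lin': "tlinear (fscale V (sgn2 P s) ?\<xi>)"
    using F.subspace_scale[OF tlinear_subspace] coind_tlinear[OF xu] by simp
  have homog: "dot_tensor n q V x ?\<zeta> a = fscale V (sgn2 P s) ?\<xi> a" if a: "a \<in> upart n q t" for a t
  proof -
    note ac = upart_carrier[OF a] and y = antipode_inv_upart[OF x]
    have "\<phi> (act W (antipode n q (antipode_inv n q x \<otimes>\<^bsub>Uq n q\<^esub> a)) u)
        = scl V (sgn2 s t) (\<phi> (act W (antipode n q a) (act W x u)))"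
      using xc ac us xu by (simp add: antipode_mult[OF y a] antipode_inv(2) W.act_uscale W.act_mult antipode_closed
          W.act_closed HomK_simps(3)[OF \<phi>])
    then have "dot_tensor n q V x ?\<zeta> a = scl V (sgn2 s (P + r + s) * (sgn2 (s + t) (r + 1) * sgn2 s t))
        (\<phi> (act W (antipode n q a) (act W x u)))"
      using dot_tensor_homog[OF lin hom x a] coind_homog[OF us upart_mult[OF y a]] by simp
    also have "sgn2 s (P + r + s) * (sgn2 (s + t) (r + 1) * sgn2 s t) = sgn2 P s * sgn2 t (s + r + 1)"
      by (cases s; cases P; cases r; cases t; simp add: sgn2_def)
    finally show ?thesis using coind_homog[OF xu a, of "s + r"] by (simp add: fscale_def)
  qed
  fix a
  show "dot_tensor n q V x ?\<zeta> a = fscale V (sgn2 P s) ?\<xi> a"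
  proof (cases "a \<in> carrier (Uq n q)")
    case True
    note ac = ucomps[OF True]
    note aa = upart_carrier[OF ac(1)]
    have "dot (scl V) n q z ?\<zeta> a = dot (scl V) n q z ?\<zeta> (ucomps n q a 0) + dot (scl V) n q z ?\<zeta> (ucomps n q a 1)"
      if z: "z \<in> carrier (Uq n q)" for z
    proof -
      note zz = upart_carrier[OF ucomps(1)[OF antipode_inv(1)[OF z]]]
      show ?thesis
        unfolding dot_def on_Uq_def if_P[OF True] if_P[OF aa]
        by (simp add: ucomps_homogeneous[OF ac(1)] zz tlinear_zero[OF lin])
    qed
    then have "dot_tensor n q V x ?\<zeta> a
        = dot_tensor n q V x ?\<zeta> (ucomps n q a 0) + dot_tensor n q V x ?\<zeta> (ucomps n q a 1)"
      unfolding dot_tensor_def signed_ext_def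
      by (simp add: upart_carrier[OF ucomps(1)[OF xc]] vcomp_add dot_space[OF lin] G.scale_right_distrib algebra_simps)
    then show ?thesis
      using homog[OF ac(1)] tlinear_add[OF lin' aa aa, of 0 1] ac(2) by simp
  next
    case False
    then show ?thesis
      using tlinear_outside[OF lin' False]
      by (simp add: dot_tensor_def signed_ext_def dot_def on_Uq_def vcomp_0)
  qed
qed

lemma HomG_exists: "\<exists>\<psi>\<in>HomG P. eval_one n q \<psi> = \<phi>"
proof -
  \<comment> \<open>\<open>coind\<close> carries a sign that depends on the degree of its argument,
    so it is applied to the homogeneous components of \<open>w\<close>.\<close>
  define \<psi> where "\<psi> w = (if w \<in> space_of W then coind \<phi> 0 (vcomp W 0 w) + coind \<phi> 1 (vcomp W 1 w) else 0)" for w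
  have vs: "vcomp W r w \<in> space_of W" if "w \<in> space_of W" for r w
    using W.vcomp_in_part[OF that] W.space_part by blast
  have zero: "coind \<phi> r 0 = 0" for r
    using coind_scale[OF W.space_0, of r 0] by simp
  have part: "\<psi> w = coind \<phi> r w" if "w \<in> part W r" for w r
    using W.space_part[OF that] W.vcomp_part[OF that] zero by (cases r) (simp_all add: \<psi>_def)
  have add: "\<psi> (w + w') = \<psi> w + \<psi> w'" if "w \<in> space_of W" "w' \<in> space_of W" for w w'
    using that by (simp add: \<psi>_def W.space_add W.vcomp_add coind_add vs add_ac)
  have lin: "tlinear (\<psi> w)" if "w \<in> space_of W" for w
    using F.subspace_add[OF tlinear_subspace] coind_tlinear vs that by (simp add: \<psi>_def)
  have "\<psi> \<in> HomG P"
    unfolding Hom_part_def mem_Collect_eq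
  proof (intro conjI allI ballI impI)
    show "\<psi> (w + w') = \<psi> w + \<psi> w'" if "w \<in> space_of W" "w' \<in> space_of W" for w w' by (rule add[OF that])
    show "\<psi> w = 0" if "w \<notin> space_of W" for w using that by (simp add: \<psi>_def)
    show "\<psi> (scl W c w) = scl (induced n q \<Theta> V) c (\<psi> w)" if "w \<in> space_of W" for w c
      using that
      by (simp add: \<psi>_def induced_def W.space_scale W.vcomp_scale coind_scale vs F.scale_right_distrib)
    show "\<psi> w \<in> part (induced n q \<Theta> V) (P + r)" if w: "w \<in> part W r" for r w
      using coind_Gamma[OF w] thomog_tensor_T_part[OF coind_tensor_T[OF W.space_part[OF w]] coind_thomog[OF w]]
      by (simp add: part[OF w] induced_def)
    fix s x w
    assume x: "x \<in> carrier (Uq n q) \<inter> upart n q s" and w: "w \<in> space_of W"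
    have "dot_tensor n q V x (\<psi> w) = fscale V (sgn2 P s) (\<psi> (act W x w))"
      using w
    proof (induction rule: space_induct)
      case (1 r w)
      then show ?case using x dot_tensor_coind[OF 1, of x s] part[OF 1] part[OF W.act_part[OF _ 1, of x s]] by simp
    next
      case (2 w w')
      have xc: "x \<in> carrier (Uq n q)" using x by blast
      show ?case
        unfolding add[OF 2(1,2)] W.act_add[OF xc 2(1,2)] add[OF W.act_closed W.act_closed, OF xc 2(1) xc 2(2)]
          dot_tensor_add[OF lin[OF 2(1)] lin[OF 2(2)]] 2(3,4) F.scale_right_distrib ..
    qed
    then show "act (induced n q \<Theta> V) x (\<psi> w) = scl (induced n q \<Theta> V) (sgn2 P s) (\<psi> (act W x w))"
      by (simp add: induced_def)
  qed
  moreover have "eval_one n q \<psi> w = \<phi> w" for w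
  proof (cases "w \<in> space_of W")
    case True
    have "coind \<phi> r u \<one>\<^bsub>Uq n q\<^esub> = \<phi> u" if "u \<in> space_of W" for r u
      using coind_homog[OF that upart_one] antipode_generators(1)[of 1] n_pos W.act_one[OF that]
      by (simp add: sgn2_def)
    then show ?thesis
      using True vs HomK_simps(2)[OF \<phi> vs vs, OF True True, of 0 1] W.vcomp_decomp[OF True]
      by (simp add: eval_one_def \<psi>_def)
  qed (simp add: eval_one_def \<psi>_def HomK_simps(1)[OF \<phi>])
  ultimately show ?thesis by blast
qed

end

section \<open>From homogeneous homomorphisms to all homomorphisms\<close>

lemma eval_one_add: "eval_one n q (\<psi> + \<psi>') = eval_one n q \<psi> + eval_one n q \<psi>'"
  by (auto simp: eval_one_def)

lemma eval_one_Hom_part: "eval_one n q ` HomG P = HomK P"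
  using eval_one_HomK HomG_exists by blast

lemma eval_one_bij:
  "bij_betw (eval_one n q) (Hom n q (carrier (Uq n q)) W (induced n q \<Theta> V)) (Hom n q (Uk n q \<Theta>) W V)"
  unfolding bij_betw_def
proof
  show "inj_on (eval_one n q) (Hom n q (carrier (Uq n q)) W (induced n q \<Theta> V))"
  proof (rule inj_onI)
    fix \<psi> \<psi>'
    assume "\<psi> \<in> Hom n q (carrier (Uq n q)) W (induced n q \<Theta> V)"
      "\<psi>' \<in> Hom n q (carrier (Uq n q)) W (induced n q \<Theta> V)" and eq: "eval_one n q \<psi> = eval_one n q \<psi>'"
    then obtain \<psi>0 \<psi>1 \<psi>0' \<psi>1' where *: "\<psi>0 \<in> HomG 0" "\<psi>1 \<in> HomG 1" "\<psi>0' \<in> HomG 0" "\<psi>1' \<in> HomG 1"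
        "\<psi> = \<psi>0 + \<psi>1" "\<psi>' = \<psi>0' + \<psi>1'"
      by (auto simp: Hom_def)
    have "eval_one n q \<psi>0 = eval_one n q \<psi>0' \<and> eval_one n q \<psi>1 = eval_one n q \<psi>1'"
      using HomK_sum_unique[OF eval_one_HomK eval_one_HomK eval_one_HomK eval_one_HomK, OF *(1-4)] eq
      by (simp add: *(5,6) eval_one_add)
    then show "\<psi> = \<psi>'" using HomG_eqI *(1-4) unfolding *(5,6) by metis
  qed
  show "eval_one n q ` Hom n q (carrier (Uq n q)) W (induced n q \<Theta> V) = Hom n q (Uk n q \<Theta>) W V"
  proof
    show "eval_one n q ` Hom n q (carrier (Uq n q)) W (induced n q \<Theta> V) \<subseteq> Hom n q (Uk n q \<Theta>) W V"
      using eval_one_HomK by (force simp: Hom_def eval_one_add)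
    show "Hom n q (Uk n q \<Theta>) W V \<subseteq> eval_one n q ` Hom n q (carrier (Uq n q)) W (induced n q \<Theta> V)"
    proof
      fix \<phi>
      assume "\<phi> \<in> Hom n q (Uk n q \<Theta>) W V"
      then obtain \<phi>0 \<phi>1 where "\<phi>0 \<in> HomK 0" "\<phi>1 \<in> HomK 1" "\<phi> = \<phi>0 + \<phi>1" by (auto simp: Hom_def)
      moreover from this obtain \<psi>0 \<psi>1 where "\<psi>0 \<in> HomG 0" "\<psi>1 \<in> HomG 1"
          "eval_one n q \<psi>0 = \<phi>0" "eval_one n q \<psi>1 = \<phi>1"
        using HomG_exists by metis
      ultimately have "\<psi>0 + \<psi>1 \<in> Hom n q (carrier (Uq n q)) W (induced n q \<Theta> V)"
          "\<phi> = eval_one n q (\<psi>0 + \<psi>1)"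
        by (auto simp: Hom_def eval_one_add)
      then show "\<phi> \<in> eval_one n q ` Hom n q (carrier (Uq n q)) W (induced n q \<Theta> V)" by blast
    qed
  qed
qed

end

theorem theorem5:
  fixes n :: nat and q :: complex and \<Theta> :: "nat set"
    and V :: "('v::ab_group_add) smod" and W :: "('w::ab_group_add) smod"
  assumes "n \<ge> 1"
    and "q \<noteq> 0" and "\<forall>m>0. q ^ m \<noteq> 1"
    and "\<Theta> \<subseteq> {1..n}"
    and "is_module n q (Uk n q \<Theta>) V" and "finite_dim V"
    and "is_module n q (carrier (Uq n q)) W" and "T_comodule n q W"
  shows "bij_betw (eval_one n q)
           (Hom n q (carrier (Uq n q)) W (induced n q \<Theta> V))
           (Hom n q (Uk n q \<Theta>) W V)
       \<and> (\<forall>p. eval_one n q ` Hom_part n q (carrier (Uq n q)) W (induced n q \<Theta> V) p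
              = Hom_part n q (Uk n q \<Theta>) W V p)
       \<and> (\<forall>\<psi>\<in>Hom n q (carrier (Uq n q)) W (induced n q \<Theta> V).
          \<forall>\<psi>'\<in>Hom n q (carrier (Uq n q)) W (induced n q \<Theta> V).
            eval_one n q (\<psi> + \<psi>') = eval_one n q \<psi> + eval_one n q \<psi>')
       \<and> (\<forall>c. \<forall>\<psi>\<in>Hom n q (carrier (Uq n q)) W (induced n q \<Theta> V).
            eval_one n q (\<lambda>w. scl (induced n q \<Theta> V) c (\<psi> w))
              = (\<lambda>w. scl V c (eval_one n q \<psi> w)))"
proof -
  interpret reciprocity n q V W \<Theta>
    using assms by unfold_locales (auto simp: is_module_def vector_space_def)
  show ?thesis
  proof (intro conjI allI ballI)
    show "eval_one n q (\<lambda>w. scl (induced n q \<Theta> V) c (\<psi> w)) = (\<lambda>w. scl V c (eval_one n q \<psi> w))" for c \<psi>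
      by (simp add: eval_one_def induced_def fscale_def)
  qed (rule eval_one_bij eval_one_Hom_part eval_one_add)+
qed

end
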